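(* Let $G$ be a transitive nonunimodular graph and consider Bernoulli$(p)$ edge percolation on $G$. Then almost surely, for every cluster $C$: $C$ is heavy if and only if $C$ intersects each level of $G$ in infinitely many vertices.
   Context: All graphs are locally finite; transitive graphs are infinite and connected. $\mathrm{Aut}(G)$ is the automorphism group of $G$, and $S_x=\{g\in \mathrm{Aut}(G): g(x)=x\}$ is the stabilizer of a vertex $x$. A transitive graph $G$ is unimodular if $|S_xy|=|S_yx|$ for all $x,y\in V(G)$; otherwise it is nonunimodular. Fix a vertex $o$; the weight of $x\in V(G)$ is $w(x)=|S_xo|/|S_ox|$ (independent of $o$ up to a constant factor; it satisfies $|S_xy|/|S_yx|=w(x)/w(y)$). A level of $G$ is a maximal set of vertices any two of which satisfy $|S_xy|=|S_yx|$, i.e. a maximal set of vertices of equal weight. In Bernoulli$(p)$ edge percolation each edge is independently kept (open) with probability $p$ and removed (closed) with probability $1-p$; clusters are the connected components of the resulting open subgraph (on all vertices). A cluster $C$ is heavy if $\sum_{x\in C}w(x)=\infty$ and light otherwise. *)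

theory Defs
  imports "HOL-Probability.Probability"
begin

text \<open>
  The vertex set of a graph is the whole type \<open>'v\<close>, and a graph is given by its adjacency
  relation. Edges are unordered, so that the two orientations share one percolation variable.
\<close>

type_synonym 'v graph = "'v \<Rightarrow> 'v \<Rightarrow> bool"

definition simple_graph :: "'v graph \<Rightarrow> bool" where
  "simple_graph G \<longleftrightarrow> symp G \<and> irreflp G"

definition edges :: "'v graph \<Rightarrow> 'v set set" where
  "edges G = {{x, y} | x y. G x y}"

definition locally_finite_graph :: "'v graph \<Rightarrow> bool" where
  "locally_finite_graph G \<longleftrightarrow> (\<forall>x. finite {y. G x y})"

definition connected_graph :: "'v graph \<Rightarrow> bool" where
  "connected_graph G \<longleftrightarrow> (\<forall>x y. G\<^sup>*\<^sup>* x y)"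

definition Aut :: "'v graph \<Rightarrow> ('v \<Rightarrow> 'v) set" where
  "Aut G = {g. bij g \<and> (\<forall>x y. G (g x) (g y) \<longleftrightarrow> G x y)}"

text \<open>Transitive graphs are by convention infinite, connected and locally finite.\<close>

definition transitive_graph :: "'v graph \<Rightarrow> bool" where
  "transitive_graph G \<longleftrightarrow>
     simple_graph G \<and> locally_finite_graph G \<and> connected_graph G \<and> infinite (UNIV :: 'v set) \<and>
     (\<forall>x y. \<exists>g\<in>Aut G. g x = y)"

definition stabilizer :: "'v graph \<Rightarrow> 'v \<Rightarrow> ('v \<Rightarrow> 'v) set" where
  "stabilizer G x = {g \<in> Aut G. g x = x}"

definition stab_orbit :: "'v graph \<Rightarrow> 'v \<Rightarrow> 'v \<Rightarrow> 'v set" where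
  "stab_orbit G x y = (\<lambda>g. g y) ` stabilizer G x"

text \<open>
  In a connected locally finite graph all sets \<open>stab_orbit G x y\<close> are finite, so the
  convention that infinite sets have \<open>card\<close> zero does not interfere below.
\<close>

definition unimodular :: "'v graph \<Rightarrow> bool" where
  "unimodular G \<longleftrightarrow> (\<forall>x y. card (stab_orbit G x y) = card (stab_orbit G y x))"

text \<open>The first vertex argument is the fixed reference vertex.\<close>

definition weight :: "'v graph \<Rightarrow> 'v \<Rightarrow> 'v \<Rightarrow> real" where
  "weight G r x = real (card (stab_orbit G x r)) / real (card (stab_orbit G r x))"

definition same_level :: "'v graph \<Rightarrow> 'v set \<Rightarrow> bool" where
  "same_level G L \<longleftrightarrow>
     (\<forall>x\<in>L. \<forall>y\<in>L. card (stab_orbit G x y) = card (stab_orbit G y x))"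

definition is_level :: "'v graph \<Rightarrow> 'v set \<Rightarrow> bool" where
  "is_level G L \<longleftrightarrow> same_level G L \<and> (\<forall>L'. same_level G L' \<and> L \<subseteq> L' \<longrightarrow> L' = L)"

definition bernoulli_percolation :: "'v graph \<Rightarrow> real \<Rightarrow> ('v set \<Rightarrow> bool) measure" where
  "bernoulli_percolation G p = Pi\<^sub>M (edges G) (\<lambda>_. measure_pmf (bernoulli_pmf p))"

definition open_subgraph :: "'v graph \<Rightarrow> ('v set \<Rightarrow> bool) \<Rightarrow> 'v graph" where
  "open_subgraph G \<omega> x y \<longleftrightarrow> G x y \<and> \<omega> {x, y}"

definition clusters :: "'v graph \<Rightarrow> ('v set \<Rightarrow> bool) \<Rightarrow> 'v set set" where
  "clusters G \<omega> = {{y. (open_subgraph G \<omega>)\<^sup>*\<^sup>* x y} | x. True}"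

text \<open>The sum is taken in \<^typ>\<open>ennreal\<close>, where it always exists.\<close>

definition heavy :: "'v graph \<Rightarrow> 'v \<Rightarrow> 'v set \<Rightarrow> bool" where
  "heavy G r C \<longleftrightarrow> (\<Sum>\<^sub>\<infinity>x\<in>C. ennreal (weight G r x)) = \<infinity>"

end

theory Submission
  imports Defs
begin

text \<open>
  Weights turn the mass transport principle into \<open>E (\<Sum>y. f o y) = E (\<Sum>x. f x o * w x / w o)\<close>, so no
  finite nonempty set can be selected equivariantly from infinite weight. Applied to the vertices of
  maximal weight, and combined with infinitely many independent attempts to step upwards, this gives
  a heavy cluster infinitely many vertices above every weight. Similar attempts show that a cluster
  meeting one level infinitely often meets every level infinitely often.

  It remains to exclude \<^emph>\<open>thin\<close> clusters: heavy ones all of whose levels are finite. Selecting the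
  thin vertices of a level shows that there would be infinitely many thin clusters, and by finite
  energy three of them could be joined into one having an open ball (a trifurcation) whose removal
  leaves three heavy components, each of unbounded weight. Weights lie in an abelian, hence amenable,
  group, so a thin cluster is exhausted by finite sets cut out by Folner sets of weights.
  The Burton-Keane argument, applied to all vertices above a given weight and integrated over that
  weight, bounds the weighted proportion of trifurcations in such a set by \<open>N / M\<close>, once each of the
  three branches contains \<open>M\<close> heavier vertices of the set. As \<open>M\<close> is arbitrary, trifurcations
  have probability zero.
\<close>

text \<open>A nonunimodular transitive graph is nonamenable, so counting trifurcations against the
  boundary of large finite sets of \<open>G\<close> leads nowhere. Amenability survives only in the
  group of weight ratios. A thin cluster has finitely many vertices of each weight, so a finite
  window of weights cuts a finite set out of it, and the count can be made there against the volume
  of this set instead of a boundary: every branch holds \<open>M\<close> of its points, whence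
  \<open>1 / M\<close>, while \<open>N\<close> is the size of a ball of radius \<open>2 * R\<close>,
  the price of making the balls at the trifurcations disjoint. The mass transport principle,
  however, compares weights and not numbers. The count is therefore made for the vertices of weight
  at least \<open>s\<close>, for every \<open>s > 0\<close>. The \<open>M\<close> points of a branch
  survive each truncation that keeps their trifurcation because they are required to be at least as
  heavy as it; this is why heavy components must have unbounded weights. Since \<open>M\<close>
  tends to infinity, crude constants suffice elsewhere: half of a Folner set being interior is
  enough.\<close>

section \<open>Automorphisms and graph balls\<close>

lemma Aut_id: "(\<lambda>x. x) \<in> Aut G"
  by (simp add: Aut_def bij_id[unfolded id_def])

lemma Aut_comp: "g \<in> Aut G \<Longrightarrow> h \<in> Aut G \<Longrightarrow> (\<lambda>x. g (h x)) \<in> Aut G"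
  using bij_comp[of h g] by (auto simp: Aut_def comp_def)

lemma Aut_inv: "g \<in> Aut G \<Longrightarrow> inv g \<in> Aut G"
proof -
  assume g: "g \<in> Aut G"
  then have b: "bij g" by (simp add: Aut_def)
  have "G (inv g x) (inv g y) \<longleftrightarrow> G x y" for x y
  proof -
    have "G (g (inv g x)) (g (inv g y)) \<longleftrightarrow> G (inv g x) (inv g y)" using g by (simp add: Aut_def)
    then show ?thesis using b by (simp add: bij_is_surj surj_f_inv_f)
  qed
  then show ?thesis using b by (simp add: Aut_def bij_imp_bij_inv)
qed

lemma Aut_inv_left: "g \<in> Aut G \<Longrightarrow> inv g (g x) = x"
  by (simp add: Aut_def bij_is_inj)

lemma Aut_inv_right: "g \<in> Aut G \<Longrightarrow> g (inv g x) = x"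
  by (simp add: Aut_def bij_is_surj surj_f_inv_f)

lemma Aut_edge: "g \<in> Aut G \<Longrightarrow> G (g x) (g y) \<longleftrightarrow> G x y"
  by (simp add: Aut_def)

lemma Aut_bij: "g \<in> Aut G \<Longrightarrow> bij g"
  by (simp add: Aut_def)

lemma card_Aut_image: "g \<in> Aut G \<Longrightarrow> card (g ` A) = card A"
  by (metis Aut_bij bij_is_inj card_image inj_on_subset subset_UNIV)

lemma stab_orbit_eq: "stab_orbit G x y = {g y | g. g \<in> Aut G \<and> g x = x}"
  by (auto simp: stab_orbit_def stabilizer_def)

lemma relpowp_map:
  assumes "\<And>x y. R x y \<Longrightarrow> S (f x) (f y)" and "(R ^^ n) x y"
  shows "(S ^^ n) (f x) (f y)"
  using assms(2)
proof (induction n arbitrary: y)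
  case (Suc n)
  then show ?case using assms(1) by (auto intro!: relcomppI)
qed simp

definition gball :: "'v graph \<Rightarrow> nat \<Rightarrow> 'v \<Rightarrow> 'v set" where
  "gball G n x = {y. \<exists>k\<le>n. (G ^^ k) x y}"

lemma gball_self: "x \<in> gball G n x"
  unfolding gball_def by (intro CollectI exI[of _ 0]) simp

lemma gball_Aut:
  assumes "g \<in> Aut G" shows "g y \<in> gball G n (g x) \<longleftrightarrow> y \<in> gball G n x"
proof -
  have 1: "(G ^^ k) (h u) (h v)" if "h \<in> Aut G" "(G ^^ k) u v" for h k u v
    using relpowp_map[of G G h k u v] that by (simp add: Aut_edge)
  have "(G ^^ k) (g x) (g y) \<longleftrightarrow> (G ^^ k) x y" for k
    using 1[OF assms] 1[OF Aut_inv[OF assms], of k "g x" "g y"] assms by (auto simp: Aut_inv_left)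
  then show ?thesis by (simp add: gball_def)
qed

text \<open>Orbit-stabilizer for pairs: a group element \<open>h\<close> carries the fibre over
  \<open>y\<close> of the orbit of \<open>(y, z)\<close> bijectively onto the fibre over
  \<open>h y\<close>, so all fibres have one size. \<open>P\<close> will be membership in the
  stabilizer of a third vertex.\<close>

lemma card_pair_orbit:
  assumes H: "\<And>g h. P g \<Longrightarrow> P h \<Longrightarrow> P (\<lambda>x. g (h x))"
    and I: "\<And>g. P g \<Longrightarrow> P (inv g) \<and> bij g"
    and fin: "finite {g y | g. P g}" "finite {g z | g. P g}"
  shows "card {(g y, g z) | g. P g} = card {g y | g. P g} * card {g z | g. P g \<and> g y = y}"
proof -
  have eq: "{(g y, g z) | g. P g} = (SIGMA u:{g y | g. P g}. {g z | g. P g \<and> g y = u})"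
    by auto metis
  have fib: "card {g z | g. P g \<and> g y = h y} = card {g z | g. P g \<and> g y = y}" if "P h" for h
  proof -
    have "{g z | g. P g \<and> g y = h y} = h ` {g z | g. P g \<and> g y = y}" (is "?A = ?B")
    proof
      show "?B \<subseteq> ?A"
      proof
        fix v assume "v \<in> ?B"
        then obtain g where "P g" "g y = y" "v = h (g z)" by auto
        then show "v \<in> ?A" using H[OF that] by (intro CollectI exI[of _ "\<lambda>x. h (g x)"]) simp
      qed
      show "?A \<subseteq> ?B"
      proof
        fix v assume "v \<in> ?A"
        then obtain g where g: "P g" "g y = h y" "v = g z" by auto
        have i: "bij h" "P (inv h)" using I[OF that] by auto
        have "P (\<lambda>x. inv h (g x))" using H[OF i(2) g(1)] .
        moreover have "inv h (g y) = y" using g i by (simp add: bij_is_inj)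
        moreover have "v = h (inv h (g z))" using g i by (simp add: bij_is_surj surj_f_inv_f)
        ultimately show "v \<in> ?B"
          by (intro image_eqI[of v h "inv h (g z)"] CollectI exI[of _ "\<lambda>x. inv h (g x)"]) auto
      qed
    qed
    moreover have "inj h" using I[OF that] bij_is_inj by blast
    ultimately show ?thesis by (simp add: card_image inj_on_subset)
  qed
  have "card {(g y, g z) | g. P g} = (\<Sum>u\<in>{g y | g. P g}. card {g z | g. P g \<and> g y = u})"
    unfolding eq using fin by (intro card_SigmaI) (auto elim: finite_subset[rotated])
  also have "\<dots> = (\<Sum>u\<in>{g y | g. P g}. card {g z | g. P g \<and> g y = y})"
    by (intro sum.cong) (auto simp: fib)
  finally show ?thesis by simp
qed

lemma gball_image: assumes "g \<in> Aut G" shows "g ` gball G n x = gball G n (g x)"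
proof
  show "g ` gball G n x \<subseteq> gball G n (g x)" using gball_Aut[OF assms] by auto
  show "gball G n (g x) \<subseteq> g ` gball G n x"
  proof
    fix u assume "u \<in> gball G n (g x)"
    then have "inv g u \<in> gball G n x"
      using gball_Aut[OF assms, of "inv g u" n x] by (simp add: Aut_inv_right[OF assms])
    then show "u \<in> g ` gball G n x" using Aut_inv_right[OF assms, of u] by (metis image_eqI)
  qed
qed

locale perc_graph =
  fixes G :: "'v graph" and r :: 'v
  assumes trans: "transitive_graph G" and nonuni: "\<not> unimodular G"
begin

abbreviation w :: "'v \<Rightarrow> real" where "w \<equiv> weight G r"

lemma sym: "G x y \<Longrightarrow> G y x"
  using trans by (auto simp: transitive_graph_def simple_graph_def symp_def)

lemma fin_nbrs: "finite {y. G x y}"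
  using trans by (auto simp: transitive_graph_def locally_finite_graph_def)

lemma conn: "G\<^sup>*\<^sup>* x y"
  using trans by (auto simp: transitive_graph_def connected_graph_def)

lemma transE: obtains g where "g \<in> Aut G" "g x = y"
  using trans by (auto simp: transitive_graph_def)

lemma finite_relpow: "finite {y. (G ^^ k) x y}"
proof (induction k)
  case (Suc k)
  have "{y. (G ^^ Suc k) x y} = (\<Union>z\<in>{z. (G ^^ k) x z}. {y. G z y})" by auto
  then show ?case using Suc fin_nbrs by simp
qed simp

lemma finite_gball: "finite (gball G n x)"
proof -
  have "gball G n x = (\<Union>k\<in>{..n}. {y. (G ^^ k) x y})" by (auto simp: gball_def)
  then show ?thesis by (simp add: finite_relpow)
qed

lemma ex_gball: "\<exists>n. y \<in> gball G n x"
  using conn[of x y] by (auto simp: gball_def rtranclp_power)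

lemma gball_mono: "m \<le> n \<Longrightarrow> gball G m x \<subseteq> gball G n x"
  unfolding gball_def using order_trans by blast

lemma gball_commute: "y \<in> gball G n x \<longleftrightarrow> x \<in> gball G n y"
proof -
  have "(G ^^ k) x y \<Longrightarrow> (G ^^ k) y x" for k x y
  proof (induction k arbitrary: y)
    case (Suc k)
    then obtain z where "(G ^^ k) x z" "G z y" by auto
    then have "(G ^^ k) z x" "G y z" using Suc.IH sym by blast+
    then show ?case by (rule relpowp_Suc_I2[rotated])
  qed simp
  then show ?thesis by (auto simp: gball_def)
qed

lemma gball_trans: "y \<in> gball G m x \<Longrightarrow> z \<in> gball G n y \<Longrightarrow> z \<in> gball G (m + n) x"
proof -
  assume "y \<in> gball G m x" "z \<in> gball G n y"
  then obtain k l where "k \<le> m" "l \<le> n" "(G ^^ k) x y" "(G ^^ l) y z" by (auto simp: gball_def)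
  then have "(G ^^ (k + l)) x z" "k + l \<le> m + n" by (auto simp: relpowp_add)
  then show "z \<in> gball G (m + n) x" unfolding gball_def by blast
qed

lemma countable_UNIV: "countable (UNIV :: 'v set)"
proof -
  have "(UNIV :: 'v set) = (\<Union>n. gball G n r)" using ex_gball[of _ r] by blast
  also have "countable \<dots>" by (rule countable_UN) (auto simp: countable_finite finite_gball)
  finally show ?thesis .
qed

lemma card_gball: "card (gball G n x) = card (gball G n y)"
proof -
  obtain g where g: "g \<in> Aut G" "g x = y" using transE .
  then show ?thesis using gball_image[OF g(1), of n x] card_Aut_image[OF g(1)] by metis
qed

section \<open>The modular function\<close>

abbreviation orb :: "'v \<Rightarrow> 'v \<Rightarrow> nat" where "orb x y \<equiv> card (stab_orbit G x y)"

text \<open>The orbit size of \<open>z\<close> under the joint stabilizer of \<open>x\<close> and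
  \<open>y\<close>; in the cocycle identity \<open>w_ratio\<close> it occurs only as a factor that
  cancels.\<close>

definition orb2 :: "'v \<Rightarrow> 'v \<Rightarrow> 'v \<Rightarrow> nat" where
  "orb2 x y z = card {g z | g. (g \<in> Aut G \<and> g x = x) \<and> g y = y}"

lemma finite_stab_orbit: "finite (stab_orbit G x y)"
proof -
  obtain n where n: "y \<in> gball G n x" using ex_gball by blast
  have "stab_orbit G x y \<subseteq> gball G n x"
  proof
    fix z assume "z \<in> stab_orbit G x y"
    then obtain g where "g \<in> Aut G" "g x = x" "z = g y" by (auto simp: stab_orbit_eq)
    then show "z \<in> gball G n x" using gball_Aut[of g G y n x] n by simp
  qed
  then show ?thesis using finite_gball finite_subset by blast
qed

lemma orb_pos: "orb x y > 0"
  using finite_stab_orbit Aut_id by (fastforce simp: card_gt_0_iff stab_orbit_eq)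

lemma orb2_commute: "orb2 x y z = orb2 y x z"
  unfolding orb2_def by (rule arg_cong[where f=card]) auto

lemma orb2_pos: "orb2 x y z > 0"
proof -
  have "{g z | g. (g \<in> Aut G \<and> g x = x) \<and> g y = y} \<subseteq> stab_orbit G x z" by (auto simp: stab_orbit_eq)
  then have "finite {g z | g. (g \<in> Aut G \<and> g x = x) \<and> g y = y}"
    using finite_stab_orbit finite_subset by blast
  moreover have "z \<in> {g z | g. (g \<in> Aut G \<and> g x = x) \<and> g y = y}"
    using Aut_id[of G] by fastforce
  ultimately show ?thesis unfolding orb2_def card_gt_0_iff by blast
qed

text \<open>Both sides count the orbit of the pair \<open>(y, z)\<close> under the stabilizer of
  \<open>x\<close>, fibred over its first or over its second coordinate.\<close>

lemma orb_orb2: "orb x y * orb2 x y z = orb x z * orb2 x z y"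
proof -
  let ?P = "\<lambda>g. g \<in> Aut G \<and> g x = x"
  have c: "card {(g y, g z) | g. ?P g} = orb x y * orb2 x y z" for y z
    unfolding orb2_def stab_orbit_eq
  proof (rule card_pair_orbit)
    show "?P g \<Longrightarrow> ?P (inv g) \<and> bij g" for g
      using Aut_inv Aut_bij Aut_inv_left by metis
  qed (use finite_stab_orbit in \<open>auto simp: Aut_comp stab_orbit_eq[symmetric]\<close>)
  have "{(g z, g y) | g. ?P g} = prod.swap ` {(g y, g z) | g. ?P g}" by force
  then have "card {(g y, g z) | g. ?P g} = card {(g z, g y) | g. ?P g}"
    by (simp add: card_image)
  then show ?thesis by (simp add: c)
qed

lemma w_pos: "w x > 0"
  using orb_pos by (simp add: weight_def)

text \<open>The cocycle identity of the modular function. \<open>orb_orb2\<close> based at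
  \<open>x\<close>, at \<open>y\<close> and at \<open>r\<close> relates the six orbit sizes of the
  triple through three joint orbit sizes, and these cancel.\<close>

lemma w_ratio: "real (orb x y) / real (orb y x) = w x / w y"
proof -
  note p = orb_pos orb2_pos
  have 1: "real (orb x y) * orb2 x y r = real (orb x r) * orb2 x r y"
    using orb_orb2 by (metis of_nat_mult)
  have 2: "real (orb y x) * orb2 x y r = real (orb y r) * orb2 y r x"
    using orb_orb2[of y x r] orb2_commute[of x y r] by (metis of_nat_mult)
  have 3: "real (orb r x) * orb2 x r y = real (orb r y) * orb2 y r x"
    using orb_orb2[of r x y] orb2_commute[of r x y] orb2_commute[of r y x] by (metis of_nat_mult)
  have "real (orb x y) * (orb r x * orb y r) = real (orb y x) * (orb x r * orb r y)"
  proof -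
    have "real (orb x y) * (orb r x * orb y r) * orb2 x y r * orb2 y r x
       = real (orb x r) * orb2 x r y * (orb r x * orb y r) * orb2 y r x"
      using arg_cong[OF 1, of "\<lambda>t. t * (orb r x * orb y r) * orb2 y r x"] by (simp add: mult_ac)
    also have "\<dots> = real (orb x r) * (orb r y * orb2 y r x) * (orb y r * orb2 y r x)"
      using arg_cong[OF 3, of "\<lambda>t. real (orb x r) * t * (orb y r * orb2 y r x)"] by (simp add: mult_ac)
    also have "\<dots> = real (orb y x) * (orb x r * orb r y) * orb2 x y r * orb2 y r x"
      using arg_cong[OF 2[symmetric], of "\<lambda>t. real (orb x r) * (orb r y * orb2 y r x) * t"] by (simp add: mult_ac)
    finally show ?thesis using p by (simp add: less_imp_neq[symmetric])
  qed
  then show ?thesis unfolding weight_def using orb_pos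
    by (simp add: field_simps less_imp_neq[symmetric])
qed

lemma orb_eq_iff: "orb x y = orb y x \<longleftrightarrow> w x = w y"
proof -
  have "real (orb x y) / real (orb y x) = 1 \<longleftrightarrow> orb x y = orb y x"
    using orb_pos[of y x] by auto
  moreover have "w x / w y = 1 \<longleftrightarrow> w x = w y" using w_pos[of y] by auto
  ultimately show ?thesis using w_ratio by simp
qed

lemma orb_Aut: assumes g: "g \<in> Aut G" shows "orb (g x) (g y) = orb x y"
proof -
  have "stab_orbit G (g x) (g y) = g ` stab_orbit G x y" (is "?A = ?B")
  proof
    show "?A \<subseteq> ?B"
    proof
      fix v assume "v \<in> ?A"
      then obtain h where h: "h \<in> Aut G" "h (g x) = g x" "v = h (g y)" by (auto simp: stab_orbit_eq)
      have "(\<lambda>u. inv g (h (g u))) \<in> Aut G"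
        using Aut_comp[OF Aut_inv[OF g] Aut_comp[OF h(1) g]] .
      then have "inv g v \<in> stab_orbit G x y"
        using h Aut_inv_left[OF g] by (force simp: stab_orbit_eq)
      then show "v \<in> ?B" using Aut_inv_right[OF g] by (metis image_eqI)
    qed
    show "?B \<subseteq> ?A"
    proof
      fix v assume "v \<in> ?B"
      then obtain h where h: "h \<in> Aut G" "h x = x" "v = g (h y)" by (auto simp: stab_orbit_eq)
      have "(\<lambda>u. g (h (inv g u))) \<in> Aut G"
        using Aut_comp[OF g Aut_comp[OF h(1) Aut_inv[OF g]]] .
      then show "v \<in> ?A" unfolding stab_orbit_eq
        using h Aut_inv_left[OF g] by (intro CollectI exI[of _ "\<lambda>u. g (h (inv g u))"]) simp
    qed
  qed
  then show ?thesis using card_Aut_image[OF g] by simp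
qed

lemma w_Aut_ratio: "g \<in> Aut G \<Longrightarrow> w (g x) / w (g y) = w x / w y"
  using w_ratio orb_Aut by metis

text \<open>The factor depends on \<open>g\<close> alone. Comparisons of weights are therefore
  invariant, and sets of weights are merely rescaled.\<close>

lemma w_Aut: "g \<in> Aut G \<Longrightarrow> w (g x) = w (g r) / w r * w x"
  using w_Aut_ratio[of g x r] w_pos[of "g r"] w_pos[of r] by (simp add: field_simps)

lemma w_Aut_le: "g \<in> Aut G \<Longrightarrow> w (g x) \<le> w (g y) \<longleftrightarrow> w x \<le> w y"
  using w_Aut[of g x] w_Aut[of g y] w_pos[of "g r"] w_pos[of r]
  by (simp add: mult_le_cancel_left_pos del: times_divide_eq_left)

lemma w_Aut_eq: "g \<in> Aut G \<Longrightarrow> w (g x) = w (g y) \<longleftrightarrow> w x = w y"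
  using w_Aut_le[of g x y] w_Aut_le[of g y x] by auto

text \<open>Transitivity copies a ratio seen on one edge to every vertex, so a step with this ratio
  is available everywhere.\<close>

lemma nbr_ratio:
  assumes "G u v" shows "\<exists>y. G x y \<and> w y = w v / w u * w x"
proof -
  obtain g where g: "g \<in> Aut G" "g u = x" using transE .
  have "G x (g v)" using assms g Aut_edge by metis
  moreover have "w (g v) = w v / w u * w x"
    using w_Aut_ratio[OF g(1), of v u] g w_pos[of x] by (simp add: field_simps)
  ultimately show ?thesis by blast
qed

text \<open>If every edge joined equal weights, connectedness would make all weights equal and
  \<open>G\<close> unimodular. An edge with unequal weights is read in the increasing
  direction.\<close>

lemma growth: "\<exists>l>1. \<forall>x. \<exists>y. G x y \<and> w y = l * w x"
proof -
  have "\<exists>u v. G u v \<and> w u \<noteq> w v"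
  proof (rule ccontr)
    assume *: "\<not> ?thesis"
    have "w x = w y" for x y
      using conn[of x y] by (induction rule: rtranclp_induct) (use * in auto)
    then show False using nonuni orb_eq_iff by (auto simp: unimodular_def)
  qed
  then obtain u v where uv: "G u v" "w u < w v"
    using sym by (metis linorder_neqE_linordered_idom)
  show ?thesis
    using nbr_ratio[OF uv(1)] uv w_pos[of u] by (intro exI[of _ "w v / w u"]) (auto simp: field_simps)
qed

lemma w_unbounded: "\<exists>y. w y > s"
proof -
  obtain l where l: "l > 1" "\<And>x. \<exists>y. G x y \<and> w y = l * w x" using growth by blast
  have "\<exists>y. w y = l ^ n * w r" for n
  proof (induction n)
    case (Suc n)
    then obtain y where "w y = l ^ n * w r" by blast
    then show ?case using l(2)[of y] by (auto simp: mult.assoc)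
  qed auto
  moreover obtain n where n: "s / w r < l ^ n" using real_arch_pow l(1) by blast
  ultimately obtain y where "w y = l ^ n * w r" by blast
  then show ?thesis using w_pos[of r] n
    by (intro exI[of _ y]) (simp add: field_simps)
qed

definition level :: "'v \<Rightarrow> 'v set" where "level x = {y. w y = w x}"

lemma level_image: assumes "g \<in> Aut G" shows "level (g x) = g ` level x"
proof
  show "g ` level x \<subseteq> level (g x)" using assms by (auto simp: level_def w_Aut_eq)
  show "level (g x) \<subseteq> g ` level x"
  proof
    fix y assume "y \<in> level (g x)"
    then have "inv g y \<in> level x"
      using w_Aut_eq[OF assms, of "inv g y" x] Aut_inv_right[OF assms] by (simp add: level_def)
    then show "y \<in> g ` level x" using Aut_inv_right[OF assms] by (metis image_eqI)
  qed
qed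

text \<open>Stabilizers preserve weights, so finite levels, all of one size \<open>N\<close> by
  transitivity, would bound every orbit size and hence every weight ratio by
  \<open>N\<close>.\<close>

lemma infinite_level: "infinite (level x)"
proof
  assume fin: "finite (level x)"
  define N where "N = card (level x)"
  have level: "finite (level y) \<and> card (level y) = N" for y
  proof -
    obtain g where g: "g \<in> Aut G" "g x = y" using transE .
    then show ?thesis using level_image[OF g(1), of x] fin card_Aut_image[OF g(1)]
      by (simp add: N_def)
  qed
  have le: "orb y z \<le> N" for y z
  proof -
    have "w (g z) = w z" if "g \<in> Aut G" "g y = y" for g
      using w_Aut_ratio[OF that(1), of z y] that w_pos[of y] by simp
    then have "stab_orbit G y z \<subseteq> level z" by (auto simp: level_def stab_orbit_eq)
    then show ?thesis using level card_mono by metis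
  qed
  obtain y where y: "w y > N * w r" using w_unbounded by blast
  have "w y / w r = real (orb y r) / real (orb r y)" using w_ratio by simp
  also have "\<dots> \<le> real N / 1"
    using le orb_pos[of r y] by (intro frac_le) (auto simp: Suc_le_eq)
  finally show False using y w_pos[of r] by (simp add: field_simps)
qed

lemma is_level_iff: "is_level G L \<longleftrightarrow> (\<exists>x. L = level x)"
proof -
  have same: "same_level G A \<longleftrightarrow> (\<forall>x\<in>A. \<forall>y\<in>A. w x = w y)" for A
    by (auto simp: same_level_def orb_eq_iff)
  show ?thesis
  proof
    assume L: "is_level G L"
    \<comment> \<open>The empty set is vacuously a \<open>same_level\<close> set; maximality
      excludes it.\<close>
    have "L \<noteq> {}"
    proof
      assume "L = {}"
      moreover have "same_level G {r}" by (simp add: same)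
      ultimately show False using L unfolding is_level_def by (metis empty_subsetI insert_not_empty)
    qed
    then obtain x where x: "x \<in> L" by blast
    have "same_level G (level x)" by (simp add: same level_def)
    moreover have "L \<subseteq> level x" 
    proof -
      have "same_level G L" using L by (simp add: is_level_def)
      then show ?thesis using x unfolding same level_def by blast
    qed
    ultimately have "level x = L" using L unfolding is_level_def by blast
    then show "\<exists>x. L = level x" by blast
  next
    assume "\<exists>x. L = level x"
    then obtain x where x: "L = level x" by blast
    show "is_level G L" unfolding is_level_def
    proof (intro conjI allI impI)
      show "same_level G L" by (simp add: same level_def x)
      fix L' assume "same_level G L' \<and> L \<subseteq> L'"
      then have *: "\<forall>u\<in>L'. \<forall>v\<in>L'. w u = w v" "level x \<subseteq> L'"
        unfolding x same by blast+
      have "x \<in> level x" by (simp add: level_def)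
      then have "x \<in> L'" using *(2) by blast
      then have "L' \<subseteq> level x" using *(1) unfolding level_def by blast
      then show "L' = L" using *(2) x by blast
    qed
  qed
qed

end

section \<open>Separating hubs in a graph\<close>

definition avoid :: "'v graph \<Rightarrow> 'v set \<Rightarrow> 'v graph" where
  "avoid E B a b \<longleftrightarrow> E a b \<and> a \<notin> B \<and> b \<notin> B"

text \<open>The conjunct \<open>u \<notin> B\<close> is there because the closure is reflexive:
  without it a vertex of \<open>B\<close> would reach itself. The case \<open>B = {}\<close> gives
  clusters, other \<open>B\<close> give components of the complement.\<close>

definition reach :: "'v graph \<Rightarrow> 'v set \<Rightarrow> 'v \<Rightarrow> 'v \<Rightarrow> bool" where
  "reach E B u v \<longleftrightarrow> u \<notin> B \<and> (avoid E B)\<^sup>*\<^sup>* u v"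

lemma reach_refl: "u \<notin> B \<Longrightarrow> reach E B u u"
  by (simp add: reach_def)

lemma reach_start: "reach E B u v \<Longrightarrow> u \<notin> B"
  by (simp add: reach_def)

lemma reach_end: "reach E B u v \<Longrightarrow> v \<notin> B"
  unfolding reach_def by (auto elim: rtranclp.cases simp: avoid_def)

lemma reach_trans: "reach E B u v \<Longrightarrow> reach E B v z \<Longrightarrow> reach E B u z"
  unfolding reach_def by (auto intro: rtranclp_trans)

lemma reach_step: "reach E B u v \<Longrightarrow> E v z \<Longrightarrow> z \<notin> B \<Longrightarrow> reach E B u z"
  using reach_end[of E B u v] unfolding reach_def
  by (auto simp: avoid_def intro: rtranclp.rtrancl_into_rtrancl)

lemma reach_sym: assumes "symp E" "reach E B u v" shows "reach E B v u"
proof -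
  have "symp (avoid E B)" using assms(1) by (auto simp: symp_def avoid_def)
  then have "(avoid E B)\<^sup>*\<^sup>* v u"
    using assms(2) by (meson reach_def symp_rtranclp sympD)
  then show ?thesis using reach_end[OF assms(2)] by (simp add: reach_def)
qed

lemma reach_induct [consumes 1, case_names base step]:
  assumes "reach E B u v" and "P u"
    and "\<And>a b. reach E B u a \<Longrightarrow> P a \<Longrightarrow> E a b \<Longrightarrow> b \<notin> B \<Longrightarrow> P b"
  shows "P v"
proof -
  have "(avoid E B)\<^sup>*\<^sup>* u v" "u \<notin> B" using assms(1) by (auto simp: reach_def)
  then have "reach E B u v \<and> P v"
    by (induction rule: rtranclp_induct)
      (use assms in \<open>auto simp: avoid_def intro: reach_refl reach_step\<close>)
  then show ?thesis by simp
qed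

lemma reach_empty: "reach E {} u v \<longleftrightarrow> E\<^sup>*\<^sup>* u v"
proof -
  have "avoid E {} = E" by (intro ext) (simp add: avoid_def)
  then show ?thesis by (simp add: reach_def)
qed

lemma reach_rtranclp: "reach E B u v \<Longrightarrow> E\<^sup>*\<^sup>* u v"
  by (induction rule: reach_induct) (auto intro: rtranclp.rtrancl_into_rtrancl)

lemma reach_first_entry:
  assumes "E\<^sup>*\<^sup>* u t" "u \<notin> B" "t \<in> B"
  shows "\<exists>a b. reach E B u a \<and> E a b \<and> b \<in> B"
proof -
  have "reach E B u t \<or> (\<exists>a b. reach E B u a \<and> E a b \<and> b \<in> B)"
    using assms(1)
    by (induction rule: rtranclp_induct) (use assms(2) in \<open>auto intro: reach_refl reach_step\<close>)
  then show ?thesis using reach_end assms(3) by metis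
qed

abbreviation induced :: "'v graph \<Rightarrow> 'v set \<Rightarrow> 'v graph" where
  "induced E B \<equiv> \<lambda>a b. E a b \<and> a \<in> B \<and> b \<in> B"

lemma induced_reach:
  assumes "(induced E A)\<^sup>*\<^sup>* u v" "A \<inter> B = {}" "u \<in> A"
  shows "reach E B u v"
  using assms(1)
proof (induction rule: rtranclp_induct)
  case base
  show ?case using assms by (auto intro: reach_refl)
next
  case (step y z)
  then show ?case using assms(2) by (auto intro: reach_step)
qed

text \<open>The sets \<open>B x\<close> are balls that take the place of single trifurcation points;
  a ball connected by edges inside it behaves like one vertex.\<close>

locale hubs =
  fixes E :: "'v graph" and B :: "'v \<Rightarrow> 'v set"
  assumes symE: "symp E"
    and center: "x \<in> B x"
begin

definition hub :: "'v \<Rightarrow> bool" where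
  "hub x \<longleftrightarrow> (\<forall>u\<in>B x. (induced E (B x))\<^sup>*\<^sup>* u x)"

lemma rsym: "reach E A u v \<Longrightarrow> reach E A v u"
  using reach_sym[OF symE] .

text \<open>Follow a path from \<open>u\<close> to its first entry into \<open>B x\<close>. It
  cannot touch \<open>B y\<close> before, since \<open>B y\<close> is connected off
  \<open>B x\<close> and would lead on to \<open>y\<close>.\<close>

lemma around:
  assumes hub: "hub x" "hub y" and disj: "B x \<inter> B y = {}"
    and u: "E\<^sup>*\<^sup>* u x" "u \<notin> B y" and sep: "\<not> reach E (B x) u y"
  shows "reach E (B y) u x"
proof (cases "u \<in> B x")
  case True
  then show ?thesis using induced_reach[of E "B x" u x "B y"] hub(1) disj by (auto simp: hub_def)
next
  case False
  obtain a b where ab: "reach E (B x) u a" "E a b" "b \<in> B x"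
    using reach_first_entry[OF u(1) False center] by blast
  have off: "c \<notin> B y" if "reach E (B x) u c" for c
  proof
    assume "c \<in> B y"
    then have "reach E (B x) c y"
      using induced_reach[of E "B y" c y "B x"] hub(2) disj by (auto simp: hub_def)
    then show False using sep that reach_trans by metis
  qed
  have "reach E (B y) u a"
    using ab(1)
  proof (induction rule: reach_induct)
    case base
    show ?case using u(2) by (rule reach_refl)
  next
    case (step a b)
    then show ?case using off reach_step by metis
  qed
  then have "reach E (B y) u b" using ab disj reach_step by (metis disjoint_iff)
  moreover have "reach E (B y) b x"
    using induced_reach[of E "B x" b x "B y"] hub(1) disj ab by (auto simp: hub_def)
  ultimately show ?thesis by (rule reach_trans)
qed

text \<open>Rooting the cluster at \<open>\<rho>\<close>, an innermost hub has two branches away from the root; one of them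
  can be discarded together with its at least \<open>M\<close> points of \<open>F\<close>, since any branch of another hub
  meeting it also contains the other one.\<close>

lemma burton_keane:
  assumes "finite S" "finite F"
    and "\<And>x. x \<in> S \<Longrightarrow> hub x \<and> E\<^sup>*\<^sup>* \<rho> x"
    and "\<And>x y. x \<in> S \<Longrightarrow> y \<in> S \<Longrightarrow> x \<noteq> y \<Longrightarrow> B x \<inter> B y = {}"
    and "\<And>x. x \<in> S \<Longrightarrow> \<exists>z1 z2. \<not> reach E (B x) z1 z2 \<and>
      (\<forall>z\<in>{z1, z2}. \<not> reach E (B x) z \<rho> \<and> E\<^sup>*\<^sup>* \<rho> z \<and> M \<le> card {v\<in>F. reach E (B x) z v})"
  shows "M * card S \<le> card F"
  using assms
proof (induction "card S" arbitrary: S F)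
  case 0
  then show ?case by simp
next
  case (Suc n)
  note S = Suc.prems(3) and disj = Suc.prems(4)
  \<comment> \<open>\<open>Desc x\<close> is what \<open>B x\<close> cuts off from the root. A hub
    with the fewest hubs in it is innermost.\<close>
  define Desc where "Desc x = {u. E\<^sup>*\<^sup>* \<rho> u \<and> u \<notin> B x \<and> \<not> reach E (B x) u \<rho>}" for x
  have cc: "E\<^sup>*\<^sup>* u v" if "E\<^sup>*\<^sup>* \<rho> u" "E\<^sup>*\<^sup>* \<rho> v" for u v
    using that symE by (meson rtranclp_trans sympD symp_rtranclp)
  have "S \<noteq> {}" using Suc.hyps(2) by auto
  define x where "x = arg_min_on (\<lambda>x. card (S \<inter> Desc x)) S"
  have x: "x \<in> S" unfolding x_def using \<open>S \<noteq> {}\<close> Suc.prems(1) arg_min_if_finite(1) by blast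
  have xmin: "card (S \<inter> Desc x) \<le> card (S \<inter> Desc y)" if "y \<in> S" for y
    unfolding x_def by (rule arg_min_least[OF Suc.prems(1) \<open>S \<noteq> {}\<close> that])
  have none: "y \<notin> Desc x" if y: "y \<in> S" for y
  proof
    assume yD: "y \<in> Desc x"
    then have "y \<noteq> x" using center by (auto simp: Desc_def)
    then have d: "B x \<inter> B y = {}" using disj x y by blast
    \<comment> \<open>\<open>B x\<close> separates \<open>y\<close> from the root, so by
      \<open>around\<close> the root gets to \<open>x\<close> without touching
      \<open>B y\<close>.\<close>
    have rho: "reach E (B y) \<rho> x"
    proof (rule around)
      show "\<not> reach E (B x) \<rho> y" using yD rsym by (auto simp: Desc_def)
      show "\<rho> \<notin> B y"
      proof
        assume "\<rho> \<in> B y"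
        then have "reach E (B x) \<rho> y"
          using induced_reach[of E "B y" \<rho> y "B x"] S[OF y] d by (auto simp: hub_def)
        then show False using yD rsym by (auto simp: Desc_def)
      qed
    qed (use S x y d in auto)
    \<comment> \<open>A point joined to \<open>y\<close> off \<open>B x\<close> is cut off from the
      root like \<open>y\<close>. Any other point gets to \<open>x\<close> off \<open>B y\<close>
      and from there to the root, so it is not in \<open>Desc y\<close>.\<close>
    have "Desc y \<subseteq> Desc x"
    proof
      fix u assume u: "u \<in> Desc y"
      show "u \<in> Desc x"
      proof (cases "reach E (B x) u y")
        case True
        then show ?thesis using u yD reach_start rsym reach_trans by (fastforce simp: Desc_def)
      next
        case False
        have "reach E (B y) u x"
          using around[OF _ _ d _ _ False] S[OF x] S[OF y] u cc[of u x] by (auto simp: Desc_def)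
        then have "reach E (B y) u \<rho>" using rho rsym reach_trans by metis
        then show ?thesis using u by (auto simp: Desc_def)
      qed
    qed
    moreover have "y \<notin> Desc y" using center by (auto simp: Desc_def)
    ultimately have "S \<inter> Desc y \<subset> S \<inter> Desc x" using y yD by blast
    then have "card (S \<inter> Desc y) < card (S \<inter> Desc x)"
      using Suc.prems(1) by (intro psubset_card_mono) auto
    then show False using xmin[OF y] by simp
  qed
  obtain z1 z2 where z: "\<not> reach E (B x) z1 z2"
    "\<And>z. z \<in> {z1, z2} \<Longrightarrow> \<not> reach E (B x) z \<rho> \<and> E\<^sup>*\<^sup>* \<rho> z \<and> M \<le> card {v\<in>F. reach E (B x) z v}"
    using Suc.prems(5)[OF x] by blast
  \<comment> \<open>The branches of \<open>z1\<close> and \<open>z2\<close> lie in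
    \<open>Desc x\<close>, which contains no hub of \<open>S\<close>.\<close>
  have off: "\<not> reach E (B x) v y" if "y \<in> S" "z \<in> {z1, z2}" "reach E (B x) z v" for v y z
  proof
    assume "reach E (B x) v y"
    then have zy: "reach E (B x) z y" using that reach_trans by metis
    then have "\<not> reach E (B x) y \<rho>" using z(2)[OF that(2)] reach_trans by metis
    moreover have "y \<notin> B x" using zy by (rule reach_end)
    ultimately have "y \<in> Desc x" using S[OF that(1)] by (auto simp: Desc_def)
    then show False using none that by blast
  qed
  define F' where "F' = {v\<in>F. \<not> reach E (B x) z1 v}"
  have "M * card (S - {x}) \<le> card F'"
  proof (rule Suc.hyps(1))
    show "n = card (S - {x})" using Suc.hyps(2) x Suc.prems(1) by simp
    show "finite F'" using Suc.prems(2) by (simp add: F'_def)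
    fix y assume y: "y \<in> S - {x}"
    then have d: "B x \<inter> B y = {}" using disj x by blast
    obtain y1 y2 where y12: "\<not> reach E (B y) y1 y2"
      "\<And>z. z \<in> {y1, y2} \<Longrightarrow> \<not> reach E (B y) z \<rho> \<and> E\<^sup>*\<^sup>* \<rho> z \<and> M \<le> card {v\<in>F. reach E (B y) z v}"
      using Suc.prems(5)[of y] y by blast
    have "M \<le> card {v\<in>F'. reach E (B y) t v}" if t: "t \<in> {y1, y2}" for t
    proof (cases "\<exists>v\<in>F. reach E (B x) z1 v \<and> reach E (B y) t v")
      case False
      then have "{v\<in>F'. reach E (B y) t v} = {v\<in>F. reach E (B y) t v}" by (auto simp: F'_def)
      then show ?thesis using y12(2)[OF t] by simp
    next
      case True
      \<comment> \<open>The branch of \<open>t\<close> at \<open>y\<close> meets the discarded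
        branch of \<open>z1\<close>. It then contains \<open>x\<close>, and with it the whole branch
        of \<open>z2\<close>, whose \<open>M\<close> points are kept in \<open>F'\<close>.\<close>
      then obtain v where v: "reach E (B x) z1 v" "reach E (B y) t v" by blast
      have to_x: "reach E (B y) u x" if zu: "z \<in> {z1, z2}" "reach E (B x) z u" for z u
      proof (rule around)
        show ns: "\<not> reach E (B x) u y" using off[of y z u] y zu by blast
        show "u \<notin> B y"
        proof
          assume "u \<in> B y"
          then have "reach E (B x) u y"
            using induced_reach[of E "B y" u y "B x"] S[of y] y d by (auto simp: hub_def)
          then show False using ns by blast
        qed
        have "E\<^sup>*\<^sup>* \<rho> u" using reach_rtranclp[OF zu(2)] z(2)[OF zu(1)] by auto
        then show "E\<^sup>*\<^sup>* u x" using cc S[OF x] by blast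
      qed (use S x y d in auto)
      have tx: "reach E (B y) t x" using v to_x[of z1 v] reach_trans by (metis insertI1)
      have "{v\<in>F. reach E (B x) z2 v} \<subseteq> {v\<in>F'. reach E (B y) t v}"
      proof safe
        fix u assume u: "u \<in> F" "reach E (B x) z2 u"
        then have "reach E (B y) u x" using to_x[of z2] by blast
        then show "reach E (B y) t u" using tx rsym reach_trans by metis
        have "\<not> reach E (B x) z1 u" using z(1) u rsym reach_trans by metis
        then show "u \<in> F'" using u by (simp add: F'_def)
      qed
      then have "card {v\<in>F. reach E (B x) z2 v} \<le> card {v\<in>F'. reach E (B y) t v}"
        using Suc.prems(2) by (intro card_mono) (auto simp: F'_def)
      then show ?thesis using z(2)[of z2] by simp
    qed
    then show "\<exists>z1 z2. \<not> reach E (B y) z1 z2 \<and>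
      (\<forall>z\<in>{z1, z2}. \<not> reach E (B y) z \<rho> \<and> E\<^sup>*\<^sup>* \<rho> z \<and> M \<le> card {v\<in>F'. reach E (B y) z v})"
      using y12 by blast
  qed (use Suc.prems in auto)
  moreover have "card F' + M \<le> card F"
  proof -
    have "card F = card F' + card {v\<in>F. reach E (B x) z1 v}"
      unfolding F'_def using Suc.prems(2)
      by (subst card_Un_disjoint[symmetric]) (auto intro: arg_cong[where f=card])
    then show ?thesis using z(2)[of z1] by simp
  qed
  moreover have "card S = Suc (card (S - {x}))" using x Suc.prems(1) by (metis card_Suc_Diff1)
  ultimately show ?case by simp
qed

end

section \<open>Level sets and growth of weights\<close>

text \<open>A sum of weights is the integral over \<open>s > 0\<close> of the number of points of
  weight at least \<open>s\<close>, so a counting bound valid at every \<open>s\<close> integrates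
  to a bound on weights.\<close>

lemma layer_cake_le:
  fixes w :: "'a \<Rightarrow> real"
  assumes fin: "finite A" "finite F" and pos: "\<And>x. w x > 0"
    and le: "\<And>s. s > 0 \<Longrightarrow> M * card {x\<in>A. s \<le> w x} \<le> N * card {x\<in>F. s \<le> w x}"
  shows "real M * sum w A \<le> real N * sum w F"
proof -
  have int: "(\<integral>\<^sup>+s. ennreal (real m * card {x\<in>X. s \<le> w x}) * indicator {0<..} s \<partial>lborel)
      = ennreal (real m * sum w X)" if X: "finite X" for X m
  proof -
    have "ennreal (real m * card {x\<in>X. s \<le> w x}) * indicator {0<..} s
        = (\<Sum>x\<in>X. ennreal (real m) * indicator {0<..w x} s)" for s :: real
    proof -
      have "real (card {x\<in>X. s \<le> w x}) = (\<Sum>x\<in>X. if s \<le> w x then 1 else 0)"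
        using X by (simp add: sum.If_cases Int_def)
      then have "real m * card {x\<in>X. s \<le> w x} * indicator {0<..} s
          = (\<Sum>x\<in>X. real m * indicator {0<..w x} s)"
        by (simp add: sum_distrib_left sum_distrib_right indicator_def) (auto intro!: sum.cong)
      then have "ennreal (real m * card {x\<in>X. s \<le> w x} * indicator {0<..} s)
          = (\<Sum>x\<in>X. ennreal (real m * indicator {0<..w x} s))"
        by (simp add: sum_ennreal)
      then show ?thesis by (simp add: ennreal_mult' ennreal_indicator)
    qed
    then have "(\<integral>\<^sup>+s. ennreal (real m * card {x\<in>X. s \<le> w x}) * indicator {0<..} s \<partial>lborel)
        = (\<Sum>x\<in>X. ennreal (real m) * ennreal (w x))"
      using pos by (simp add: nn_integral_sum nn_integral_cmult less_imp_le)
    also have "\<dots> = ennreal (real m * sum w X)"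
      using pos by (simp add: ennreal_mult'[symmetric] sum_ennreal less_imp_le sum_distrib_left)
    finally show ?thesis .
  qed
  have "ennreal (real M * sum w A) \<le> ennreal (real N * sum w F)"
    unfolding int[OF fin(1), symmetric] int[OF fin(2), symmetric]
  proof (intro nn_integral_mono)
    fix s :: real
    have "real M * card {x\<in>A. s \<le> w x} \<le> real N * card {x\<in>F. s \<le> w x}" if "s > 0"
      using le[OF that] by (metis of_nat_le_iff of_nat_mult)
    then show "ennreal (real M * card {x\<in>A. s \<le> w x}) * indicator {0<..} s
      \<le> ennreal (real N * card {x\<in>F. s \<le> w x}) * indicator {0<..} s"
      by (cases "s > 0") (auto intro: ennreal_leI)
  qed
  moreover have "0 \<le> real N * sum w F"
    using pos by (intro mult_nonneg_nonneg sum_nonneg) (auto intro: less_imp_le)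
  ultimately show ?thesis by (simp add: ennreal_le_iff)
qed

lemma power_lt_two_power: "\<exists>N. (Suc N) ^ d < (2::nat) ^ N"
proof -
  \<comment> \<open>With \<open>Suc N = 2 ^ (2 * t)\<close> the claim becomes
    \<open>2 * t * d < N\<close>. As \<open>2 * d < t\<close>, this follows from
    \<open>Suc t * Suc t \<le> 2 ^ (2 * t)\<close>.\<close>
  define t where "t = 2 * Suc d"
  define N where "N = (2::nat) ^ (2 * t) - 1"
  have "Suc t \<le> 2 ^ t" by (rule Suc_leI) (rule less_exp)
  then have "Suc t * Suc t \<le> 2 ^ t * 2 ^ t" by (rule mult_le_mono) fact
  then have "2 * t * d < N" unfolding N_def t_def by (simp add: power_add[symmetric] mult_2[symmetric])
  then have "(2::nat) ^ (2 * t * d) < 2 ^ N" by simp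
  moreover have "Suc N = 2 ^ (2 * t)" by (simp add: N_def)
  ultimately show ?thesis by (metis power_mult)
qed

text \<open>Finitely generated abelian groups grow polynomially, so the balls for the generators \<open>Q\<close>
  cannot double their size at every step.\<close>

lemma folner_mult:
  fixes Q :: "real set"
  assumes Q: "finite Q" "\<And>q. q \<in> Q \<Longrightarrow> q > 0"
  shows "\<exists>K. finite K \<and> K \<noteq> {} \<and> (\<forall>k\<in>K. k > 0) \<and> card K \<le> 2 * card {k\<in>K. \<forall>q\<in>Q. k * q \<in> K}"
proof -
  \<comment> \<open>Monomials with all exponents at most \<open>N\<close>: at most
    \<open>Suc N ^ card Q\<close> of them, and one multiplication by a generator leads from
    \<open>K N\<close> into \<open>K (Suc N)\<close>.\<close>
  define K where "K N = (\<lambda>f. \<Prod>q\<in>Q. q ^ f q) ` (Q \<rightarrow>\<^sub>E {..N})" for N :: nat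
  have fin: "finite (K N)" for N
    unfolding K_def using Q by (intro finite_imageI finite_PiE) auto
  have card: "card (K N) \<le> Suc N ^ card Q" for N
  proof -
    have "card (K N) \<le> card (Q \<rightarrow>\<^sub>E {..N})"
      unfolding K_def using Q by (intro card_image_le finite_PiE) auto
    then show ?thesis using Q by (simp add: card_PiE)
  qed
  have one: "1 \<in> K 0"
    unfolding K_def by (rule image_eqI[of _ _ "restrict (\<lambda>_. 0) Q"]) auto
  have sub: "K N \<subseteq> K (Suc N)" for N unfolding K_def
    by (intro image_mono PiE_mono) auto
  have step: "k * q \<in> K (Suc N)" if k: "k \<in> K N" and q: "q \<in> Q" for k q N
  proof -
    obtain f where f: "f \<in> Q \<rightarrow>\<^sub>E {..N}" "k = (\<Prod>q\<in>Q. q ^ f q)" using k by (auto simp: K_def)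
    have "(\<Prod>s\<in>Q. s ^ (f(q := Suc (f q))) s) = k * q"
    proof -
      have "(\<Prod>s\<in>Q. s ^ (f(q := Suc (f q))) s) = (\<Prod>s\<in>Q. s ^ f s * (if s = q then q else 1))"
        by (intro prod.cong) auto
      also have "\<dots> = k * q" using Q q f by (simp add: prod.distrib)
      finally show ?thesis .
    qed
    moreover have "f(q := Suc (f q)) \<in> Q \<rightarrow>\<^sub>E {..Suc N}"
      using f q by (auto simp: PiE_iff extensional_def le_SucI)
    ultimately show ?thesis unfolding K_def by (intro image_eqI[of _ _ "f(q := Suc (f q))"]) auto
  qed
  \<comment> \<open>More than doubling at every step would make \<open>2 ^ N\<close> a lower bound
    for a polynomial in \<open>N\<close>.\<close>
  have "\<exists>N. card (K (Suc N)) \<le> 2 * card (K N)"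
  proof (rule ccontr)
    assume "\<not> ?thesis"
    then have dbl: "2 * card (K N) < card (K (Suc N))" for N by (meson not_le)
    have "2 ^ N \<le> card (K N)" for N
    proof (induction N)
      case 0
      have "card (K 0) > 0" using one fin by (auto simp: card_gt_0_iff)
      then show ?case by simp
    next
      case (Suc N)
      then show ?case using dbl[of N] by simp
    qed
    then show False using power_lt_two_power[of "card Q"] card by (metis leD order_trans)
  qed
  then obtain N where N: "card (K (Suc N)) \<le> 2 * card (K N)" by blast
  \<comment> \<open>All of \<open>K N\<close> is interior to \<open>K (Suc N)\<close>, and it is at
    least half of it.\<close>
  have "K N \<subseteq> {k \<in> K (Suc N). \<forall>q\<in>Q. k * q \<in> K (Suc N)}" using sub step by blast
  then have "card (K N) \<le> card {k \<in> K (Suc N). \<forall>q\<in>Q. k * q \<in> K (Suc N)}"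
    using fin by (intro card_mono) auto
  moreover have "K n \<noteq> {}" for n using one lift_Suc_mono_le[of K 0 n] sub by blast
  moreover have "k > 0" if "k \<in> K n" for k n
    using that Q by (auto simp: K_def intro!: prod_pos)
  ultimately show ?thesis using N fin by (intro exI[of _ "K (Suc N)"]) auto
qed

section \<open>The mass transport principle\<close>

text \<open>Sums over vertices are integrals over counting measure, so that exchanging them with
  each other or with expectations is Tonelli's theorem.\<close>

abbreviation csum :: "('a \<Rightarrow> ennreal) \<Rightarrow> ennreal" where
  "csum f \<equiv> \<integral>\<^sup>+x. f x \<partial>count_space UNIV"

context perc_graph
begin

text \<open>Spread \<open>f o' y\<close> evenly over those \<open>z\<close> for which
  \<open>(z, o')\<close> is an automorphic copy of \<open>(o', y)\<close>, then exchange the sums.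
  Each \<open>z\<close> occurs for \<open>orb z o'\<close> vertices \<open>y\<close>, each time with
  share \<open>1 / orb o' z\<close>, and the quotient is \<open>w z / w o'\<close>.\<close>

lemma mass_transport_sum:
  fixes f :: "'v \<Rightarrow> 'v \<Rightarrow> ennreal"
  assumes inv: "\<And>g x y. g \<in> Aut G \<Longrightarrow> f (g x) (g y) = f x y"
  shows "csum (\<lambda>y. f o' y) = csum (\<lambda>x. f x o' * ennreal (w x / w o'))"
proof -
  \<comment> \<open>The vertices \<open>z\<close> over which \<open>f o' y\<close> is spread. They
    form one orbit of the stabilizer of \<open>o'\<close>, so there are finitely many.\<close>
  define A where "A y = {h o' | h. h \<in> Aut G \<and> h y = o'}" for y
  have A: "A y = stab_orbit G o' z" if z: "z \<in> A y" for y z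
  proof -
    obtain k where k: "k \<in> Aut G" "k y = o'" "z = k o'" using z by (auto simp: A_def)
    show ?thesis
    proof
      show "A y \<subseteq> stab_orbit G o' z"
      proof
        fix v assume "v \<in> A y"
        then obtain h where h: "h \<in> Aut G" "h y = o'" "v = h o'" by (auto simp: A_def)
        have "(\<lambda>x. h (inv k x)) \<in> Aut G" using Aut_comp[OF h(1) Aut_inv[OF k(1)]] .
        moreover have "inv k o' = y" "inv k z = o'" using k Aut_inv_left by metis+
        ultimately show "v \<in> stab_orbit G o' z"
          unfolding stab_orbit_eq using h by (intro CollectI exI[of _ "\<lambda>x. h (inv k x)"]) auto
      qed
      show "stab_orbit G o' z \<subseteq> A y"
      proof
        fix v assume "v \<in> stab_orbit G o' z"
        then obtain h where h: "h \<in> Aut G" "h o' = o'" "v = h z" by (auto simp: stab_orbit_eq)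
        show "v \<in> A y" unfolding A_def
          using Aut_comp[OF h(1) k(1)] h k by (intro CollectI exI[of _ "\<lambda>x. h (k x)"]) auto
      qed
    qed
  qed
  have ne: "\<exists>z. z \<in> A y" for y
  proof -
    obtain h where "h \<in> Aut G" "h y = o'" using transE .
    then show ?thesis by (auto simp: A_def)
  qed
  have finA: "finite (A y)" and cardA: "card (A y) > 0" for y
    using ne[of y] A finite_stab_orbit orb_pos by metis+
  have split: "f o' y = csum (\<lambda>z. f z o' * (indicator (A y) z / of_nat (card (A y))))" for y
  proof -
    have "csum (\<lambda>z. f z o' * (indicator (A y) z / of_nat (card (A y))))
      = csum (\<lambda>z. (f o' y / of_nat (card (A y))) * indicator (A y) z)"
    proof (intro nn_integral_cong)
      fix z
      have "f z o' = f o' y" if "z \<in> A y"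
        using that inv[of _ o' y] by (auto simp: A_def)
      then show "f z o' * (indicator (A y) z / of_nat (card (A y)))
          = (f o' y / of_nat (card (A y))) * indicator (A y) z"
        by (auto simp: indicator_def divide_ennreal_def)
    qed
    also have "\<dots> = (f o' y / of_nat (card (A y))) * of_nat (card (A y))"
      using finA by (simp add: nn_integral_cmult_indicator emeasure_count_space)
    also have "\<dots> = f o' y"
    proof -
      have "of_nat (card (A y)) / of_nat (card (A y)) = (1 :: ennreal)"
        using cardA[of y] by (intro ennreal_divide_self) (auto simp: of_nat_less_top)
      then show ?thesis by (simp add: ennreal_divide_times)
    qed
    finally show ?thesis by simp
  qed
  have inner: "csum (\<lambda>y. indicator (A y) z / of_nat (card (A y))) = ennreal (w z / w o')" for z
  proof -
    obtain h where h: "h \<in> Aut G" "h o' = z" using transE .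
    define y0 where "y0 = inv h o'"
    have hy0: "h y0 = o'" using Aut_inv_right[OF h(1)] by (simp add: y0_def)
    \<comment> \<open>Read from \<open>z\<close>, the vertices \<open>y\<close> served by it are
      again one orbit of the stabilizer of \<open>o'\<close>; moving by \<open>h\<close> turns its
      size into \<open>orb z o'\<close>.\<close>
    have Y: "{y. z \<in> A y} = stab_orbit G o' y0"
    proof
      show "{y. z \<in> A y} \<subseteq> stab_orbit G o' y0"
      proof safe
        fix y assume "z \<in> A y"
        then obtain k where k: "k \<in> Aut G" "k y = o'" "z = k o'" by (auto simp: A_def)
        have "(\<lambda>x. inv k (h x)) \<in> Aut G" using Aut_comp[OF Aut_inv[OF k(1)] h(1)] .
        moreover have "inv k o' = y" "inv k z = o'" using k Aut_inv_left by metis+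
        ultimately show "y \<in> stab_orbit G o' y0"
          unfolding stab_orbit_eq using h hy0 by (intro CollectI exI[of _ "\<lambda>x. inv k (h x)"]) auto
      qed
      show "stab_orbit G o' y0 \<subseteq> {y. z \<in> A y}"
      proof safe
        fix y assume "y \<in> stab_orbit G o' y0"
        then obtain g where g: "g \<in> Aut G" "g o' = o'" "y = g y0" by (auto simp: stab_orbit_eq)
        have "(\<lambda>x. h (inv g x)) \<in> Aut G" using Aut_comp[OF h(1) Aut_inv[OF g(1)]] .
        moreover have "inv g o' = o'" "inv g y = y0" using g Aut_inv_left by metis+
        ultimately show "z \<in> A y"
          unfolding A_def using h hy0 by (intro CollectI exI[of _ "\<lambda>x. h (inv g x)"]) auto
      qed
    qed
    have "csum (\<lambda>y. indicator (A y) z / of_nat (card (A y)))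
        = csum (\<lambda>y. (1 / of_nat (orb o' z)) * indicator (stab_orbit G o' y0) y)"
    proof (intro nn_integral_cong)
      fix y
      show "indicator (A y) z / of_nat (card (A y))
          = (1 / of_nat (orb o' z)) * (indicator (stab_orbit G o' y0) y :: ennreal)"
        using A[of z y] Y by (cases "z \<in> A y") (auto simp: indicator_def)
    qed
    also have "\<dots> = (1 / of_nat (orb o' z)) * of_nat (orb o' y0)"
      using finite_stab_orbit by (simp add: nn_integral_cmult_indicator emeasure_count_space)
    also have "orb o' y0 = orb z o'" using orb_Aut[OF h(1), of o' y0] h hy0 by simp
    also have "(1 / of_nat (orb o' z)) * of_nat (orb z o') = ennreal (real (orb z o') / real (orb o' z))"
      using orb_pos[of o' z]
      by (simp add: divide_ennreal[symmetric] ennreal_of_nat_eq_real_of_nat ennreal_times_divide mult.commute)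
    finally show ?thesis by (simp add: w_ratio)
  qed
  have "csum (\<lambda>y. f o' y) = csum (\<lambda>y. csum (\<lambda>z. f z o' * (indicator (A y) z / of_nat (card (A y)))))"
    using split by simp
  also have "\<dots> = csum (\<lambda>z. csum (\<lambda>y. f z o' * (indicator (A y) z / of_nat (card (A y)))))"
    by (intro nn_integral_count_space_nn_integral countable_UNIV) auto
  also have "\<dots> = csum (\<lambda>z. f z o' * ennreal (w z / w o'))"
    by (simp add: nn_integral_cmult inner)
  finally show ?thesis .
qed

end

section \<open>Bernoulli percolation\<close>

text \<open>Used to name the first \<open>n\<close> attempts in a fixed enumeration: different sets
  cannot be the first \<open>n\<close> elements simultaneously, so the corresponding events are
  disjoint.\<close>

lemma first_elements:
  fixes idx :: "'a \<Rightarrow> nat"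
  assumes "infinite X" "inj idx"
  shows "\<exists>S. finite S \<and> S \<subseteq> X \<and> card S = n \<and> (\<forall>a\<in>S. \<forall>b\<in>X - S. idx a < idx b)"
proof (induction n)
  case 0
  show ?case by (intro exI[of _ "{}"]) simp
next
  case (Suc n)
  then obtain S where S: "finite S" "S \<subseteq> X" "card S = n" "\<forall>a\<in>S. \<forall>b\<in>X - S. idx a < idx b" by blast
  have "X - S \<noteq> {}" using assms(1) S(1) by (metis finite.emptyI finite_Diff2)
  then obtain m where m: "m \<in> X - S" "\<And>b. b \<in> X - S \<Longrightarrow> idx m \<le> idx b"
    using ex_has_least_nat[of "\<lambda>x. x \<in> X - S" _ idx] by blast
  have "idx m < idx b" if "b \<in> X - insert m S" for b
  proof -
    have "idx m \<noteq> idx b" using that assms(2) by (auto dest: injD)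
    then show ?thesis using m(2)[of b] that by auto
  qed
  then show ?case using S m by (intro exI[of _ "insert m S"]) auto
qed

text \<open>Greedy selection. It will thin out overlapping balls at the cost of a bounded
  factor.\<close>

lemma separated_subset:
  assumes "finite X" and sym: "\<And>x y. near x y \<Longrightarrow> near y x" and refl: "\<And>x. near x x"
  shows "\<exists>S\<subseteq>X. (\<forall>x\<in>S. \<forall>y\<in>S. x \<noteq> y \<longrightarrow> \<not> near x y) \<and> (\<forall>x\<in>X. \<exists>y\<in>S. near x y)"
  using assms(1)
proof (induction X rule: finite_induct)
  case (insert x X)
  from insert.IH obtain S where S0: "S \<subseteq> X"
    "\<forall>x\<in>S. \<forall>y\<in>S. x \<noteq> y \<longrightarrow> \<not> near x y" "\<forall>x\<in>X. \<exists>y\<in>S. near x y" by (elim exE conjE)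
  note S = S0(1) S0(2)[rule_format] S0(3)[rule_format]
  show ?case
  proof (cases "\<exists>y\<in>S. near x y")
    case True
    show ?thesis
    proof (intro exI[of _ S] conjI ballI impI)
      show "S \<subseteq> insert x X" using S(1) by blast
      show "\<exists>y\<in>S. near z y" if "z \<in> insert x X" for z using that True S(3) by blast
    qed (rule S(2))
  next
    case False
    show ?thesis
    proof (intro exI[of _ "insert x S"] conjI ballI impI)
      show "insert x S \<subseteq> insert x X" using S(1) by blast
      show "\<exists>y\<in>insert x S. near z y" if "z \<in> insert x X" for z using that refl S(3) by blast
      show "\<not> near a b" if "a \<in> insert x S" "b \<in> insert x S" "a \<noteq> b" for a b
        using that False S(2) sym[of a b] by blast
    qed
  qed
qed simp

lemma reach_image:
  assumes "bij g"
  shows "reach (\<lambda>x y. E (g x) (g y)) B x y \<longleftrightarrow> reach E (g ` B) (g x) (g y)"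
proof
  have mem: "g u \<in> g ` B \<longleftrightarrow> u \<in> B" for u using assms by (simp add: bij_is_inj inj_image_mem_iff)
  show "reach E (g ` B) (g x) (g y)" if "reach (\<lambda>x y. E (g x) (g y)) B x y"
    using that
  proof (induction rule: reach_induct)
    case base
    show ?case using that by (simp add: mem reach_refl reach_start)
  next
    case (step a b)
    then show ?case using reach_step[of E "g ` B" "g x" "g a" "g b"] mem by blast
  qed
  show "reach (\<lambda>x y. E (g x) (g y)) B x y" if r: "reach E (g ` B) (g x) (g y)"
  proof -
    have gi: "g (inv g u) = u" for u using assms by (simp add: bij_is_surj surj_f_inv_f)
    have gi': "inv g (g u) = u" for u using assms by (simp add: bij_is_inj)
    have "reach (\<lambda>x y. E (g x) (g y)) B x (inv g (g y))"
      using r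
    proof (induction rule: reach_induct)
      case base
      show ?case using reach_start[OF r] by (simp add: mem gi' reach_refl)
    next
      case (step a b)
      have "inv g b \<notin> B" using step mem[of "inv g b"] by (simp add: gi)
      then show ?case using step by (auto intro: reach_step simp: gi)
    qed
    then show ?thesis by (simp add: gi')
  qed
qed

locale percolation = perc_graph G r for G :: "'v graph" and r :: 'v +
  fixes p :: real
  assumes p01: "0 \<le> p" "p \<le> 1"
begin

abbreviation P :: "('v set \<Rightarrow> bool) measure" where "P \<equiv> bernoulli_percolation G p"

abbreviation opn :: "('v set \<Rightarrow> bool) \<Rightarrow> 'v graph" where "opn \<equiv> open_subgraph G"

abbreviation coin :: "bool measure" where "coin \<equiv> measure_pmf (bernoulli_pmf p)"

lemma P_eq: "P = Pi\<^sub>M (edges G) (\<lambda>_. coin)"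
  by (simp add: bernoulli_percolation_def)

sublocale prob_space P
  unfolding P_eq by (intro prob_space_PiM prob_space_measure_pmf)

lemma edge_mem: "G x y \<Longrightarrow> {x, y} \<in> edges G"
  by (auto simp: edges_def)

lemma opn_sym: "symp (opn \<omega>)"
  by (auto simp: symp_def open_subgraph_def insert_commute sym)

lemma measurable_coord: "e \<in> edges G \<Longrightarrow> Measurable.pred P (\<lambda>\<omega>. \<omega> e)"
  unfolding P_eq by measurable

lemma pred_open [measurable]: "Measurable.pred P (\<lambda>\<omega>. opn \<omega> x y)"
  by (cases "G x y") (use measurable_coord[OF edge_mem, of x y] in \<open>auto simp: open_subgraph_def\<close>)

text \<open>Countability of the vertices is a consequence of connectedness and local finiteness, so
  quantifiers over them are handled through \<open>countable_UNIV\<close>.\<close>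

lemma pred_ex_v [measurable (raw)]:
  "(\<And>x. Measurable.pred P (\<lambda>\<omega>. Q \<omega> x)) \<Longrightarrow> Measurable.pred P (\<lambda>\<omega>. \<exists>x::'v. Q \<omega> x)"
  using sets.sets_Collect_countable_Ex'[of UNIV P "\<lambda>x \<omega>. Q \<omega> x"] countable_UNIV by (simp add: pred_def)

lemma pred_all_v [measurable (raw)]:
  "(\<And>x. Measurable.pred P (\<lambda>\<omega>. Q \<omega> x)) \<Longrightarrow> Measurable.pred P (\<lambda>\<omega>. \<forall>x::'v. Q \<omega> x)"
  using sets.sets_Collect_countable_All'[of UNIV P "\<lambda>x \<omega>. Q \<omega> x"] countable_UNIV by (simp add: pred_def)

lemma countable_finite_sets: "countable {F :: 'v set. finite F}"
  using countable_Collect_finite_subset[OF countable_UNIV] by simp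

lemma pred_ex_fin:
  assumes "\<And>F. finite F \<Longrightarrow> Measurable.pred P (\<lambda>\<omega>. Q \<omega> F)"
  shows "Measurable.pred P (\<lambda>\<omega>. \<exists>F::'v set. finite F \<and> Q \<omega> F)"
  using sets.sets_Collect_countable_Ex'[OF _ countable_finite_sets, of P "\<lambda>x \<omega>. Q \<omega> x"] assms
  by (simp add: pred_def)

lemma pred_reach [measurable]: "Measurable.pred P (\<lambda>\<omega>. reach (opn \<omega>) B x y)"
proof -
  have "Measurable.pred P (\<lambda>\<omega>. (avoid (opn \<omega>) B ^^ n) x y)" for n
  proof (induction n arbitrary: y)
    case (Suc n)
    note Suc.IH [measurable]
    have "(avoid (opn \<omega>) B ^^ Suc n) x y \<longleftrightarrow>
        (\<exists>z. (avoid (opn \<omega>) B ^^ n) x z \<and> opn \<omega> z y \<and> z \<notin> B \<and> y \<notin> B)" for \<omega>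
      by (auto simp: avoid_def)
    then show ?case by simp
  qed simp
  then show ?thesis by (simp add: reach_def rtranclp_power)
qed

lemma pred_finite:
  assumes [measurable]: "\<And>x. Measurable.pred P (\<lambda>\<omega>. S \<omega> x)"
  shows "Measurable.pred P (\<lambda>\<omega>. finite {x::'v. S \<omega> x})"
proof -
  have "finite {x. S \<omega> x} \<longleftrightarrow> (\<exists>F. finite F \<and> (\<forall>x. S \<omega> x \<longrightarrow> x \<in> F))" for \<omega>
  proof
    show "\<exists>F. finite F \<and> (\<forall>x. S \<omega> x \<longrightarrow> x \<in> F)" if "finite {x. S \<omega> x}" for \<omega>
      using that by (intro exI[of _ "{x. S \<omega> x}"]) simp
    show "finite {x. S \<omega> x}" if "\<exists>F. finite F \<and> (\<forall>x. S \<omega> x \<longrightarrow> x \<in> F)" for \<omega>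
      using that by (auto intro: finite_subset[of "{x. S \<omega> x}"])
  qed
  moreover have "Measurable.pred P (\<lambda>\<omega>. \<exists>F. finite F \<and> (\<forall>x. S \<omega> x \<longrightarrow> x \<in> F))"
    by (rule pred_ex_fin) measurable
  ultimately show ?thesis by simp
qed

text \<open>\<open>heavy\<close> in terms of finite witnesses, see
  \<open>heavy_iff_inf_weight\<close>. There are only countably many finite vertex sets, which makes
  the notion measurable.\<close>

definition inf_weight :: "'v set \<Rightarrow> bool" where
  "inf_weight S \<longleftrightarrow> (\<forall>n::nat. \<exists>F. finite F \<and> F \<subseteq> S \<and> real n \<le> sum w F)"

text \<open>Unlike \<open>M \<le> card S\<close>, this is correct for infinite \<open>S\<close>,
  whose \<open>card\<close> is 0.\<close>

definition at_least :: "nat \<Rightarrow> 'v set \<Rightarrow> bool" where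
  "at_least M S \<longleftrightarrow> (\<exists>F. finite F \<and> F \<subseteq> S \<and> card F = M)"

lemma pred_subset:
  assumes [measurable]: "\<And>x. Measurable.pred P (\<lambda>\<omega>. S \<omega> x)"
  shows "Measurable.pred P (\<lambda>\<omega>. F \<subseteq> {x::'v. S \<omega> x})"
proof -
  have "F \<subseteq> {x. S \<omega> x} \<longleftrightarrow> (\<forall>x. x \<in> F \<longrightarrow> S \<omega> x)" for \<omega> by auto
  then show ?thesis by simp
qed

lemma pred_inf_weight:
  assumes "\<And>x. Measurable.pred P (\<lambda>\<omega>. S \<omega> x)"
  shows "Measurable.pred P (\<lambda>\<omega>. inf_weight {x. S \<omega> x})"
  unfolding inf_weight_def
  by (intro pred_intros_countable pred_ex_fin pred_intros_logic pred_subset assms) auto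

lemma pred_at_least:
  assumes "\<And>x. Measurable.pred P (\<lambda>\<omega>. S \<omega> x)"
  shows "Measurable.pred P (\<lambda>\<omega>. at_least M {x. S \<omega> x})"
  unfolding at_least_def
  by (intro pred_ex_fin pred_intros_logic pred_subset assms) auto

lemma inf_weight_mono: "inf_weight A \<Longrightarrow> A \<subseteq> B \<Longrightarrow> inf_weight B"
  unfolding inf_weight_def by (meson order_trans)

lemma inf_weight_infinite: "inf_weight A \<Longrightarrow> infinite A"
proof
  assume "inf_weight A" "finite A"
  obtain n :: nat where n: "sum w A < n" using reals_Archimedean2 by blast
  obtain F where "F \<subseteq> A" "real n \<le> sum w F" using \<open>inf_weight A\<close> by (auto simp: inf_weight_def)
  moreover have "sum w F \<le> sum w A"
    using \<open>finite A\<close> \<open>F \<subseteq> A\<close> w_pos by (intro sum_mono2) (auto intro: less_imp_le)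
  ultimately show False using n by simp
qed

lemma inf_weight_csum: assumes "inf_weight A" shows "csum (\<lambda>x. ennreal (w x) * indicator A x) = \<infinity>"
proof -
  have "of_nat n \<le> csum (\<lambda>x. ennreal (w x) * indicator A x)" for n
  proof -
    obtain F where F: "finite F" "F \<subseteq> A" "real n \<le> sum w F" using assms by (auto simp: inf_weight_def)
    have "of_nat n \<le> ennreal (sum w F)" using F(3) by (metis ennreal_leI ennreal_of_nat_eq_real_of_nat)
    also have "\<dots> = (\<Sum>x\<in>F. ennreal (w x))" using w_pos by (simp add: sum_ennreal less_imp_le)
    also have "\<dots> = csum (\<lambda>x. ennreal (w x) * indicator F x)"
      using F(1) by (subst nn_integral_count_space'[of F]) auto
    also have "\<dots> \<le> csum (\<lambda>x. ennreal (w x) * indicator A x)"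
      using F(2) by (intro nn_integral_mono) (auto simp: indicator_def)
    finally show ?thesis .
  qed
  then show ?thesis using ennreal_SUP_of_nat_eq_top by (metis SUP_least infinity_ennreal_def top.extremum_unique)
qed

lemma heavy_iff_inf_weight: "heavy G r A \<longleftrightarrow> inf_weight A"
proof -
  have "infsum (\<lambda>x. ennreal (w x)) A = (SUP F\<in>{F. finite F \<and> F \<subseteq> A}. \<Sum>x\<in>F. ennreal (w x))"
    by (rule nonneg_infsum_complete) auto
  also have "\<dots> = (SUP F\<in>{F. finite F \<and> F \<subseteq> A}. ennreal (sum w F))"
    using w_pos by (simp add: sum_ennreal less_imp_le)
  finally have S: "infsum (\<lambda>x. ennreal (w x)) A = (SUP F\<in>{F. finite F \<and> F \<subseteq> A}. ennreal (sum w F))" .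
  show ?thesis
  proof
    assume "heavy G r A"
    then have top: "(SUP F\<in>{F. finite F \<and> F \<subseteq> A}. ennreal (sum w F)) = top" by (simp add: heavy_def S)
    show "inf_weight A" unfolding inf_weight_def
    proof
      fix n :: nat
      have "\<exists>F\<in>{F. finite F \<and> F \<subseteq> A}. of_nat n < ennreal (sum w F)"
        using top by (subst (asm) SUP_eq_top_iff) (auto simp: of_nat_less_top)
      then obtain F where F: "finite F" "F \<subseteq> A" "of_nat n < ennreal (sum w F)" by auto
      then have "real n < sum w F"
        by (simp add: ennreal_of_nat_eq_real_of_nat ennreal_less_iff)
      then show "\<exists>F. finite F \<and> F \<subseteq> A \<and> real n \<le> sum w F" using F by (auto intro: less_imp_le)
    qed
  next
    assume inf_weight: "inf_weight A"
    have "of_nat n \<le> infsum (\<lambda>x. ennreal (w x)) A" for n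
    proof -
      obtain F where F: "finite F" "F \<subseteq> A" "real n \<le> sum w F" using inf_weight by (auto simp: inf_weight_def)
      have "of_nat n \<le> ennreal (sum w F)" using F(3) by (metis ennreal_leI ennreal_of_nat_eq_real_of_nat)
      also have "\<dots> \<le> infsum (\<lambda>x. ennreal (w x)) A" unfolding S using F by (intro SUP_upper) auto
      finally show ?thesis .
    qed
    then show "heavy G r A" unfolding heavy_def
      using ennreal_SUP_of_nat_eq_top by (metis SUP_least infinity_ennreal_def top.extremum_unique)
  qed
qed

lemma infinite_subset_level_inf_weight: assumes "infinite A" "A \<subseteq> level x" shows "inf_weight A"
  unfolding inf_weight_def
proof
  fix n :: nat
  obtain m :: nat where m: "real n / w x < m" using reals_Archimedean2 by blast
  obtain F where F: "F \<subseteq> A" "finite F" "card F = m"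
    using infinite_arbitrarily_large[OF assms(1)] by blast
  have "sum w F = (\<Sum>y\<in>F. w x)" using F assms(2) by (intro sum.cong) (auto simp: level_def)
  then have "sum w F = m * w x" using F by simp
  then show "\<exists>F. finite F \<and> F \<subseteq> A \<and> real n \<le> sum w F"
    using F m w_pos[of x] by (intro exI[of _ F]) (auto simp: field_simps)
qed

section \<open>Invariance\<close>

text \<open>The configuration pulled back along \<open>g\<close>. Restriction to the edges keeps it
  extensional, hence in the product space.\<close>

definition act :: "('v \<Rightarrow> 'v) \<Rightarrow> ('v set \<Rightarrow> bool) \<Rightarrow> 'v set \<Rightarrow> bool" where
  "act g \<omega> = (\<lambda>e\<in>edges G. \<omega> (g ` e))"

lemma edges_image: "g \<in> Aut G \<Longrightarrow> e \<in> edges G \<Longrightarrow> g ` e \<in> edges G"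
  by (auto simp: edges_def Aut_def)

lemma act_distr: assumes "g \<in> Aut G" shows "distr P P (act g) = P"
proof -
  have "distr (Pi\<^sub>M (edges G) (\<lambda>_. coin)) (Pi\<^sub>M (edges G) (\<lambda>_. coin)) (\<lambda>\<omega>. \<lambda>n\<in>edges G. \<omega> (g ` n))
      = Pi\<^sub>M (edges G) (\<lambda>_. coin)"
  proof (rule distr_PiM_reindex)
    show "inj_on ((`) g) (edges G)"
      using Aut_bij[OF assms] by (meson bij_is_inj inj_on_image inj_on_subset subset_UNIV inj_on_def inj_image_eq_iff)
  qed (use edges_image[OF assms] prob_space_measure_pmf in auto)
  then show ?thesis by (simp add: P_eq act_def[abs_def])
qed

lemma act_measurable: assumes "g \<in> Aut G" shows "act g \<in> measurable P P"
  unfolding P_eq act_def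
proof (rule measurable_restrict)
  fix e assume "e \<in> edges G"
  then show "(\<lambda>\<omega>. \<omega> (g ` e)) \<in> measurable (Pi\<^sub>M (edges G) (\<lambda>_. coin)) coin"
    by (intro measurable_component_singleton edges_image assms)
qed

lemma opn_act: "g \<in> Aut G \<Longrightarrow> opn (act g \<omega>) x y \<longleftrightarrow> opn \<omega> (g x) (g y)"
  by (auto simp: open_subgraph_def act_def edge_mem Aut_edge)

lemma reach_act: assumes "g \<in> Aut G"
  shows "reach (opn (act g \<omega>)) B x y \<longleftrightarrow> reach (opn \<omega>) (g ` B) (g x) (g y)"
proof -
  have "opn (act g \<omega>) = (\<lambda>x y. opn \<omega> (g x) (g y))" using opn_act[OF assms] by (intro ext) simp
  then show ?thesis using reach_image[OF Aut_bij[OF assms]] by simp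
qed

text \<open>\<open>act g\<close> preserves \<open>P\<close>, so the expectation of \<open>f\<close>
  is invariant under moving both vertices, and the deterministic identity applies to it.\<close>

lemma mass_transport:
  fixes f :: "('v set \<Rightarrow> bool) \<Rightarrow> 'v \<Rightarrow> 'v \<Rightarrow> ennreal"
  assumes meas: "\<And>x y. (\<lambda>\<omega>. f \<omega> x y) \<in> borel_measurable P"
    and inv: "\<And>g \<omega> x y. g \<in> Aut G \<Longrightarrow> f (act g \<omega>) x y = f \<omega> (g x) (g y)"
  shows "(\<integral>\<^sup>+\<omega>. csum (\<lambda>y. f \<omega> v y) \<partial>P) = (\<integral>\<^sup>+\<omega>. csum (\<lambda>x. f \<omega> x v * ennreal (w x / w v)) \<partial>P)"
proof -
  have "(\<integral>\<^sup>+\<omega>. csum (\<lambda>y. f \<omega> v y) \<partial>P) = csum (\<lambda>y. \<integral>\<^sup>+\<omega>. f \<omega> v y \<partial>P)"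
    using meas by (intro nn_integral_count_space_nn_integral countable_UNIV) auto
  also have "\<dots> = csum (\<lambda>x. (\<integral>\<^sup>+\<omega>. f \<omega> x v \<partial>P) * ennreal (w x / w v))"
  proof (rule mass_transport_sum)
    fix g x y assume g: "g \<in> Aut G"
    have "(\<integral>\<^sup>+\<omega>. f \<omega> (g x) (g y) \<partial>P) = (\<integral>\<^sup>+\<omega>. f (act g \<omega>) x y \<partial>P)" by (simp add: inv[OF g])
    also have "\<dots> = (\<integral>\<^sup>+\<omega>. f \<omega> x y \<partial>distr P P (act g))"
      using act_measurable[OF g] meas by (subst nn_integral_distr) auto
    finally show "(\<integral>\<^sup>+\<omega>. f \<omega> (g x) (g y) \<partial>P) = (\<integral>\<^sup>+\<omega>. f \<omega> x y \<partial>P)" by (simp add: act_distr[OF g])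
  qed
  also have "\<dots> = csum (\<lambda>x. \<integral>\<^sup>+\<omega>. f \<omega> x v * ennreal (w x / w v) \<partial>P)"
    using meas by (simp add: nn_integral_multc)
  also have "\<dots> = (\<integral>\<^sup>+\<omega>. csum (\<lambda>x. f \<omega> x v * ennreal (w x / w v)) \<partial>P)"
    using meas by (intro nn_integral_count_space_nn_integral[symmetric] countable_UNIV) auto
  finally show ?thesis .
qed

lemma csum_measurable:
  assumes "\<And>x. (\<lambda>\<omega>. f \<omega> x) \<in> borel_measurable P"
  shows "(\<lambda>\<omega>. csum (\<lambda>x::'v. f \<omega> x)) \<in> borel_measurable P"
proof -
  interpret c: sigma_finite_measure "count_space (UNIV :: 'v set)"
    by (rule sigma_finite_measure_count_space_countable[OF countable_UNIV])
  have "(\<lambda>(x, \<omega>). f \<omega> x) \<in> borel_measurable (count_space UNIV \<Otimes>\<^sub>M P)"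
    by (rule measurable_pair_measure_countable1) (use assms countable_UNIV in auto)
  then have "(\<lambda>(\<omega>, x). f \<omega> x) \<in> borel_measurable (P \<Otimes>\<^sub>M count_space UNIV)"
    by (subst measurable_pair_swap_iff) (simp add: case_prod_unfold)
  then show ?thesis by (rule c.borel_measurable_nn_integral)
qed

text \<open>Every vertex distributes mass one uniformly over the set it selects; a vertex receiving mass
  from infinitely much weight would receive infinite expected mass.\<close>

lemma no_finite_selection:
  assumes meas: "\<And>x y. Measurable.pred P (\<lambda>\<omega>. R \<omega> x y)"
    and inv: "\<And>g \<omega> x y. g \<in> Aut G \<Longrightarrow> R (act g \<omega>) x y \<longleftrightarrow> R \<omega> (g x) (g y)"
  shows "AE \<omega> in P. \<forall>v S. finite S \<longrightarrow> v \<in> S \<longrightarrow> \<not> inf_weight {x. {y. R \<omega> x y} = S}"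
proof -
  define c where "c \<omega> x = csum (\<lambda>y. if R \<omega> x y then 1 else 0)" for \<omega> x
  define f where "f \<omega> x y = (if R \<omega> x y then 1 else 0) / c \<omega> x" for \<omega> x y
  have [measurable]: "(\<lambda>\<omega>. c \<omega> x) \<in> borel_measurable P" for x
    unfolding c_def using meas by (intro csum_measurable) measurable
  have fm [measurable]: "(\<lambda>\<omega>. f \<omega> x y) \<in> borel_measurable P" for x y
    unfolding f_def using meas by measurable
  have finv: "f (act g \<omega>) x y = f \<omega> (g x) (g y)" if g: "g \<in> Aut G" for g \<omega> x y
  proof -
    have "c (act g \<omega>) x = csum (\<lambda>y. if R \<omega> (g x) (g y) then 1 else 0)"
      by (simp add: c_def inv[OF g])
    also have "\<dots> = c \<omega> (g x)" unfolding c_def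
      by (rule nn_integral_bij_count_space) (use Aut_bij[OF g] in simp)
    finally show ?thesis by (simp add: f_def inv[OF g])
  qed
  have "AE \<omega> in P. \<forall>S. finite S \<longrightarrow> v \<in> S \<longrightarrow> \<not> inf_weight {x. {y. R \<omega> x y} = S}" for v
  proof -
    \<comment> \<open>In \<open>ennreal\<close> both \<open>0 / 0\<close> and
      \<open>top / top\<close> are 0, so a vertex selecting nothing or infinitely many vertices
      sends no mass.\<close>
    have "csum (\<lambda>y. f \<omega> v y) \<le> 1" for \<omega>
    proof -
      have "csum (\<lambda>y. f \<omega> v y) = c \<omega> v / c \<omega> v"
        unfolding f_def c_def by (simp add: nn_integral_divide)
      also have "\<dots> \<le> 1"
        by (metis ennreal_divide_self ennreal_divide_top ennreal_zero_divide order_refl top.not_eq_extremum zero_le)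
      finally show ?thesis .
    qed
    then have "(\<integral>\<^sup>+\<omega>. csum (\<lambda>y. f \<omega> v y) \<partial>P) \<le> (\<integral>\<^sup>+\<omega>. 1 \<partial>P)" by (intro nn_integral_mono)
    then have "(\<integral>\<^sup>+\<omega>. csum (\<lambda>x. f \<omega> x v * ennreal (w x / w v)) \<partial>P) \<le> 1"
      by (subst mass_transport[where f=f, OF fm finv, symmetric]) (auto simp: emeasure_space_1)
    then have "AE \<omega> in P. csum (\<lambda>x. f \<omega> x v * ennreal (w x / w v)) \<noteq> \<infinity>"
      by (intro nn_integral_PInf_AE csum_measurable) (auto simp: top_unique)
    then show ?thesis
    proof (rule AE_mp[OF _ AE_I2], intro impI allI notI)
      fix \<omega> S
      assume ne: "csum (\<lambda>x. f \<omega> x v * ennreal (w x / w v)) \<noteq> \<infinity>"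
        and S: "finite S" "v \<in> S" and inf_weight: "inf_weight {x. {y. R \<omega> x y} = S}"
      \<comment> \<open>A vertex \<open>x\<close> selecting \<open>S\<close> sends
        \<open>1 / card S\<close> to \<open>v\<close>; with the factor \<open>w x / w v\<close> it
        contributes \<open>k * w x\<close>.\<close>
      define k :: ennreal where "k = ennreal (1 / (real (card S) * w v))"
      have cS: "card S > 0" using S by (auto simp: card_gt_0_iff)
      then have k: "k > 0" using w_pos[of v] by (simp add: k_def)
      have "k * csum (\<lambda>x. ennreal (w x) * indicator {x. {y. R \<omega> x y} = S} x)
          = csum (\<lambda>x. k * (ennreal (w x) * indicator {x. {y. R \<omega> x y} = S} x))"
        by (simp add: nn_integral_cmult)
      also have "\<dots> \<le> csum (\<lambda>x. f \<omega> x v * ennreal (w x / w v))"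
      proof (intro nn_integral_mono)
        fix x
        show "k * (ennreal (w x) * indicator {x. {y. R \<omega> x y} = S} x) \<le> f \<omega> x v * ennreal (w x / w v)"
        proof (cases "{y. R \<omega> x y} = S")
          case True
          have "c \<omega> x = csum (\<lambda>y. indicator S y)" unfolding c_def using True
            by (intro nn_integral_cong) (auto simp: indicator_def)
          then have "c \<omega> x = ennreal (real (card S))"
            using S by (simp add: ennreal_of_nat_eq_real_of_nat)
          moreover have "R \<omega> x v" using True S by auto
          ultimately have "f \<omega> x v = ennreal (1 / real (card S))"
            using cS by (simp add: f_def divide_ennreal[symmetric])
          then have "f \<omega> x v * ennreal (w x / w v) = ennreal (1 / real (card S) * (w x / w v))"
            using w_pos[of x] w_pos[of v] by (simp add: ennreal_mult'[symmetric])
          also have "\<dots> = k * ennreal (w x)" unfolding k_def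
            using w_pos[of x] w_pos[of v] by (simp add: ennreal_mult'[symmetric])
          finally show ?thesis by (simp add: indicator_def)
        qed simp
      qed
      finally show False using inf_weight_csum[OF inf_weight] ne k by (auto simp: ennreal_mult_top top_unique split: if_splits)
    qed
  qed
  then have "AE \<omega> in P. \<forall>v\<in>UNIV. \<forall>S. finite S \<longrightarrow> v \<in> S \<longrightarrow> \<not> inf_weight {x. {y. R \<omega> x y} = S}"
    by (subst AE_ball_countable[OF countable_UNIV]) auto
  then show ?thesis by simp
qed

section \<open>Independence of edges and finite energy\<close>

definition upd :: "'v set set \<Rightarrow> 'v set set \<Rightarrow> ('v set \<Rightarrow> bool) \<Rightarrow> 'v set \<Rightarrow> bool" where
  "upd D O' \<omega> = (\<lambda>e. if e \<in> D then e \<in> O' else \<omega> e)"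

lemma upd_measurable: assumes "D \<subseteq> edges G" shows "upd D O' \<in> measurable P P"
  unfolding P_eq upd_def
proof (rule measurable_PiM_single')
  fix e assume e: "e \<in> edges G"
  show "(\<lambda>\<omega>. if e \<in> D then e \<in> O' else \<omega> e) \<in> measurable (Pi\<^sub>M (edges G) (\<lambda>_. coin)) coin"
    using measurable_component_singleton[OF e, of "\<lambda>_. coin"] by (cases "e \<in> D") auto
next
  show "(\<lambda>\<omega> e. if e \<in> D then e \<in> O' else \<omega> e) \<in> space (Pi\<^sub>M (edges G) (\<lambda>_. coin))
      \<rightarrow> (\<Pi>\<^sub>E i\<in>edges G. space coin)"
    using assms by (auto simp: space_PiM PiE_iff extensional_def)
qed

text \<open>\<open>P\<close> is the image of the product of one coin with the coins of the other
  edges. An event that ignores \<open>e\<close> pulls back to a full strip, and fixing the state of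
  \<open>e\<close> cuts a rectangle out of it.\<close>

lemma emeasure_coord:
  assumes A: "Measurable.pred P A" and e: "e \<in> edges G"
    and indep: "\<And>\<omega> b. A (fun_upd \<omega> e b) \<longleftrightarrow> A \<omega>"
  shows "emeasure P {\<omega>\<in>space P. A \<omega> \<and> \<omega> e = b}
    = ennreal (pmf (bernoulli_pmf p) b) * emeasure P {\<omega>\<in>space P. A \<omega>}"
proof -
  define R where "R = Pi\<^sub>M (edges G - {e}) (\<lambda>_. coin)"
  define f where "f = (\<lambda>(x :: bool, X). X(e := x))"
  interpret R: prob_space R unfolding R_def by (intro prob_space_PiM prob_space_measure_pmf)
  have ins: "insert e (edges G - {e}) = edges G" using e by auto
  have fm: "f \<in> measurable (coin \<Otimes>\<^sub>M R) P"
    using measurable_pair_swap[OF measurable_add_dim[of e "edges G - {e}" "\<lambda>_. coin"]]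
    unfolding ins P_eq R_def f_def by (simp add: case_prod_unfold)
  have D: "distr (coin \<Otimes>\<^sub>M R) P f = P"
    using distr_pair_PiM_eq_PiM[of "edges G - {e}" "\<lambda>_. coin" e,
        OF prob_space_measure_pmf prob_space_measure_pmf]
    unfolding ins P_eq R_def f_def by simp
  define S where "S = {X\<in>space R. A (X(e := True))}"
  have "(\<lambda>X. f (True, X)) \<in> measurable R P"
    using measurable_compose[OF measurable_Pair1' fm, of True] by simp
  then have S: "S \<in> sets R"
    using measurable_compose[OF _ A, of "\<lambda>X. f (True, X)" R] unfolding S_def f_def pred_def by simp
  have ind: "A (X(e := x)) \<longleftrightarrow> A (X(e := True))" for X x
    using indep[of "X(e := x)" True] by simp
  have fin: "f x \<in> space P" if "x \<in> space (coin \<Otimes>\<^sub>M R)" for x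
    using measurable_space[OF fm that] .
  have me: "{\<omega>\<in>space P. A \<omega> \<and> \<omega> e = b} \<in> sets P"
  proof -
    have "Measurable.pred P (\<lambda>\<omega>. A \<omega> \<and> \<omega> e = b)"
      using A measurable_coord[OF e] by measurable
    then show ?thesis by (simp add: pred_def)
  qed
  have "emeasure P {\<omega>\<in>space P. A \<omega> \<and> \<omega> e = b}
      = emeasure (coin \<Otimes>\<^sub>M R) (f -` {\<omega>\<in>space P. A \<omega> \<and> \<omega> e = b} \<inter> space (coin \<Otimes>\<^sub>M R))"
    by (subst D[symmetric], subst emeasure_distr[OF fm]) (use me in auto)
  also have "f -` {\<omega>\<in>space P. A \<omega> \<and> \<omega> e = b} \<inter> space (coin \<Otimes>\<^sub>M R) = {b} \<times> S"
    using fin ind by (auto simp: S_def f_def space_pair_measure)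
  also have "emeasure (coin \<Otimes>\<^sub>M R) ({b} \<times> S) = emeasure coin {b} * emeasure R S"
    using S by (intro R.emeasure_pair_measure_Times) auto
  finally have 1: "emeasure P {\<omega>\<in>space P. A \<omega> \<and> \<omega> e = b} = emeasure coin {b} * emeasure R S" .
  have mA: "{\<omega>\<in>space P. A \<omega>} \<in> sets P" using A by (simp add: pred_def)
  have "emeasure P {\<omega>\<in>space P. A \<omega>}
      = emeasure (coin \<Otimes>\<^sub>M R) (f -` {\<omega>\<in>space P. A \<omega>} \<inter> space (coin \<Otimes>\<^sub>M R))"
    by (subst D[symmetric], subst emeasure_distr[OF fm]) (use mA in auto)
  also have "f -` {\<omega>\<in>space P. A \<omega>} \<inter> space (coin \<Otimes>\<^sub>M R) = UNIV \<times> S"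
    using fin ind by (auto simp: S_def f_def space_pair_measure)
  also have "emeasure (coin \<Otimes>\<^sub>M R) (UNIV \<times> S) = emeasure coin UNIV * emeasure R S"
    using S by (intro R.emeasure_pair_measure_Times) auto
  also have "\<dots> = emeasure R S" using measure_pmf.emeasure_space_1[of "bernoulli_pmf p"] by simp
  finally show ?thesis using 1 by (simp add: emeasure_pmf_single)
qed

lemma emeasure_closed:
  assumes A: "Measurable.pred P A" and D: "finite D" "D \<subseteq> edges G"
    and indep: "\<And>\<omega> e b. e \<in> D \<Longrightarrow> A (fun_upd \<omega> e b) \<longleftrightarrow> A \<omega>"
  shows "emeasure P {\<omega>\<in>space P. A \<omega> \<and> (\<forall>e\<in>D. \<not> \<omega> e)}
    = ennreal ((1 - p) ^ card D) * emeasure P {\<omega>\<in>space P. A \<omega>}"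
  using D indep
proof (induction D rule: finite_induct)
  case (insert e D)
  have "emeasure P {\<omega>\<in>space P. (A \<omega> \<and> (\<forall>e\<in>D. \<not> \<omega> e)) \<and> \<omega> e = False}
    = ennreal (pmf (bernoulli_pmf p) False) * emeasure P {\<omega>\<in>space P. A \<omega> \<and> (\<forall>e\<in>D. \<not> \<omega> e)}"
  proof (rule emeasure_coord)
    have "Measurable.pred P (\<lambda>\<omega>. \<forall>e\<in>D. \<not> \<omega> e)"
      using insert.hyps insert.prems measurable_coord
      by (intro pred_intros_finite pred_intros_logic) auto
    then show "Measurable.pred P (\<lambda>\<omega>. A \<omega> \<and> (\<forall>e\<in>D. \<not> \<omega> e))" using A by measurable
    show "(A (fun_upd \<omega> e b) \<and> (\<forall>d\<in>D. \<not> (fun_upd \<omega> e b) d)) \<longleftrightarrow> (A \<omega> \<and> (\<forall>e\<in>D. \<not> \<omega> e))" for \<omega> b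
    proof -
      have "A (fun_upd \<omega> e b) \<longleftrightarrow> A \<omega>" using insert.prems(2) by blast
      moreover have "fun_upd \<omega> e b d = \<omega> d" if "d \<in> D" for d using that insert.hyps(2) by auto
      ultimately show ?thesis by simp
    qed
  qed (use insert in auto)
  also have "emeasure P {\<omega>\<in>space P. A \<omega> \<and> (\<forall>e\<in>D. \<not> \<omega> e)}
      = ennreal ((1 - p) ^ card D) * emeasure P {\<omega>\<in>space P. A \<omega>}"
    using insert by auto
  also have "{\<omega>\<in>space P. (A \<omega> \<and> (\<forall>e\<in>D. \<not> \<omega> e)) \<and> \<omega> e = False}
      = {\<omega>\<in>space P. A \<omega> \<and> (\<forall>e\<in>insert e D. \<not> \<omega> e)}" by auto
  finally show ?case
    using insert.hyps p01 by (simp add: ennreal_mult mult.assoc)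
qed simp

text \<open>Whether setting \<open>e\<close> to \<open>b\<close> violates \<open>A\<close> does not
  depend on \<open>e\<close>, hence is independent of the event that \<open>e\<close> already has
  state \<open>b\<close>. On that event nothing is changed and the violation is null; as the event
  has positive probability, the violation is null altogether.\<close>

lemma finite_energy1:
  assumes A: "Measurable.pred P A" and e: "e \<in> edges G" and p: "0 < p" "p < 1"
    and ae: "AE \<omega> in P. A \<omega>"
  shows "AE \<omega> in P. A (fun_upd \<omega> e b)"
proof -
  have upd: "(\<lambda>\<omega>. fun_upd \<omega> e b) = upd {e} (if b then {e} else {})"
    by (auto simp: upd_def fun_eq_iff)
  have m: "(\<lambda>\<omega>. fun_upd \<omega> e b) \<in> measurable P P" unfolding upd using e by (intro upd_measurable) auto
  have A': "Measurable.pred P (\<lambda>\<omega>. \<not> A (fun_upd \<omega> e b))"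
    using measurable_compose[OF m A] by measurable
  have "ennreal (pmf (bernoulli_pmf p) b) * emeasure P {\<omega>\<in>space P. \<not> A (fun_upd \<omega> e b)}
      = emeasure P {\<omega>\<in>space P. \<not> A (fun_upd \<omega> e b) \<and> \<omega> e = b}"
    by (rule emeasure_coord[OF A' e, symmetric]) simp
  also have "{\<omega>\<in>space P. \<not> A (fun_upd \<omega> e b) \<and> \<omega> e = b} = {\<omega>\<in>space P. \<not> A \<omega> \<and> \<omega> e = b}"
    by (auto simp: fun_upd_idem)
  also have "emeasure P \<dots> \<le> emeasure P {\<omega>\<in>space P. \<not> A \<omega>}"
    using A by (intro emeasure_mono) (auto simp: pred_def)
  also have "\<dots> = 0" using ae A by (subst AE_iff_measurable[symmetric, OF _ refl]) (auto simp: pred_def)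
  finally have "emeasure P {\<omega>\<in>space P. \<not> A (fun_upd \<omega> e b)} = 0"
    using p by (cases b) (auto simp: fun_upd_def)
  then show ?thesis
    using A' by (subst AE_iff_measurable[OF _ refl]) (auto simp: pred_def)
qed

lemma finite_energy:
  assumes A: "Measurable.pred P A" and D: "finite D" "D \<subseteq> edges G" and p: "0 < p" "p < 1"
    and ae: "AE \<omega> in P. A \<omega>"
  shows "AE \<omega> in P. A (upd D O' \<omega>)"
  using D
proof (induction D rule: finite_induct)
  case empty
  show ?case using ae by (simp add: upd_def)
next
  case (insert e D)
  have "AE \<omega> in P. A (upd D O' (fun_upd \<omega> e (e \<in> O')))"
    using insert measurable_compose[OF upd_measurable A, of D O'] p
    by (intro finite_energy1[of "\<lambda>\<omega>. A (upd D O' \<omega>)"]) auto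
  moreover have "upd D O' (fun_upd \<omega> e (e \<in> O')) = upd (insert e D) O' \<omega>" for \<omega>
    using insert by (auto simp: upd_def fun_eq_iff)
  ultimately show ?case by simp
qed

lemma AE_all_v:
  "(\<And>x. AE \<omega> in P. Q \<omega> x) \<Longrightarrow> AE \<omega> in P. \<forall>x::'v. Q \<omega> x"
  using AE_ball_countable[OF countable_UNIV, of "\<lambda>\<omega> x. Q \<omega> x" P] by simp

section \<open>Infinitely many attempts to reach a set\<close>

abbreviation cluster :: "('v set \<Rightarrow> bool) \<Rightarrow> 'v \<Rightarrow> 'v set" where
  "cluster \<omega> x \<equiv> {y. reach (opn \<omega>) {} x y}"

text \<open>The cluster of \<open>x\<close> in the complement of \<open>B\<close> is independent of the edges leading into \<open>B\<close>.\<close>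

lemma hit_nonempty:
  assumes nb: "\<And>a. a \<in> A \<Longrightarrow> G a (nb a) \<and> nb a \<in> B" and p: "0 < p"
  shows "AE \<omega> in P. infinite (cluster \<omega> x \<inter> A) \<longrightarrow> cluster \<omega> x \<inter> B \<noteq> {}"
proof -
  \<comment> \<open>Reached off \<open>B\<close>, so the available attempts are determined without
    inspecting any edge that ends in \<open>B\<close>.\<close>
  define X where "X \<omega> = {a. a \<in> A - B \<and> reach (opn \<omega>) B x a}" for \<omega>
  define ed where "ed a = {a, nb a}" for a
  define idx :: "'v \<Rightarrow> nat" where "idx = to_nat_on UNIV"
  have idx: "inj idx" unfolding idx_def by (rule inj_on_to_nat_on[OF countable_UNIV])
  \<comment> \<open>\<open>S\<close> consists of the first elements of \<open>X \<omega>\<close> in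
    the enumeration \<open>idx\<close>; spelled out over all vertices for measurability.\<close>
  define fst_n where "fst_n S \<omega> \<longleftrightarrow> S \<subseteq> {a. a \<in> A - B \<and> reach (opn \<omega>) B x a} \<and>
    (\<forall>b. b \<in> A - B \<and> reach (opn \<omega>) B x b \<longrightarrow> (\<forall>a. a \<in> S \<longrightarrow> b \<notin> S \<longrightarrow> idx a < idx b))" for S \<omega>
  have fst_n: "fst_n S \<omega> \<longleftrightarrow> S \<subseteq> X \<omega> \<and> (\<forall>a\<in>S. \<forall>b\<in>X \<omega> - S. idx a < idx b)" for S \<omega>
    unfolding fst_n_def X_def by blast
  have mfst: "Measurable.pred P (fst_n S)" for S
    unfolding fst_n_def by (intro pred_intros_logic pred_subset pred_all_v) measurable
  define bad where "bad \<omega> \<longleftrightarrow> infinite (X \<omega>) \<and> (\<forall>a\<in>X \<omega>. \<not> \<omega> (ed a))" for \<omega>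
  define \<S> where "\<S> n = {S :: 'v set. finite S \<and> S \<subseteq> A - B \<and> card S = n}" for n
  have cS: "countable (\<S> n)" for n
    by (rule countable_subset[OF _ countable_finite_sets]) (auto simp: \<S>_def)
  have edE: "ed a \<in> edges G" if "a \<in> A" for a using nb[OF that] edge_mem by (simp add: ed_def)
  have closed: "emeasure P {\<omega>\<in>space P. fst_n S \<omega> \<and> (\<forall>e\<in>ed ` S. \<not> \<omega> e)}
      = ennreal ((1 - p) ^ n) * emeasure P {\<omega>\<in>space P. fst_n S \<omega>}" if S: "S \<in> \<S> n" for S n
  proof -
    have "inj_on ed S"
    proof (rule inj_onI)
      fix a b assume ab: "a \<in> S" "b \<in> S" "ed a = ed b"
      have "a \<in> A" "b \<in> A" "a \<notin> B" "b \<notin> B" using S ab by (auto simp: \<S>_def)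
      then have "nb a \<in> B" "nb b \<in> B" using nb by auto
      then show "a = b" using ab(3) \<open>a \<notin> B\<close> \<open>b \<notin> B\<close> by (auto simp: ed_def doubleton_eq_iff)
    qed
    then have "card (ed ` S) = n" using S by (simp add: card_image \<S>_def)
    moreover have "fst_n S (fun_upd \<omega> e b) \<longleftrightarrow> fst_n S \<omega>" if e: "e \<in> ed ` S" for \<omega> e b
    proof -
      obtain a where a: "a \<in> S" "e = {a, nb a}" using e by (auto simp: ed_def)
      then have "nb a \<in> B" using nb S by (auto simp: \<S>_def)
      then have "avoid (opn (fun_upd \<omega> e b)) B = avoid (opn \<omega>) B"
        using a by (auto simp: avoid_def open_subgraph_def fun_eq_iff doubleton_eq_iff)
      then show ?thesis by (simp add: fst_n_def reach_def)
    qed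
    moreover have "ed ` S \<subseteq> edges G" using S edE by (auto simp: \<S>_def)
    ultimately show ?thesis
      using emeasure_closed[OF mfst, of "ed ` S" S] S by (auto simp: \<S>_def)
  qed
  \<comment> \<open>Disjointness is what keeps the total probability of the events
    \<open>fst_n S\<close> at most one in the union bound.\<close>
  have disj: "disjoint_family_on (\<lambda>S. {\<omega>\<in>space P. fst_n S \<omega>}) (\<S> n)" for n
    unfolding disjoint_family_on_def
  proof (intro ballI impI)
    fix S T assume ST: "S \<in> \<S> n" "T \<in> \<S> n" "S \<noteq> T"
    then have "\<not> S \<subseteq> T" "\<not> T \<subseteq> S"
      using card_subset_eq[of T S] card_subset_eq[of S T] by (auto simp: \<S>_def)
    then obtain a b where ab: "a \<in> S - T" "b \<in> T - S" by blast
    show "{\<omega>\<in>space P. fst_n S \<omega>} \<inter> {\<omega>\<in>space P. fst_n T \<omega>} = {}"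
    proof (rule ccontr)
      assume "\<not> ?thesis"
      then obtain \<omega> where "fst_n S \<omega>" "fst_n T \<omega>" by auto
      then have "idx a < idx b" "idx b < idx a" using ab unfolding fst_n by blast+
      then show False by simp
    qed
  qed
  have m1: "{\<omega>\<in>space P. fst_n S \<omega>} \<in> sets P" for S using mfst by (simp add: pred_def)
  have m2: "{\<omega>\<in>space P. fst_n S \<omega> \<and> (\<forall>e\<in>ed ` S. \<not> \<omega> e)} \<in> sets P" if "S \<in> \<S> n" for S n
  proof -
    have "Measurable.pred P (\<lambda>\<omega>. \<forall>e\<in>ed ` S. \<not> \<omega> e)"
      using that edE measurable_coord by (intro pred_intros_finite pred_intros_logic) (auto simp: \<S>_def)
    then have "Measurable.pred P (\<lambda>\<omega>. fst_n S \<omega> \<and> (\<forall>e\<in>ed ` S. \<not> \<omega> e))" using mfst by measurable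
    then show ?thesis by (simp add: pred_def)
  qed
  have mbad: "{\<omega>\<in>space P. bad \<omega>} \<in> sets P"
  proof -
    have "Measurable.pred P (\<lambda>\<omega>. \<omega> (ed a))" if "a \<in> A" for a using measurable_coord[OF edE[OF that]] .
    then have "Measurable.pred P (\<lambda>\<omega>. a \<in> A \<and> \<omega> (ed a))" for a by (cases "a \<in> A") auto
    moreover define q where "q a \<omega> \<longleftrightarrow> a \<in> A \<and> \<omega> (ed a)" for a \<omega>
    ultimately have [measurable]: "Measurable.pred P (q a)" for a by (simp add: q_def[abs_def])
    have "bad = (\<lambda>\<omega>. \<not> finite {a. a \<in> A - B \<and> reach (opn \<omega>) B x a} \<and>
        (\<forall>a. a \<in> A - B \<and> reach (opn \<omega>) B x a \<longrightarrow> \<not> q a \<omega>))"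
      by (auto simp: bad_def X_def q_def fun_eq_iff)
    then have "Measurable.pred P bad"
      by (simp only:) (intro pred_intros_logic pred_finite pred_all_v; measurable)
    then show ?thesis by (simp add: pred_def)
  qed
  \<comment> \<open>A bad configuration fails its first \<open>n\<close> attempts, and these use
    \<open>n\<close> distinct edges.\<close>
  have bound: "emeasure P {\<omega>\<in>space P. bad \<omega>} \<le> ennreal ((1 - p) ^ n)" for n
  proof -
    have "{\<omega>\<in>space P. bad \<omega>} \<subseteq> (\<Union>S\<in>\<S> n. {\<omega>\<in>space P. fst_n S \<omega> \<and> (\<forall>e\<in>ed ` S. \<not> \<omega> e)})"
    proof safe
      fix \<omega> assume w: "\<omega> \<in> space P" "bad \<omega>"
      then obtain S where S: "finite S" "S \<subseteq> X \<omega>" "card S = n" "\<forall>a\<in>S. \<forall>b\<in>X \<omega> - S. idx a < idx b"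
        using first_elements[OF _ idx, of "X \<omega>" n] by (auto simp: bad_def)
      then have "S \<in> \<S> n" by (auto simp: \<S>_def X_def)
      moreover have "fst_n S \<omega>" using S by (simp add: fst_n)
      moreover have "\<forall>e\<in>ed ` S. \<not> \<omega> e" using w(2) S(2) by (auto simp: bad_def)
      ultimately show "\<omega> \<in> (\<Union>S\<in>\<S> n. {\<omega>\<in>space P. fst_n S \<omega> \<and> (\<forall>e\<in>ed ` S. \<not> \<omega> e)})" using w by blast
    qed
    then have "emeasure P {\<omega>\<in>space P. bad \<omega>}
        \<le> emeasure P (\<Union>S\<in>\<S> n. {\<omega>\<in>space P. fst_n S \<omega> \<and> (\<forall>e\<in>ed ` S. \<not> \<omega> e)})"
      by (rule emeasure_mono) (intro sets.countable_UN' cS image_subsetI m2)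
    also have "\<dots> = (\<integral>\<^sup>+S. emeasure P {\<omega>\<in>space P. fst_n S \<omega> \<and> (\<forall>e\<in>ed ` S. \<not> \<omega> e)} \<partial>count_space (\<S> n))"
    proof (rule emeasure_UN_countable[OF _ cS])
      show "disjoint_family_on (\<lambda>S. {\<omega>\<in>space P. fst_n S \<omega> \<and> (\<forall>e\<in>ed ` S. \<not> \<omega> e)}) (\<S> n)"
        unfolding disjoint_family_on_def
      proof (intro ballI impI)
        fix S T assume "S \<in> \<S> n" "T \<in> \<S> n" "S \<noteq> T"
        then have "{\<omega>\<in>space P. fst_n S \<omega>} \<inter> {\<omega>\<in>space P. fst_n T \<omega>} = {}"
          using disj[of n] unfolding disjoint_family_on_def by blast
        then show "{\<omega>\<in>space P. fst_n S \<omega> \<and> (\<forall>e\<in>ed ` S. \<not> \<omega> e)} \<inter>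
          {\<omega>\<in>space P. fst_n T \<omega> \<and> (\<forall>e\<in>ed ` T. \<not> \<omega> e)} = {}" by blast
      qed
    qed (rule m2)
    also have "\<dots> = (\<integral>\<^sup>+S. ennreal ((1 - p) ^ n) * emeasure P {\<omega>\<in>space P. fst_n S \<omega>} \<partial>count_space (\<S> n))"
      by (intro nn_integral_cong closed) simp
    also have "\<dots> = ennreal ((1 - p) ^ n) * emeasure P (\<Union>S\<in>\<S> n. {\<omega>\<in>space P. fst_n S \<omega>})"
      by (simp add: nn_integral_cmult emeasure_UN_countable[OF m1 cS disj])
    also have "\<dots> \<le> ennreal ((1 - p) ^ n) * 1" by (intro mult_left_mono measure_le_1) simp
    finally show ?thesis by simp
  qed
  have "(\<lambda>n. ennreal ((1 - p) ^ n)) \<longlonglongrightarrow> ennreal 0"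
    using p p01 by (intro tendsto_ennrealI LIMSEQ_realpow_zero) auto
  then have "emeasure P {\<omega>\<in>space P. bad \<omega>} \<le> 0"
    using bound by (intro LIMSEQ_le_const[of "\<lambda>n. ennreal ((1 - p) ^ n)"]) auto
  then have "AE \<omega> in P. \<not> bad \<omega>"
    using mbad by (subst AE_iff_measurable[OF _ refl]) auto
  then show ?thesis
  proof (rule AE_mp[OF _ AE_I2], intro impI notI)
    fix \<omega> assume nbad: "\<not> bad \<omega>" and inf: "infinite (cluster \<omega> x \<inter> A)" and emp: "cluster \<omega> x \<inter> B = {}"
    have xB: "x \<notin> B" using emp reach_refl[of x "{}" "opn \<omega>"] by auto
    \<comment> \<open>A cluster that misses \<open>B\<close> is explored completely without entering
      \<open>B\<close>.\<close>
    have "reach (opn \<omega>) B x y" if "reach (opn \<omega>) {} x y" for y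
      using that
    proof (induction rule: reach_induct)
      case base
      show ?case using xB by (rule reach_refl)
    next
      case (step a b)
      then have "b \<notin> B" using emp reach_step[of "opn \<omega>" "{}" x a b] by auto
      then show ?case using step reach_step by metis
    qed
    then have "cluster \<omega> x \<inter> A \<subseteq> X \<omega>" using emp by (auto simp: X_def)
    then have "infinite (X \<omega>)" using inf finite_subset by blast
    then obtain a where a: "a \<in> X \<omega>" "\<omega> (ed a)" using nbad by (auto simp: bad_def)
    then have "opn \<omega> a (nb a)" "nb a \<in> B" using nb by (auto simp: X_def ed_def open_subgraph_def)
    moreover have "reach (opn \<omega>) {} x a" using a by (auto simp: X_def reach_empty reach_rtranclp)
    ultimately have "nb a \<in> cluster \<omega> x \<inter> B" using reach_step[of "opn \<omega>" "{}" x a "nb a"] by auto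
    then show False using emp by blast
  qed
qed

text \<open>Apply \<open>hit_nonempty\<close> to \<open>B - Z\<close> for each of the countably many
  finite \<open>Z\<close>. If the cluster met \<open>B\<close> finitely often, take that
  intersection as \<open>Z\<close>: by local finiteness only finitely many attempts are
  lost.\<close>

lemma hit_infinite:
  assumes nb: "\<And>a. a \<in> A \<Longrightarrow> \<exists>b\<in>B. G a b" and p: "0 < p"
  shows "AE \<omega> in P. \<forall>x. infinite (cluster \<omega> x \<inter> A) \<longrightarrow> infinite (cluster \<omega> x \<inter> B)"
proof -
  obtain nb where nb: "\<And>a. a \<in> A \<Longrightarrow> G a (nb a) \<and> nb a \<in> B" using assms(1) by metis
  define A' where "A' Z = {a\<in>A. nb a \<notin> Z}" for Z
  have "AE \<omega> in P. \<forall>Z\<in>{Z. finite Z}. infinite (cluster \<omega> x \<inter> A' Z) \<longrightarrow> cluster \<omega> x \<inter> (B - Z) \<noteq> {}" for x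
    by (subst AE_ball_countable[OF countable_finite_sets], intro ballI,
        rule hit_nonempty[of _ nb]) (use nb p in \<open>auto simp: A'_def\<close>)
  then have "AE \<omega> in P. \<forall>x. \<forall>Z\<in>{Z. finite Z}.
      infinite (cluster \<omega> x \<inter> A' Z) \<longrightarrow> cluster \<omega> x \<inter> (B - Z) \<noteq> {}"
    by (rule AE_all_v)
  then show ?thesis
  proof (rule AE_mp[OF _ AE_I2], intro impI allI notI)
    fix \<omega> x
    assume *: "\<forall>x. \<forall>Z\<in>{Z. finite Z}. infinite (cluster \<omega> x \<inter> A' Z) \<longrightarrow> cluster \<omega> x \<inter> (B - Z) \<noteq> {}"
      and inf: "infinite (cluster \<omega> x \<inter> A)" and fin: "finite (cluster \<omega> x \<inter> B)"
    define Z where "Z = cluster \<omega> x \<inter> B"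
    have "A - A' Z \<subseteq> (\<Union>z\<in>Z. {a. G z a})" using nb sym by (auto simp: A'_def)
    then have "finite (A - A' Z)" using fin fin_nbrs by (auto simp: Z_def intro: finite_subset)
    then have "infinite (cluster \<omega> x \<inter> A' Z)"
      using inf finite_subset[of "cluster \<omega> x \<inter> A" "(cluster \<omega> x \<inter> A' Z) \<union> (A - A' Z)"] by blast
    then have "cluster \<omega> x \<inter> (B - Z) \<noteq> {}" using * fin unfolding Z_def by blast
    then show False by (auto simp: Z_def)
  qed
qed

text \<open>Every vertex of \<open>level u\<close> has a neighbour in \<open>level v\<close> once
  \<open>u\<close> and \<open>v\<close> are adjacent; a path connects arbitrary levels.\<close>

lemma hit_levels:
  assumes "0 < p"
  shows "AE \<omega> in P. \<forall>x u v. infinite (cluster \<omega> x \<inter> level u) \<longrightarrow> infinite (cluster \<omega> x \<inter> level v)"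
proof -
  have "AE \<omega> in P. \<forall>x. infinite (cluster \<omega> x \<inter> level u) \<longrightarrow> infinite (cluster \<omega> x \<inter> level v)" if "G u v" for u v
  proof (rule hit_infinite[OF _ assms])
    fix a assume "a \<in> level u"
    then show "\<exists>b\<in>level v. G a b" using nbr_ratio[OF that, of a] w_pos[of u] by (auto simp: level_def)
  qed
  then have "AE \<omega> in P. G u v \<longrightarrow> (\<forall>x. infinite (cluster \<omega> x \<inter> level u) \<longrightarrow> infinite (cluster \<omega> x \<inter> level v))" for u v
    by (cases "G u v") auto
  then have "AE \<omega> in P. \<forall>u v. G u v \<longrightarrow> (\<forall>x. infinite (cluster \<omega> x \<inter> level u) \<longrightarrow> infinite (cluster \<omega> x \<inter> level v))"
    by (intro AE_all_v)
  then show ?thesis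
  proof (rule AE_mp[OF _ AE_I2], intro impI allI)
    fix \<omega> x u v
    assume *: "\<forall>u v. G u v \<longrightarrow> (\<forall>x. infinite (cluster \<omega> x \<inter> level u) \<longrightarrow> infinite (cluster \<omega> x \<inter> level v))"
      and u: "infinite (cluster \<omega> x \<inter> level u)"
    show "infinite (cluster \<omega> x \<inter> level v)"
      using conn[of u v]
    proof (induction rule: rtranclp_induct)
      case base
      show ?case by (rule u)
    next
      case (step a b)
      then show ?case using * by blast
    qed
  qed
qed

section \<open>Heavy clusters have unbounded weights\<close>

definition above :: "real \<Rightarrow> 'v set" where "above s = {y. s \<le> w y}"

lemma reach_cluster_eq: "reach (opn \<omega>) {} x y \<Longrightarrow> cluster \<omega> y = cluster \<omega> x"
  by (intro Collect_cong iffI) (metis reach_trans, metis reach_sym[OF opn_sym] reach_trans)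

lemma reach_empty_refl: "reach E {} x x"
  by (simp add: reach_refl)

text \<open>Let each vertex select the heaviest vertices of its cluster. All vertices of one cluster
  select the same set, so the selectors have infinite weight.\<close>

lemma no_finite_top:
  "AE \<omega> in P. \<forall>x. inf_weight (cluster \<omega> x) \<longrightarrow>
     \<not> (finite {y \<in> cluster \<omega> x. \<forall>z\<in>cluster \<omega> x. w z \<le> w y} \<and> {y \<in> cluster \<omega> x. \<forall>z\<in>cluster \<omega> x. w z \<le> w y} \<noteq> {})"
proof -
  define R where "R \<omega> x y \<longleftrightarrow> reach (opn \<omega>) {} x y \<and> (\<forall>z. reach (opn \<omega>) {} x z \<longrightarrow> w z \<le> w y)" for \<omega> x y
  have "AE \<omega> in P. \<forall>v S. finite S \<longrightarrow> v \<in> S \<longrightarrow> \<not> inf_weight {x. {y. R \<omega> x y} = S}"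
  proof (rule no_finite_selection)
    show "Measurable.pred P (\<lambda>\<omega>. R \<omega> x y)" for x y unfolding R_def by measurable
    fix g \<omega> x y assume g: "g \<in> Aut G"
    show "R (act g \<omega>) x y \<longleftrightarrow> R \<omega> (g x) (g y)"
    proof -
      have "(\<forall>z. reach (opn \<omega>) {} (g x) (g z) \<longrightarrow> w z \<le> w y)
          \<longleftrightarrow> (\<forall>z. reach (opn \<omega>) {} (g x) (g z) \<longrightarrow> w (g z) \<le> w (g y))"
        by (simp add: w_Aut_le[OF g])
      also have "\<dots> \<longleftrightarrow> (\<forall>z. reach (opn \<omega>) {} (g x) z \<longrightarrow> w z \<le> w (g y))"
        using Aut_inv_right[OF g] by metis
      finally show ?thesis by (simp add: R_def reach_act[OF g])
    qed
  qed
  then show ?thesis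
  proof (rule AE_mp[OF _ AE_I2], intro impI allI notI)
    fix \<omega> x
    define S where "S = {y \<in> cluster \<omega> x. \<forall>z\<in>cluster \<omega> x. w z \<le> w y}"
    assume *: "\<forall>v S. finite S \<longrightarrow> v \<in> S \<longrightarrow> \<not> inf_weight {x. {y. R \<omega> x y} = S}"
      and inf_weight: "inf_weight (cluster \<omega> x)" and fin: "finite {y \<in> cluster \<omega> x. \<forall>z\<in>cluster \<omega> x. w z \<le> w y} \<and>
        {y \<in> cluster \<omega> x. \<forall>z\<in>cluster \<omega> x. w z \<le> w y} \<noteq> {}"
    then obtain v where v: "v \<in> S" "finite S" unfolding S_def by blast
    have "{y. R \<omega> u y} = S" if "u \<in> cluster \<omega> x" for u
    proof -
      have "cluster \<omega> u = cluster \<omega> x" using that reach_cluster_eq by simp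
      moreover have "{y. R \<omega> u y} = {y \<in> cluster \<omega> u. \<forall>z\<in>cluster \<omega> u. w z \<le> w y}" by (auto simp: R_def)
      ultimately show ?thesis by (simp only: S_def)
    qed
    then have "cluster \<omega> x \<subseteq> {u. {y. R \<omega> u y} = S}" by blast
    then show False using * v inf_weight inf_weight_mono by blast
  qed
qed

text \<open>With finitely many vertices above every positive threshold, the vertices of maximal
  weight would form a finite nonempty set. So some positive threshold is exceeded infinitely often,
  and repeated attempts at a step of ratio \<open>l\<close> raise it.\<close>

lemma heavy_unbounded:
  assumes p: "0 < p"
  shows "AE \<omega> in P. \<forall>x. inf_weight (cluster \<omega> x) \<longrightarrow> (\<forall>s. infinite (cluster \<omega> x \<inter> above s))"
proof -
  obtain l where l: "l > 1" "\<And>x. \<exists>y. G x y \<and> w y = l * w x" using growth by blast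
  have "AE \<omega> in P. \<forall>x. infinite (cluster \<omega> x \<inter> above s) \<longrightarrow> infinite (cluster \<omega> x \<inter> above (l * s))" for s
  proof (rule hit_infinite[OF _ p])
    fix a assume "a \<in> above s"
    moreover obtain b where "G a b" "w b = l * w a" using l(2) by blast
    ultimately show "\<exists>b\<in>above (l * s). G a b" using l(1) by (intro bexI[of _ b]) (auto simp: above_def)
  qed
  \<comment> \<open>A countable family of thresholds: \<open>1 / Suc m\<close> gets below any
    positive one, and the powers of \<open>l\<close> climb from there.\<close>
  then have "AE \<omega> in P. \<forall>m k::nat. \<forall>x. infinite (cluster \<omega> x \<inter> above (l ^ k / Suc m)) \<longrightarrow>
      infinite (cluster \<omega> x \<inter> above (l * (l ^ k / Suc m)))"
    by (simp only: AE_all_countable) blast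
  with no_finite_top show ?thesis
  proof eventually_elim
    case (elim \<omega>)
    show ?case
    proof (intro allI impI)
      fix x and s :: real assume inf_weight: "inf_weight (cluster \<omega> x)"
      have "\<exists>s>0. infinite (cluster \<omega> x \<inter> above s)"
      proof (rule ccontr)
        assume *: "\<not> ?thesis"
        then have fin: "finite (cluster \<omega> x \<inter> above (w x))" using w_pos[of x] by blast
        have "x \<in> cluster \<omega> x \<inter> above (w x)" by (simp add: above_def reach_empty_refl)
        then have ne: "cluster \<omega> x \<inter> above (w x) \<noteq> {}" by blast
        define t where "t = Max (w ` (cluster \<omega> x \<inter> above (w x)))"
        have t: "t \<in> w ` (cluster \<omega> x \<inter> above (w x))" unfolding t_def using fin ne by (intro Max_in) auto
        then obtain y where y: "y \<in> cluster \<omega> x" "w y = t" "w x \<le> t" by (auto simp: above_def)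
        have top: "w z \<le> t" if "z \<in> cluster \<omega> x" for z
        proof (cases "w x \<le> w z")
          case True
          then have "w z \<in> w ` (cluster \<omega> x \<inter> above (w x))" using that by (auto simp: above_def)
          then show ?thesis unfolding t_def using fin by (intro Max_ge) auto
        qed (use y in auto)
        have "{y \<in> cluster \<omega> x. \<forall>z\<in>cluster \<omega> x. w z \<le> w y} \<subseteq> cluster \<omega> x \<inter> above (w x)"
          by (auto simp: above_def reach_empty_refl)
        moreover have "y \<in> {y \<in> cluster \<omega> x. \<forall>z\<in>cluster \<omega> x. w z \<le> w y}" using y top by auto
        ultimately show False using elim(1) inf_weight fin finite_subset by (metis (lifting) empty_iff)
      qed
      then obtain s0 where s0: "s0 > 0" "infinite (cluster \<omega> x \<inter> above s0)" by blast
      obtain m :: nat where m: "1 / Suc m < s0" using s0(1) nat_approx_posE by metis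
      have "infinite (cluster \<omega> x \<inter> above (l ^ k / Suc m))" for k
      proof (induction k)
        case 0
        have "cluster \<omega> x \<inter> above s0 \<subseteq> cluster \<omega> x \<inter> above (l ^ 0 / Suc m)" using m by (auto simp: above_def)
        then show ?case using s0(2) finite_subset by blast
      next
        case (Suc k)
        then show ?case using elim(2) by simp
      qed
      moreover obtain k where "s * Suc m < l ^ k" using real_arch_pow l(1) by blast
      then have "s < l ^ k / Suc m" by (simp add: pos_less_divide_eq)
      then have "above (l ^ k / Suc m) \<subseteq> above s" by (auto simp: above_def)
      ultimately show "infinite (cluster \<omega> x \<inter> above s)"
        by (meson Int_mono finite_subset order_refl)
    qed
  qed
qed

section \<open>Weight and cardinality under automorphisms\<close>

lemma image_Collect_Aut:
  assumes "g \<in> Aut G" shows "g ` {y. Q (g y)} = {y. Q y}"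
proof
  show "{y. Q y} \<subseteq> g ` {y. Q (g y)}"
  proof
    fix y assume "y \<in> {y. Q y}"
    then show "y \<in> g ` {y. Q (g y)}"
      using Aut_inv_right[OF assms, of y] by (intro image_eqI[of y g "inv g y"]) auto
  qed
qed auto

lemma inf_weight_image: assumes g: "g \<in> Aut G" shows "inf_weight (g ` A) \<longleftrightarrow> inf_weight A"
proof -
  have imp: "inf_weight (h ` A)" if h: "h \<in> Aut G" and "inf_weight A" for h A
    unfolding inf_weight_def
  proof
    fix n :: nat
    define c where "c = w (h r) / w r"
    have c: "c > 0" using w_pos by (simp add: c_def)
    \<comment> \<open>The automorphism multiplies weights by \<open>c\<close>, so weight
      \<open>n / c\<close> is secured beforehand.\<close>
    obtain m :: nat where m: "real n / c < m" using reals_Archimedean2 by blast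
    obtain F where F: "finite F" "F \<subseteq> A" "real m \<le> sum w F" using \<open>inf_weight A\<close> by (auto simp: inf_weight_def)
    have "inj_on h F" using Aut_bij[OF h] by (meson bij_is_inj inj_on_subset subset_UNIV)
    then have "sum w (h ` F) = (\<Sum>y\<in>F. w (h y))" by (simp add: sum.reindex)
    also have "\<dots> = (\<Sum>y\<in>F. c * w y)" unfolding c_def by (intro sum.cong refl w_Aut[OF h])
    also have "\<dots> = c * sum w F" by (simp add: sum_distrib_left)
    finally have e: "sum w (h ` F) = c * sum w F" .
    have "real n < c * m" using m c by (simp add: field_simps)
    also have "\<dots> \<le> c * sum w F" using F(3) c by simp
    finally show "\<exists>F. finite F \<and> F \<subseteq> h ` A \<and> real n \<le> sum w F"
      using F e by (intro exI[of _ "h ` F"]) auto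
  qed
  have "inv g ` g ` A = A" using Aut_inv_left[OF g] by (auto simp: image_image)
  then show ?thesis using imp[OF g, of A] imp[OF Aut_inv[OF g], of "g ` A"] by auto
qed

lemma at_least_image: assumes g: "g \<in> Aut G" shows "at_least M (g ` A) \<longleftrightarrow> at_least M A"
proof -
  have imp: "at_least M (h ` A)" if h: "h \<in> Aut G" and "at_least M A" for h A
  proof -
    obtain F where F: "finite F" "F \<subseteq> A" "card F = M" using \<open>at_least M A\<close> by (auto simp: at_least_def)
    then show ?thesis unfolding at_least_def
      using card_Aut_image[OF h, of F] by (intro exI[of _ "h ` F"]) auto
  qed
  have "inv g ` g ` A = A" using Aut_inv_left[OF g] by (auto simp: image_image)
  then show ?thesis using imp[OF g, of A] imp[OF Aut_inv[OF g], of "g ` A"] by auto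
qed

lemma at_least_mono: "at_least M A \<Longrightarrow> A \<subseteq> B \<Longrightarrow> at_least M B"
  unfolding at_least_def by blast

lemma at_least_card: "at_least M A \<Longrightarrow> A \<subseteq> B \<Longrightarrow> finite B \<Longrightarrow> M \<le> card B"
  unfolding at_least_def by (meson card_mono order_trans)

lemma infinite_at_least: "infinite A \<Longrightarrow> at_least M A"
  unfolding at_least_def using infinite_arbitrarily_large by blast

abbreviation component :: "('v set \<Rightarrow> bool) \<Rightarrow> 'v set \<Rightarrow> 'v \<Rightarrow> 'v set" where
  "component \<omega> B z \<equiv> {y. reach (opn \<omega>) B z y}"

lemma component_act: "g \<in> Aut G \<Longrightarrow> g ` component (act g \<omega>) B z = component \<omega> (g ` B) (g z)"
  by (simp add: reach_act image_Collect_Aut)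

lemma all_Aut: "g \<in> Aut G \<Longrightarrow> (\<forall>z. Q (g z)) \<longleftrightarrow> (\<forall>z. Q z)"
  using Aut_inv_right by metis

section \<open>Heavy clusters with finite levels\<close>

definition thin :: "('v set \<Rightarrow> bool) \<Rightarrow> 'v \<Rightarrow> bool" where
  "thin \<omega> x \<longleftrightarrow> inf_weight (cluster \<omega> x) \<and> (\<forall>y. finite (cluster \<omega> x \<inter> level y))"

lemma pred_thin [measurable]: "Measurable.pred P (\<lambda>\<omega>. thin \<omega> x)"
proof -
  have "thin \<omega> x \<longleftrightarrow> inf_weight {y. reach (opn \<omega>) {} x y} \<and> (\<forall>y. finite {z. reach (opn \<omega>) {} x z \<and> z \<in> level y})" for \<omega>
    by (simp add: thin_def Int_def)
  moreover have "Measurable.pred P (\<lambda>\<omega>. inf_weight {y. reach (opn \<omega>) {} x y} \<and>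
      (\<forall>y. finite {z. reach (opn \<omega>) {} x z \<and> z \<in> level y}))"
    by (intro pred_intros_logic pred_inf_weight pred_all_v pred_finite) measurable
  ultimately show ?thesis by simp
qed

lemma thin_act: assumes g: "g \<in> Aut G" shows "thin (act g \<omega>) x \<longleftrightarrow> thin \<omega> (g x)"
proof -
  have c: "g ` cluster (act g \<omega>) x = cluster \<omega> (g x)" using component_act[OF g, of \<omega> "{}" x] by simp
  have "finite (cluster (act g \<omega>) x \<inter> level y) \<longleftrightarrow> finite (cluster \<omega> (g x) \<inter> level (g y))" for y
  proof -
    have inj: "inj g" using Aut_bij[OF g] by (rule bij_is_inj)
    have "g ` (cluster (act g \<omega>) x \<inter> level y) = cluster \<omega> (g x) \<inter> level (g y)"
      by (simp add: image_Int[OF inj] c level_image[OF g])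
    then show ?thesis using finite_image_iff[OF inj_on_subset[OF inj subset_UNIV]] by metis
  qed
  then have "(\<forall>y. finite (cluster (act g \<omega>) x \<inter> level y)) \<longleftrightarrow> (\<forall>y. finite (cluster \<omega> (g x) \<inter> level y))"
    using all_Aut[OF g, of "\<lambda>y. finite (cluster \<omega> (g x) \<inter> level y)"] by simp
  moreover have "inf_weight (cluster (act g \<omega>) x) \<longleftrightarrow> inf_weight (cluster \<omega> (g x))" using inf_weight_image[OF g] c by metis
  ultimately show ?thesis unfolding thin_def by simp
qed

lemma thin_cluster: "reach (opn \<omega>) {} x y \<Longrightarrow> thin \<omega> y \<longleftrightarrow> thin \<omega> x"
  using reach_cluster_eq unfolding thin_def by simp

text \<open>Let each vertex select the thin vertices of its own level. A finite selection would be
  shared by the whole level, which is infinite and of constant weight.\<close>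

lemma infinitely_many_thin: "AE \<omega> in P. \<forall>x. thin \<omega> x \<longrightarrow> infinite {y \<in> level x. thin \<omega> y}"
proof -
  define R where "R \<omega> x y \<longleftrightarrow> w y = w x \<and> thin \<omega> y" for \<omega> x y
  have "AE \<omega> in P. \<forall>v S. finite S \<longrightarrow> v \<in> S \<longrightarrow> \<not> inf_weight {x. {y. R \<omega> x y} = S}"
    by (rule no_finite_selection) (auto simp: R_def thin_act w_Aut_eq)
  then show ?thesis
  proof (rule AE_mp[OF _ AE_I2], intro impI allI notI)
    fix \<omega> x
    define S where "S = {y \<in> level x. thin \<omega> y}"
    assume *: "\<forall>v S. finite S \<longrightarrow> v \<in> S \<longrightarrow> \<not> inf_weight {x. {y. R \<omega> x y} = S}"
      and x: "thin \<omega> x" and "finite {y \<in> level x. thin \<omega> y}"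
    then have "finite S" "x \<in> S" by (auto simp: S_def level_def)
    moreover have "level x \<subseteq> {u. {y. R \<omega> u y} = S}" by (auto simp: R_def S_def level_def)
    then have "inf_weight {u. {y. R \<omega> u y} = S}"
      using infinite_subset_level_inf_weight[OF infinite_level order_refl, of x] inf_weight_mono by blast
    ultimately show False using * by blast
  qed
qed

lemma finite_edges_at: assumes "finite B" shows "finite {e \<in> edges G. e \<inter> B \<noteq> {}}"
proof -
  have "{e \<in> edges G. e \<inter> B \<noteq> {}} \<subseteq> (\<Union>b\<in>B. (\<lambda>y. {b, y}) ` {y. G b y})"
    using sym by (fastforce simp: edges_def)
  moreover have "finite (\<Union>b\<in>B. (\<lambda>y. {b, y}) ` {y. G b y})" using assms fin_nbrs by blast
  ultimately show ?thesis by (rule finite_subset)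
qed

text \<open>Components off \<open>B\<close> do not see the edges at \<open>B\<close> and survive
  every modification there.\<close>

lemma avoid_upd:
  assumes "D = {e \<in> edges G. e \<inter> B \<noteq> {}}"
  shows "avoid (opn (upd D O' \<omega>)) B = avoid (opn \<omega>) B"
  using assms by (auto simp: avoid_def open_subgraph_def upd_def fun_eq_iff)

lemma opn_upd_closed:
  assumes "D = {e \<in> edges G. e \<inter> B \<noteq> {}}"
  shows "opn (upd D {} \<omega>) = avoid (opn \<omega>) B"
  using assms edge_mem by (auto simp: avoid_def open_subgraph_def upd_def fun_eq_iff)

text \<open>Closing all edges at \<open>B\<close> turns the components of the complement of \<open>B\<close> into clusters.\<close>

lemma heavy_branch_unbounded:
  assumes p: "0 < p" "p < 1" and B: "finite B"
  shows "AE \<omega> in P. \<forall>z. z \<notin> B \<longrightarrow> inf_weight (component \<omega> B z) \<longrightarrow> infinite (component \<omega> B z \<inter> above s)"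
proof -
  define D where "D = {e \<in> edges G. e \<inter> B \<noteq> {}}"
  define Q where "Q \<omega> \<longleftrightarrow> (\<forall>x. inf_weight (cluster \<omega> x) \<longrightarrow> \<not> finite {y. reach (opn \<omega>) {} x y \<and> y \<in> above s})" for \<omega>
  have "Measurable.pred P Q"
    unfolding Q_def by (intro pred_all_v pred_intros_logic pred_inf_weight pred_finite) measurable
  moreover have "AE \<omega> in P. Q \<omega>"
    using heavy_unbounded[OF p(1)] by eventually_elim (simp add: Q_def Int_def)
  ultimately have "AE \<omega> in P. Q (upd D {} \<omega>)"
    using finite_edges_at[OF B] p by (intro finite_energy) (auto simp: D_def)
  then show ?thesis
  proof eventually_elim
    case (elim \<omega>)
    \<comment> \<open>For \<open>z \<in> B\<close> the two differ: the cluster is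
      \<open>{z}\<close>, the component is empty.\<close>
    have eq: "cluster (upd D {} \<omega>) z = component \<omega> B z" if "z \<notin> B" for z
      using that opn_upd_closed[OF D_def, of \<omega>] by (simp add: reach_empty) (simp add: reach_def)
    show ?case
    proof (intro allI impI)
      fix z assume z: "z \<notin> B" "inf_weight (component \<omega> B z)"
      then have "infinite (cluster (upd D {} \<omega>) z \<inter> above s)"
      proof -
        have "inf_weight (cluster (upd D {} \<omega>) z)" using z(2) eq[OF z(1)] by simp
        then show ?thesis using elim unfolding Q_def Int_def mem_Collect_eq by blast
      qed
      then show "infinite (component \<omega> B z \<inter> above s)" using eq[OF z(1)] by simp
    qed
  qed
qed

section \<open>Trifurcations\<close>

definition ball_open :: "nat \<Rightarrow> ('v set \<Rightarrow> bool) \<Rightarrow> 'v \<Rightarrow> bool" where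
  "ball_open R \<omega> x \<longleftrightarrow> (\<forall>u v. G u v \<and> u \<in> gball G R x \<and> v \<in> gball G R x \<longrightarrow> opn \<omega> u v)"

text \<open>The predicate \<open>Q\<close> leaves the size of a branch open: infinite weight for
  \<open>trif\<close>, a number of points for \<open>good\<close>. A vertex inside the ball reaches
  nothing and would be separated vacuously, so the three are required to lie outside.\<close>

definition branches :: "nat \<Rightarrow> ('v \<Rightarrow> bool) \<Rightarrow> ('v set \<Rightarrow> bool) \<Rightarrow> 'v \<Rightarrow> bool" where
  "branches R Q \<omega> x \<longleftrightarrow> (\<exists>z1 z2 z3.
     \<not> reach (opn \<omega>) (gball G R x) z1 z2 \<and> \<not> reach (opn \<omega>) (gball G R x) z1 z3 \<and>
     \<not> reach (opn \<omega>) (gball G R x) z2 z3 \<and>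
     (z1 \<notin> gball G R x \<and> reach (opn \<omega>) {} x z1 \<and> Q z1) \<and>
     (z2 \<notin> gball G R x \<and> reach (opn \<omega>) {} x z2 \<and> Q z2) \<and>
     (z3 \<notin> gball G R x \<and> reach (opn \<omega>) {} x z3 \<and> Q z3))"

definition trif :: "nat \<Rightarrow> ('v set \<Rightarrow> bool) \<Rightarrow> 'v \<Rightarrow> bool" where
  "trif R \<omega> x \<longleftrightarrow> thin \<omega> x \<and> ball_open R \<omega> x \<and>
     branches R (\<lambda>z. inf_weight (component \<omega> (gball G R x) z)) \<omega> x"

text \<open>The finite counterpart of \<open>trif\<close>, seen through a window \<open>A\<close> of
  weights. By \<open>w x \<le> w y\<close> the \<open>M\<close> points stay in every truncation at a
  level \<open>s\<close> that keeps \<open>x\<close>.\<close>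

definition good :: "nat \<Rightarrow> nat \<Rightarrow> real set \<Rightarrow> ('v set \<Rightarrow> bool) \<Rightarrow> 'v \<Rightarrow> bool" where
  "good R M A \<omega> x \<longleftrightarrow> thin \<omega> x \<and> ball_open R \<omega> x \<and>
     branches R (\<lambda>z. at_least M {y. reach (opn \<omega>) (gball G R x) z y \<and> w x \<le> w y \<and> w y \<in> A}) \<omega> x"

lemma branches_mono:
  "branches R Q \<omega> x \<Longrightarrow> (\<And>z. z \<notin> gball G R x \<Longrightarrow> Q z \<Longrightarrow> Q' z) \<Longrightarrow> branches R Q' \<omega> x"
  unfolding branches_def by blast

lemma good_mono: "good R M A \<omega> x \<Longrightarrow> A \<subseteq> A' \<Longrightarrow> good R M A' \<omega> x"
  unfolding good_def by (auto elim!: branches_mono at_least_mono)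

lemma pred_ball_open [measurable]: "Measurable.pred P (\<lambda>\<omega>. ball_open R \<omega> x)"
  unfolding ball_open_def by measurable

lemma pred_branches:
  assumes [measurable]: "\<And>z. Measurable.pred P (\<lambda>\<omega>. Q \<omega> z)"
  shows "Measurable.pred P (\<lambda>\<omega>. branches R (Q \<omega>) \<omega> x)"
  unfolding branches_def by measurable

lemma pred_trif [measurable]: "Measurable.pred P (\<lambda>\<omega>. trif R \<omega> x)"
  unfolding trif_def by (intro pred_intros_logic pred_branches pred_inf_weight) measurable

lemma pred_good [measurable]: "Measurable.pred P (\<lambda>\<omega>. good R M A \<omega> x)"
  unfolding good_def by (intro pred_intros_logic pred_branches pred_at_least) measurable

lemma ball_open_act: assumes g: "g \<in> Aut G" shows "ball_open R (act g \<omega>) x \<longleftrightarrow> ball_open R \<omega> (g x)"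
proof -
  have "ball_open R (act g \<omega>) x \<longleftrightarrow> (\<forall>u v. G (g u) (g v) \<and> g u \<in> gball G R (g x) \<and>
      g v \<in> gball G R (g x) \<longrightarrow> opn \<omega> (g u) (g v))"
    by (simp add: ball_open_def opn_act[OF g] Aut_edge[OF g] gball_Aut[OF g])
  also have "\<dots> \<longleftrightarrow> ball_open R \<omega> (g x)"
    unfolding ball_open_def
    using all_Aut[OF g, of "\<lambda>u. \<forall>v. G u (g v) \<and> u \<in> gball G R (g x) \<and>
      g v \<in> gball G R (g x) \<longrightarrow> opn \<omega> u (g v)"]
      all_Aut[OF g, of "\<lambda>v. G u v \<and> u \<in> gball G R (g x) \<and> v \<in> gball G R (g x) \<longrightarrow> opn \<omega> u v" for u]
    by simp
  finally show ?thesis .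
qed

lemma branches_act:
  assumes g: "g \<in> Aut G" and Q: "\<And>z. Q z \<longleftrightarrow> Q' (g z)"
  shows "branches R Q (act g \<omega>) x \<longleftrightarrow> branches R Q' \<omega> (g x)"
proof -
  define body where "body z1 z2 z3 \<longleftrightarrow>
     \<not> reach (opn \<omega>) (gball G R (g x)) z1 z2 \<and> \<not> reach (opn \<omega>) (gball G R (g x)) z1 z3 \<and>
     \<not> reach (opn \<omega>) (gball G R (g x)) z2 z3 \<and>
     (z1 \<notin> gball G R (g x) \<and> reach (opn \<omega>) {} (g x) z1 \<and> Q' z1) \<and>
     (z2 \<notin> gball G R (g x) \<and> reach (opn \<omega>) {} (g x) z2 \<and> Q' z2) \<and>
     (z3 \<notin> gball G R (g x) \<and> reach (opn \<omega>) {} (g x) z3 \<and> Q' z3)" for z1 z2 z3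
  have "branches R Q (act g \<omega>) x \<longleftrightarrow> (\<exists>z1 z2 z3. body (g z1) (g z2) (g z3))"
    by (simp add: branches_def body_def reach_act[OF g] gball_image[OF g] gball_Aut[OF g] Q)
  also have "\<dots> \<longleftrightarrow> (\<exists>z1 z2 z3. body z1 z2 z3)"
    by (metis Aut_inv_right[OF g])
  finally show ?thesis by (simp add: branches_def body_def)
qed

text \<open>An automorphism rescales weights, so the window has to move along.\<close>

lemma good_act:
  assumes g: "g \<in> Aut G"
  shows "good R M A (act g \<omega>) x \<longleftrightarrow> good R M ((*) (w (g r) / w r) ` A) \<omega> (g x)"
proof -
  define c where "c = w (g r) / w r"
  have c: "c > 0" using w_pos by (simp add: c_def)
  have wg: "w (g y) = c * w y" for y unfolding c_def by (rule w_Aut[OF g])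
  have mem: "w (g y) \<in> (*) c ` A \<longleftrightarrow> w y \<in> A" for y
    using c by (auto simp: wg)
  have "at_least M {y. reach (opn (act g \<omega>)) (gball G R x) z y \<and> w x \<le> w y \<and> w y \<in> A} \<longleftrightarrow>
      at_least M {y. reach (opn \<omega>) (gball G R (g x)) (g z) y \<and> w (g x) \<le> w y \<and> w y \<in> (*) c ` A}" for z
  proof -
    have "{y. reach (opn (act g \<omega>)) (gball G R x) z y \<and> w x \<le> w y \<and> w y \<in> A} =
        {y. reach (opn \<omega>) (gball G R (g x)) (g z) (g y) \<and> w (g x) \<le> w (g y) \<and> w (g y) \<in> (*) c ` A}"
      by (simp add: reach_act[OF g] gball_image[OF g] w_Aut_le[OF g] mem)
    then show ?thesis
      using at_least_image[OF g, of M "{y. reach (opn (act g \<omega>)) (gball G R x) z y \<and> w x \<le> w y \<and> w y \<in> A}"]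
        image_Collect_Aut[OF g, of "\<lambda>y. reach (opn \<omega>) (gball G R (g x)) (g z) y \<and> w (g x) \<le> w y \<and> w y \<in> (*) c ` A"]
      by simp
  qed
  then show ?thesis
    unfolding good_def c_def[symmetric] thin_act[OF g] ball_open_act[OF g]
    by (subst branches_act[OF g]) auto
qed

text \<open>A walk of at most \<open>R\<close> steps from the center never leaves the ball, so in an
  open ball it is open.\<close>

lemma hub_ball:
  assumes "ball_open R \<omega> x" "u \<in> gball G R x"
  shows "(induced (opn \<omega>) (gball G R x))\<^sup>*\<^sup>* u x"
proof -
  have sub: "(induced (opn \<omega>) (gball G R x))\<^sup>*\<^sup>* x u" if "(G ^^ k) x u" "k \<le> R" for k u
    using that
  proof (induction k arbitrary: u)
    case (Suc k)
    then obtain v where v: "(G ^^ k) x v" "G v u" by auto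
    moreover have "v \<in> gball G R x" "u \<in> gball G R x"
    proof -
      show "v \<in> gball G R x" using v(1) Suc.prems(2) unfolding gball_def by (intro CollectI exI[of _ k]) simp
      show "u \<in> gball G R x" using Suc.prems unfolding gball_def by blast
    qed
    ultimately have "induced (opn \<omega>) (gball G R x) v u" using assms(1) by (auto simp: ball_open_def)
    then show ?case using Suc.IH[OF v(1)] Suc.prems by (auto intro: rtranclp.rtrancl_into_rtrancl)
  qed simp
  obtain k where "k \<le> R" "(G ^^ k) x u" using assms(2) by (auto simp: gball_def)
  then have "(induced (opn \<omega>) (gball G R x))\<^sup>*\<^sup>* x u" using sub by blast
  moreover have "symp (induced (opn \<omega>) (gball G R x))"
    using opn_sym[of \<omega>] by (auto simp: symp_def)
  ultimately show ?thesis by (meson symp_rtranclp sympD)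
qed

section \<open>The weighted Burton-Keane bound\<close>

text \<open>Burton-Keane in the cluster rooted at \<open>v\<close>, with the window part of weight
  at least \<open>s\<close> as the set in which branches are measured. The first factor on the right
  pays for passing to trifurcations with disjoint balls.\<close>

lemma card_good_le:
  assumes F: "finite F" "F = {y \<in> cluster \<omega> v. w y \<in> A}"
  shows "M * card {x \<in> {x\<in>F. good R M A \<omega> x}. s \<le> w x} \<le> card (gball G (R + R) v) * card {x\<in>F. s \<le> w x}"
proof -
  define X where "X = {x \<in> {x\<in>F. good R M A \<omega> x}. s \<le> w x}"
  define Fs where "Fs = {x\<in>F. s \<le> w x}"
  interpret hubs "opn \<omega>" "gball G R"
    by unfold_locales (rule opn_sym, rule gball_self)
  have finX: "finite X" "finite Fs" using F(1) unfolding X_def Fs_def by simp_all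
  \<comment> \<open>Maximality of the separated set puts every point of \<open>X\<close> within
    distance \<open>R + R\<close> of it.\<close>
  obtain S where S: "S \<subseteq> X"
    "\<And>x y. x \<in> S \<Longrightarrow> y \<in> S \<Longrightarrow> x \<noteq> y \<Longrightarrow> gball G R x \<inter> gball G R y = {}"
    "\<And>x. x \<in> X \<Longrightarrow> \<exists>y\<in>S. gball G R x \<inter> gball G R y \<noteq> {}"
    using separated_subset[OF finX(1), of "\<lambda>x y. gball G R x \<inter> gball G R y \<noteq> {}"] gball_self
    by (metis Int_commute Int_absorb empty_iff)
  have finS: "finite S" using S(1) finX finite_subset by blast
  have "M * card S \<le> card Fs"
  proof (rule burton_keane[where \<rho> = v])
    show "finite S" by fact
    show "finite Fs" by (rule finX)
    fix x assume "x \<in> S"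
    then have x: "x \<in> cluster \<omega> v" "good R M A \<omega> x" "s \<le> w x" using S(1) F(2) by (auto simp: X_def)
    show "hub x \<and> (opn \<omega>)\<^sup>*\<^sup>* v x"
      using x hub_ball by (auto simp: hub_def good_def reach_empty)
    let ?B = "gball G R x"
    obtain z1 z2 z3 where z: "\<not> reach (opn \<omega>) ?B z1 z2" "\<not> reach (opn \<omega>) ?B z1 z3" "\<not> reach (opn \<omega>) ?B z2 z3"
      and zz: "\<And>z. z \<in> {z1, z2, z3} \<Longrightarrow> z \<notin> ?B \<and> reach (opn \<omega>) {} x z \<and>
        at_least M {y. reach (opn \<omega>) ?B z y \<and> w x \<le> w y \<and> w y \<in> A}"
      using x(2) unfolding good_def branches_def by blast
    have br: "(opn \<omega>)\<^sup>*\<^sup>* v z \<and> M \<le> card {y\<in>Fs. reach (opn \<omega>) ?B z y}" if "z \<in> {z1, z2, z3}" for z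
    proof
      have vz: "reach (opn \<omega>) {} v z" using x(1) zz[OF that] reach_trans by (metis mem_Collect_eq)
      then show "(opn \<omega>)\<^sup>*\<^sup>* v z" by (simp add: reach_empty)
      have "reach (opn \<omega>) {} v y" if "reach (opn \<omega>) ?B z y" for y
        using vz reach_rtranclp[OF that] by (auto simp: reach_empty)
      then have "{y. reach (opn \<omega>) ?B z y \<and> w x \<le> w y \<and> w y \<in> A} \<subseteq> {y\<in>Fs. reach (opn \<omega>) ?B z y}"
        using x(3) F(2) by (auto simp: Fs_def)
      then show "M \<le> card {y\<in>Fs. reach (opn \<omega>) ?B z y}"
        using zz[OF that] finX(2) by (intro at_least_card) auto
    qed
    have one: "\<not> (reach (opn \<omega>) ?B a v \<and> reach (opn \<omega>) ?B b v)" if "\<not> reach (opn \<omega>) ?B a b" for a b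
      using that rsym reach_trans by metis
    \<comment> \<open>The root lies in at most one of three separated branches, so two of them lead
      away from it.\<close>
    consider "\<not> reach (opn \<omega>) ?B z1 v" "\<not> reach (opn \<omega>) ?B z2 v"
      | "\<not> reach (opn \<omega>) ?B z1 v" "\<not> reach (opn \<omega>) ?B z3 v"
      | "\<not> reach (opn \<omega>) ?B z2 v" "\<not> reach (opn \<omega>) ?B z3 v"
      using one[OF z(1)] one[OF z(2)] one[OF z(3)] by blast
    then show "\<exists>z1 z2. \<not> reach (opn \<omega>) ?B z1 z2 \<and> (\<forall>z\<in>{z1, z2}. \<not> reach (opn \<omega>) ?B z v \<and>
        (opn \<omega>)\<^sup>*\<^sup>* v z \<and> M \<le> card {y\<in>Fs. reach (opn \<omega>) ?B z y})"
      using z br by cases (blast intro: exI)+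
  qed (rule S(2))
  moreover have "card X \<le> card (gball G (R + R) v) * card S"
  proof -
    have "X \<subseteq> (\<Union>y\<in>S. gball G (R + R) y)"
    proof
      fix x assume "x \<in> X"
      then obtain y u where y: "y \<in> S" "u \<in> gball G R x" "u \<in> gball G R y" using S(3) by blast
      then have "x \<in> gball G (R + R) y" using gball_trans gball_commute by blast
      then show "x \<in> (\<Union>y\<in>S. gball G (R + R) y)" using y by blast
    qed
    then have "card X \<le> card (\<Union>y\<in>S. gball G (R + R) y)"
      using finS finite_gball by (intro card_mono) auto
    also have "\<dots> \<le> (\<Sum>y\<in>S. card (gball G (R + R) y))" using finS by (rule card_UN_le)
    also have "\<dots> = (\<Sum>y\<in>S. card (gball G (R + R) v))" by (intro sum.cong refl card_gball)
    finally show ?thesis by (simp add: mult.commute)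
  qed
  ultimately have "M * card X \<le> card (gball G (R + R) v) * card Fs"
    by (metis mult.left_commute mult_le_mono2 order_trans)
  then show ?thesis by (simp add: X_def Fs_def)
qed

lemma weight_good_le:
  assumes "finite F" "F = {y \<in> cluster \<omega> v. w y \<in> A}"
  shows "real M * sum w {x\<in>F. good R M A \<omega> x} \<le> real (card (gball G (R + R) v)) * sum w F"
proof (rule layer_cake_le)
  show "finite {x\<in>F. good R M A \<omega> x}" using assms(1) by simp
qed (use assms(1) w_pos card_good_le[OF assms] in blast)+

lemma thin_finite: assumes "thin \<omega> v" "finite A" shows "finite {y \<in> cluster \<omega> v. w y \<in> A}"
proof -
  have "finite {y \<in> cluster \<omega> v. w y = b}" for b
  proof (cases "{y \<in> cluster \<omega> v. w y = b} = {}")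
    case False
    then obtain y where "w y = b" by blast
    then have "{y \<in> cluster \<omega> v. w y = b} = cluster \<omega> v \<inter> level y" by (auto simp: level_def)
    then show ?thesis using assms(1) by (simp add: thin_def)
  qed (metis finite.emptyI)
  moreover have "{y \<in> cluster \<omega> v. w y \<in> A} = (\<Union>b\<in>A. {y \<in> cluster \<omega> v. w y = b})" by auto
  ultimately show ?thesis using assms(2) by simp
qed

text \<open>For every window \<open>a * K\<close> of weights containing its own weight and in which it is good, a vertex
  distributes mass one over the part of its cluster with weights in the window, proportionally to the weight. After
  the change of measure the mass received in one window is the proportion of good weight there.\<close>

lemma emeasure_good_le:
  assumes Q: "finite Q" "\<And>q. q \<in> Q \<Longrightarrow> q > 0" and M: "M > 0"
  shows "emeasure P {\<omega>\<in>space P. good R M ((*) (w v) ` Q) \<omega> v}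
    \<le> ennreal (2 * real (card (gball G (R + R) v)) / real M)"
proof -
  define N where "N = card (gball G (R + R) v)"
  obtain K where K: "finite K" "K \<noteq> {}" "\<And>k. k \<in> K \<Longrightarrow> k > 0"
    "card K \<le> 2 * card {k\<in>K. \<forall>q\<in>Q. k * q \<in> K}"
    using folner_mult[OF Q] by blast
  \<comment> \<open>The window \<open>a * K\<close>. Conversely \<open>A x\<close> lists the
    \<open>a\<close> whose window contains the weight of \<open>x\<close>, one for each
    \<open>k\<close> in \<open>K\<close>.\<close>
  define sc where "sc a = (*) a ` K" for a :: real
  define A where "A x = (\<lambda>k. w x / k) ` K" for x
  have finA: "finite (A x)" for x using K(1) by (simp add: A_def)
  have fin_sc: "finite (sc a)" for a using K(1) by (simp add: sc_def)
  have memA: "a \<in> A x \<longleftrightarrow> w x \<in> sc a" for a x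
  proof
    show "w x \<in> sc a" if "a \<in> A x" using that K(3) by (force simp: A_def sc_def)
    assume "w x \<in> sc a"
    then obtain k where k: "k \<in> K" "w x = a * k" by (auto simp: sc_def)
    then show "a \<in> A x" using K(3)[OF k(1)] unfolding A_def by (intro image_eqI[of _ _ k]) auto
  qed
  \<comment> \<open>Measured in units of \<open>w x\<close>, the weight of the cluster in a window
    is invariant under automorphisms that move the window along.\<close>
  define W where "W \<omega> x a = csum (\<lambda>y. if reach (opn \<omega>) {} x y \<and> w y \<in> sc a then ennreal (w y / w x) else 0)"
    for \<omega> x a
  define f where "f \<omega> x y = (\<Sum>a\<in>A x. if good R M (sc a) \<omega> x \<and> reach (opn \<omega>) {} x y \<and> w y \<in> sc a
    then ennreal (w y / w x) / W \<omega> x a else 0)" for \<omega> x y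
  have [measurable]: "(\<lambda>\<omega>. W \<omega> x a) \<in> borel_measurable P" for x a
    unfolding W_def by (rule csum_measurable) measurable
  have fm: "(\<lambda>\<omega>. f \<omega> x y) \<in> borel_measurable P" for x y
    unfolding f_def by measurable
  have finv: "f (act g \<omega>) x y = f \<omega> (g x) (g y)" if g: "g \<in> Aut G" for g \<omega> x y
  proof -
    define c where "c = w (g r) / w r"
    have c: "c > 0" using w_pos by (simp add: c_def)
    have wg: "w (g u) = c * w u" for u unfolding c_def by (rule w_Aut[OF g])
    have sc: "sc (c * a) = (*) c ` sc a" for a by (simp add: sc_def image_image mult.assoc)
    have mem: "w (g u) \<in> sc (c * a) \<longleftrightarrow> w u \<in> sc a" for u a
      using c by (auto simp: sc wg)
    have rat: "w (g u) / w (g x) = w u / w x" for u by (rule w_Aut_ratio[OF g])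
    have gd: "good R M (sc (c * a)) \<omega> (g x) \<longleftrightarrow> good R M (sc a) (act g \<omega>) x" for a
      unfolding sc unfolding c_def by (rule good_act[OF g, symmetric])
    have rc: "reach (opn (act g \<omega>)) {} x u \<longleftrightarrow> reach (opn \<omega>) {} (g x) (g u)" for u
      using reach_act[OF g, of \<omega> "{}"] by simp
    have Weq: "W \<omega> (g x) (c * a) = W (act g \<omega>) x a" for a
    proof -
      have "W \<omega> (g x) (c * a) = csum (\<lambda>y. if reach (opn \<omega>) {} (g x) (g y) \<and> w (g y) \<in> sc (c * a)
          then ennreal (w (g y) / w (g x)) else 0)"
        unfolding W_def by (rule nn_integral_bij_count_space[symmetric]) (use Aut_bij[OF g] in simp)
      then show ?thesis by (simp only: mem rat W_def rc)
    qed
    have "A (g x) = (*) c ` A x" by (simp add: A_def image_image wg)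
    moreover have "inj_on ((*) c) (A x)" using c by (auto intro: inj_onI)
    ultimately have "f \<omega> (g x) (g y) = (\<Sum>a\<in>A x. if good R M (sc (c * a)) \<omega> (g x) \<and>
        reach (opn \<omega>) {} (g x) (g y) \<and> w (g y) \<in> sc (c * a)
        then ennreal (w (g y) / w (g x)) / W \<omega> (g x) (c * a) else 0)"
      unfolding f_def by (simp add: sum.reindex)
    then show ?thesis by (simp only: gd rc[symmetric] mem rat Weq f_def)
  qed
  have W_eq: "W \<omega> x a = ennreal (sum w {y \<in> cluster \<omega> x. w y \<in> sc a} / w x)"
    "sum w {y \<in> cluster \<omega> x. w y \<in> sc a} > 0"
    if thin: "thin \<omega> x" and a: "w u \<in> sc a" "u \<in> cluster \<omega> x" for \<omega> x a u
  proof -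
    let ?F = "{y \<in> cluster \<omega> x. w y \<in> sc a}"
    have fin: "finite ?F" using thin_finite[OF thin fin_sc] .
    have "W \<omega> x a = (\<Sum>y\<in>?F. if reach (opn \<omega>) {} x y \<and> w y \<in> sc a then ennreal (w y / w x) else 0)"
      unfolding W_def by (rule nn_integral_count_space'[OF fin]) auto
    also have "\<dots> = (\<Sum>y\<in>?F. ennreal (w y / w x))" by (intro sum.cong) auto
    also have "\<dots> = ennreal (\<Sum>y\<in>?F. w y / w x)"
      by (rule sum_ennreal) (use w_pos less_imp_le in \<open>auto intro!: divide_nonneg_nonneg\<close>)
    finally show "W \<omega> x a = ennreal (sum w ?F / w x)" by (simp add: sum_divide_distrib)
    show "sum w ?F > 0"
      using a w_pos by (intro sum_pos fin) auto
  qed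
  \<comment> \<open>One unit leaves for each window in which the vertex is good. The denominator is
    positive, as the window contains the weight of \<open>v\<close>, and finite because the cluster
    is thin.\<close>
  have out: "csum (\<lambda>y. f \<omega> v y) = (\<Sum>a\<in>A v. indicator {\<omega>\<in>space P. good R M (sc a) \<omega> v} \<omega>)"
    if \<omega>: "\<omega> \<in> space P" for \<omega>
  proof -
    have "csum (\<lambda>y. f \<omega> v y) = (\<Sum>a\<in>A v. csum (\<lambda>y. if good R M (sc a) \<omega> v \<and> reach (opn \<omega>) {} v y \<and>
        w y \<in> sc a then ennreal (w y / w v) / W \<omega> v a else 0))"
      unfolding f_def by (rule nn_integral_sum) simp
    also have "\<dots> = (\<Sum>a\<in>A v. indicator {\<omega>\<in>space P. good R M (sc a) \<omega> v} \<omega>)"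
    proof (intro sum.cong refl)
      fix a assume a: "a \<in> A v"
      show "csum (\<lambda>y. if good R M (sc a) \<omega> v \<and> reach (opn \<omega>) {} v y \<and> w y \<in> sc a
          then ennreal (w y / w v) / W \<omega> v a else 0) = indicator {\<omega>\<in>space P. good R M (sc a) \<omega> v} \<omega>"
      proof (cases "good R M (sc a) \<omega> v")
        case True
        have "csum (\<lambda>y. if good R M (sc a) \<omega> v \<and> reach (opn \<omega>) {} v y \<and> w y \<in> sc a
          then ennreal (w y / w v) / W \<omega> v a else 0) = W \<omega> v a / W \<omega> v a"
          unfolding W_def[of \<omega> v a] nn_integral_divide[OF borel_measurable_count_space, symmetric]
          by (intro nn_integral_cong) (simp add: True)
        also have "\<dots> = 1"
        proof -
          have "thin \<omega> v" using True by (simp add: good_def)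
          moreover have "w v \<in> sc a" using a memA by simp
          ultimately show ?thesis
            using W_eq[of \<omega> v v a] reach_empty_refl[of "opn \<omega>" v] w_pos[of v]
            by (intro ennreal_divide_self) auto
        qed
        finally show ?thesis using True \<omega> by simp
      qed simp
    qed
    finally show ?thesis .
  qed
  \<comment> \<open>In each of the at most \<open>card K\<close> windows containing
    \<open>w v\<close>, the received mass is the share of good weight, at most \<open>N / M\<close>
    by \<open>weight_good_le\<close>.\<close>
  have inn: "csum (\<lambda>x. f \<omega> x v * ennreal (w x / w v)) \<le> of_nat (card K) * ennreal (real N / real M)" for \<omega>
  proof -
    define Tot where "Tot a = sum w {y \<in> cluster \<omega> v. w y \<in> sc a}" for a
    have received: "f \<omega> x v * ennreal (w x / w v) = (\<Sum>a\<in>A v. if good R M (sc a) \<omega> x \<and>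
        reach (opn \<omega>) {} v x \<and> w x \<in> sc a then ennreal (w x / Tot a) else 0)" for x
    proof -
      have "f \<omega> x v * ennreal (w x / w v) = (\<Sum>a\<in>A x. if w v \<in> sc a then
          (if good R M (sc a) \<omega> x \<and> reach (opn \<omega>) {} v x then ennreal (w x / Tot a) else 0) else 0)"
        unfolding f_def sum_distrib_right
      proof (intro sum.cong refl)
        fix a assume "a \<in> A x"
        show "(if good R M (sc a) \<omega> x \<and> reach (opn \<omega>) {} x v \<and> w v \<in> sc a
            then ennreal (w v / w x) / W \<omega> x a else 0) * ennreal (w x / w v) =
          (if w v \<in> sc a then
          (if good R M (sc a) \<omega> x \<and> reach (opn \<omega>) {} v x then ennreal (w x / Tot a) else 0) else 0)"
        proof (cases "good R M (sc a) \<omega> x \<and> reach (opn \<omega>) {} v x \<and> w v \<in> sc a")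
          case True
          then have xv: "reach (opn \<omega>) {} x v" using reach_sym[OF opn_sym] by blast
          have thin: "thin \<omega> x" using True by (simp add: good_def)
          have "cluster \<omega> x = cluster \<omega> v" using True reach_cluster_eq by blast
          then have W: "W \<omega> x a = ennreal (Tot a / w x)" "Tot a > 0"
            using W_eq[OF thin, of v a] True xv by (auto simp: Tot_def)
          have "ennreal (w v / w x) / W \<omega> x a * ennreal (w x / w v)
              = ennreal (w v / w x / (Tot a / w x) * (w x / w v))"
            unfolding W(1) using w_pos[of v] w_pos[of x] W(2)
            by (simp add: divide_ennreal ennreal_mult'[symmetric])
          also have "w v / w x / (Tot a / w x) * (w x / w v) = w x / Tot a"
            using w_pos[of v] w_pos[of x] W(2) by (simp add: field_simps)
          finally show ?thesis using True xv by simp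
        next
          case False
          then show ?thesis using reach_sym[OF opn_sym, of \<omega> "{}" x v] by auto
        qed
      qed
      also have "\<dots> = (\<Sum>a\<in>{a\<in>A x. w v \<in> sc a}.
          (if good R M (sc a) \<omega> x \<and> reach (opn \<omega>) {} v x then ennreal (w x / Tot a) else 0))"
        by (rule sum.inter_filter[OF finA, symmetric])
      \<comment> \<open>Either side says that the window contains the weights of both
        \<open>x\<close> and \<open>v\<close>; this exchanges the windows of the sender for those of
        the receiver.\<close>
      also have "{a\<in>A x. w v \<in> sc a} = {a\<in>A v. w x \<in> sc a}" by (auto simp: memA)
      also have "(\<Sum>a\<in>\<dots>. (if good R M (sc a) \<omega> x \<and> reach (opn \<omega>) {} v x then ennreal (w x / Tot a) else 0))
        = (\<Sum>a\<in>A v. if w x \<in> sc a then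
          (if good R M (sc a) \<omega> x \<and> reach (opn \<omega>) {} v x then ennreal (w x / Tot a) else 0) else 0)"
        by (rule sum.inter_filter[OF finA])
      also have "\<dots> = (\<Sum>a\<in>A v. if good R M (sc a) \<omega> x \<and>
        reach (opn \<omega>) {} v x \<and> w x \<in> sc a then ennreal (w x / Tot a) else 0)"
        by (intro sum.cong) auto
      finally show ?thesis .
    qed
    have each: "csum (\<lambda>x. if good R M (sc a) \<omega> x \<and> reach (opn \<omega>) {} v x \<and> w x \<in> sc a
        then ennreal (w x / Tot a) else 0) \<le> ennreal (real N / real M)" if a: "a \<in> A v" for a
    proof (cases "thin \<omega> v")
      case True
      let ?F = "{y \<in> cluster \<omega> v. w y \<in> sc a}"
      let ?X = "{x \<in> ?F. good R M (sc a) \<omega> x}"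
      have fin: "finite ?F" using thin_finite[OF True fin_sc] .
      have Tot: "Tot a > 0"
        using W_eq(2)[OF True, of v a] a memA reach_empty_refl[of "opn \<omega>" v] by (simp add: Tot_def)
      have "csum (\<lambda>x. if good R M (sc a) \<omega> x \<and> reach (opn \<omega>) {} v x \<and> w x \<in> sc a
        then ennreal (w x / Tot a) else 0) = (\<Sum>x\<in>?X. if good R M (sc a) \<omega> x \<and> reach (opn \<omega>) {} v x \<and>
          w x \<in> sc a then ennreal (w x / Tot a) else 0)"
      proof (rule nn_integral_count_space')
        show "finite ?X" using fin by (rule finite_subset[rotated]) blast
      qed auto
      also have "\<dots> = (\<Sum>x\<in>?X. ennreal (w x / Tot a))" by (intro sum.cong) auto
      also have "\<dots> = ennreal (\<Sum>x\<in>?X. w x / Tot a)"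
        by (rule sum_ennreal) (use w_pos Tot less_imp_le in \<open>auto intro!: divide_nonneg_nonneg\<close>)
      also have "(\<Sum>x\<in>?X. w x / Tot a) = sum w ?X / Tot a" by (simp add: sum_divide_distrib)
      also have "\<dots> \<le> real N / real M"
      proof -
        have "real M * sum w ?X \<le> real N * Tot a"
          unfolding N_def Tot_def using weight_good_le[OF fin refl] .
        then show ?thesis using M Tot by (simp add: field_simps)
      qed
      finally show ?thesis by (simp add: ennreal_leI)
    next
      case False
      then have "\<not> (good R M (sc a) \<omega> x \<and> reach (opn \<omega>) {} v x \<and> w x \<in> sc a)" for x
        using thin_cluster unfolding good_def by blast
      then show ?thesis by (simp only: if_False) simp
    qed
    have "csum (\<lambda>x. f \<omega> x v * ennreal (w x / w v)) = (\<Sum>a\<in>A v. csum (\<lambda>x. if good R M (sc a) \<omega> x \<and>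
        reach (opn \<omega>) {} v x \<and> w x \<in> sc a then ennreal (w x / Tot a) else 0))"
      unfolding received by (rule nn_integral_sum) simp
    also have "\<dots> \<le> of_nat (card (A v)) * ennreal (real N / real M)"
      by (rule sum_bounded_above) (rule each)
    also have "\<dots> \<le> of_nat (card K) * ennreal (real N / real M)"
      unfolding A_def using card_image_le[OF K(1)] by (intro mult_right_mono) auto
    finally show ?thesis .
  qed
  define e where "e = emeasure P {\<omega>\<in>space P. good R M ((*) (w v) ` Q) \<omega> v}"
  \<comment> \<open>For \<open>k\<close> in \<open>K0\<close> the window with
    \<open>a = w v / k\<close> contains every weight \<open>w v * q\<close>, \<open>q\<close> in
    \<open>Q\<close>, so goodness for these weights implies goodness in the window.\<close>
  define K0 where "K0 = {k\<in>K. \<forall>q\<in>Q. k * q \<in> K}"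
  have mg: "{\<omega>\<in>space P. good R M B \<omega> v} \<in> sets P" for B
    using pred_good[of R M B v] by (simp add: pred_def)
  have "of_nat (card K0) * e \<le> (\<Sum>k\<in>K0. emeasure P {\<omega>\<in>space P. good R M (sc (w v / k)) \<omega> v})"
  proof (rule sum_bounded_below)
    fix k assume k: "k \<in> K0"
    then have "(*) (w v) ` Q \<subseteq> sc (w v / k)"
    proof (intro image_subsetI)
      fix q assume "q \<in> Q"
      then have "k * q \<in> K" "k > 0" using k K(3) by (auto simp: K0_def)
      then show "w v * q \<in> sc (w v / k)" unfolding sc_def by (intro image_eqI[of _ _ "k * q"]) auto
    qed
    then show "e \<le> emeasure P {\<omega>\<in>space P. good R M (sc (w v / k)) \<omega> v}"
      unfolding e_def using good_mono mg by (intro emeasure_mono) auto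
  qed
  also have "\<dots> \<le> (\<Sum>k\<in>K. emeasure P {\<omega>\<in>space P. good R M (sc (w v / k)) \<omega> v})"
    using K(1) by (intro sum_mono2) (auto simp: K0_def)
  also have "\<dots> = (\<Sum>a\<in>A v. emeasure P {\<omega>\<in>space P. good R M (sc a) \<omega> v})"
  proof -
    have "inj_on (\<lambda>k. w v / k) K"
      using K(3) w_pos[of v] by (intro inj_onI) (auto simp: field_simps)
    then show ?thesis unfolding A_def by (simp add: sum.reindex)
  qed
  also have "\<dots> = (\<integral>\<^sup>+\<omega>. (\<Sum>a\<in>A v. indicator {\<omega>\<in>space P. good R M (sc a) \<omega> v} \<omega>) \<partial>P)"
    using mg by (subst nn_integral_sum) auto
  also have "\<dots> = (\<integral>\<^sup>+\<omega>. csum (\<lambda>y. f \<omega> v y) \<partial>P)"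
    by (intro nn_integral_cong) (simp add: out)
  also have "\<dots> = (\<integral>\<^sup>+\<omega>. csum (\<lambda>x. f \<omega> x v * ennreal (w x / w v)) \<partial>P)"
    using fm finv by (rule mass_transport)
  also have "\<dots> \<le> (\<integral>\<^sup>+\<omega>. of_nat (card K) * ennreal (real N / real M) \<partial>P)"
    by (intro nn_integral_mono inn)
  also have "\<dots> = of_nat (card K) * ennreal (real N / real M)" by (simp add: emeasure_space_1)
  \<comment> \<open>The Folner property: returning from \<open>card K\<close> to
    \<open>card K0\<close> costs the factor 2, and then \<open>card K0\<close> cancels.\<close>
  also have "\<dots> \<le> of_nat (2 * card K0) * ennreal (real N / real M)"
    using K(4) unfolding K0_def[symmetric] by (intro mult_right_mono) (simp_all only: of_nat_le_iff zero_le)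
  finally have le: "of_nat (card K0) * e \<le> of_nat (2 * card K0) * ennreal (real N / real M)" .
  have "card K > 0" using K(1,2) by (simp add: card_gt_0_iff)
  then have c0: "card K0 > 0" using K(4) unfolding K0_def[symmetric] by linarith
  have e1: "e = ennreal (measure P {\<omega>\<in>space P. good R M ((*) (w v) ` Q) \<omega> v})"
    unfolding e_def by (rule emeasure_eq_measure)
  define m where "m = measure P {\<omega>\<in>space P. good R M ((*) (w v) ` Q) \<omega> v}"
  have "ennreal (real (card K0) * m) \<le> ennreal (real (2 * card K0) * (real N / real M))"
    using le unfolding e1 m_def[symmetric]
    by (simp add: ennreal_of_nat_eq_real_of_nat ennreal_mult'[symmetric] m_def)
  then have "real (card K0) * m \<le> real (2 * card K0) * (real N / real M)"
    by (subst (asm) ennreal_le_iff) auto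
  then have "real (card K0) * m \<le> real (card K0) * (2 * real N / real M)" by (simp add: mult_ac)
  then have "m \<le> 2 * real N / real M" by (rule mult_left_le_imp_le) (use c0 in simp)
  then show ?thesis unfolding e_def[symmetric] e1 m_def[symmetric] N_def by (rule ennreal_leI)
qed

lemma finite_subset_gball: "finite F \<Longrightarrow> \<exists>n. F \<subseteq> gball G n v"
proof (induction F rule: finite_induct)
  case (insert x F)
  then obtain n where "F \<subseteq> gball G n v" by blast
  moreover obtain m where "x \<in> gball G m v" using ex_gball by blast
  ultimately have "insert x F \<subseteq> gball G (max n m) v"
    using gball_mono[of n "max n m" v] gball_mono[of m "max n m" v] by auto
  then show ?case by blast
qed simp

text \<open>At a trifurcation each branch almost surely has \<open>M\<close> points at least as
  heavy as \<open>v\<close>, all inside some finite ball. The events \<open>good\<close> for the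
  weights in growing balls thus exhaust it, and the bound of \<open>emeasure_good_le\<close> does
  not depend on the window.\<close>

lemma no_trif:
  assumes p: "0 < p" "p < 1"
  shows "AE \<omega> in P. \<not> trif R \<omega> v"
proof -
  define N where "N = card (gball G (R + R) v)"
  define T where "T = {\<omega>\<in>space P. trif R \<omega> v}"
  have mT: "T \<in> sets P" using pred_trif[of R v] by (simp add: T_def pred_def)
  have le: "measure P T \<le> 2 * real N / real M" if M: "M > 0" for M
  proof -
    define X where "X n = {\<omega>\<in>space P. good R M (w ` gball G n v) \<omega> v}" for n
    have mX: "X n \<in> sets P" for n using pred_good by (simp add: X_def pred_def)
    have X: "emeasure P (X n) \<le> ennreal (2 * real N / real M)" for n
    proof -
      \<comment> \<open>The ratios \<open>w y / w v\<close> serve as \<open>Q\<close>, so that the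
        window consists of the weights found in the ball.\<close>
      have "(*) (w v) ` (\<lambda>y. w y / w v) ` gball G n v = w ` gball G n v"
        using w_pos[of v] by (simp add: image_image)
      moreover have "q > 0" if "q \<in> (\<lambda>y. w y / w v) ` gball G n v" for q using that w_pos by auto
      ultimately show ?thesis
        using emeasure_good_le[of "(\<lambda>y. w y / w v) ` gball G n v" M R v] M finite_gball
        by (simp add: X_def N_def)
    qed
    have inc: "incseq X"
      unfolding X_def incseq_def using good_mono[OF _ image_mono[OF gball_mono]] by blast
    have "AE \<omega> in P. \<omega> \<in> T \<longrightarrow> \<omega> \<in> (\<Union>n. X n)"
      using heavy_branch_unbounded[OF p finite_gball[of R v], of "w v"]
    proof (rule AE_mp[OF _ AE_I2], intro impI)
      fix \<omega> assume sp: "\<omega> \<in> space P" and tr: "\<omega> \<in> T"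
        and inf: "\<forall>z. z \<notin> gball G R v \<longrightarrow> inf_weight (component \<omega> (gball G R v) z) \<longrightarrow>
          infinite (component \<omega> (gball G R v) z \<inter> above (w v))"
      let ?B = "gball G R v"
      \<comment> \<open>Holding for all larger radii as well, the three statements can be met at one
        common radius.\<close>
      have ev: "\<exists>n. \<forall>m\<ge>n. at_least M {y. reach (opn \<omega>) ?B z y \<and> w v \<le> w y \<and> w y \<in> w ` gball G m v}"
        if z: "z \<notin> ?B" "inf_weight (component \<omega> ?B z)" for z
      proof -
        have "at_least M (component \<omega> ?B z \<inter> above (w v))" using inf z infinite_at_least by blast
        then obtain F where F: "finite F" "F \<subseteq> component \<omega> ?B z \<inter> above (w v)" "card F = M"
          by (auto simp: at_least_def)
        obtain n where n: "F \<subseteq> gball G n v" using finite_subset_gball[OF F(1)] by blast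
        have "at_least M {y. reach (opn \<omega>) ?B z y \<and> w v \<le> w y \<and> w y \<in> w ` gball G m v}" if "m \<ge> n" for m
        proof -
          have "F \<subseteq> gball G m v" using n gball_mono[OF that] by blast
          then show ?thesis unfolding at_least_def using F by (intro exI[of _ F]) (auto simp: above_def)
        qed
        then show ?thesis by blast
      qed
      have tr': "thin \<omega> v" "ball_open R \<omega> v" "branches R (\<lambda>z. inf_weight (component \<omega> ?B z)) \<omega> v"
        using tr by (auto simp: T_def trif_def)
      obtain z1 z2 z3 where z: "\<not> reach (opn \<omega>) ?B z1 z2" "\<not> reach (opn \<omega>) ?B z1 z3" "\<not> reach (opn \<omega>) ?B z2 z3"
        and zz: "\<And>z. z \<in> {z1, z2, z3} \<Longrightarrow> z \<notin> ?B \<and> reach (opn \<omega>) {} v z \<and> inf_weight (component \<omega> ?B z)"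
        using tr'(3) unfolding branches_def by blast
      obtain n1 where n1:
        "\<forall>m\<ge>n1. at_least M {y. reach (opn \<omega>) ?B z1 y \<and> w v \<le> w y \<and> w y \<in> w ` gball G m v}"
        using ev[of z1] zz[of z1] by auto
      obtain n2 where n2:
        "\<forall>m\<ge>n2. at_least M {y. reach (opn \<omega>) ?B z2 y \<and> w v \<le> w y \<and> w y \<in> w ` gball G m v}"
        using ev[of z2] zz[of z2] by auto
      obtain n3 where n3:
        "\<forall>m\<ge>n3. at_least M {y. reach (opn \<omega>) ?B z3 y \<and> w v \<le> w y \<and> w y \<in> w ` gball G m v}"
        using ev[of z3] zz[of z3] by auto
      have "good R M (w ` gball G (n1 + n2 + n3) v) \<omega> v"
        unfolding good_def branches_def
      proof (intro conjI exI)
        show "\<not> reach (opn \<omega>) ?B z1 z2" "\<not> reach (opn \<omega>) ?B z1 z3" "\<not> reach (opn \<omega>) ?B z2 z3" by fact+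
      qed (use tr' zz[of z1] zz[of z2] zz[of z3] n1 n2 n3 in auto)
      then show "\<omega> \<in> (\<Union>n. X n)" using sp by (auto simp: X_def)
    qed
    then have "emeasure P T \<le> emeasure P (\<Union>n. X n)"
      using mX by (intro emeasure_mono_AE) auto
    also have "\<dots> = (SUP n. emeasure P (X n))"
      using mX inc by (intro SUP_emeasure_incseq[symmetric]) auto
    also have "\<dots> \<le> ennreal (2 * real N / real M)" by (intro SUP_least X)
    finally show ?thesis unfolding emeasure_eq_measure by (subst (asm) ennreal_le_iff) auto
  qed
  have "measure P T = 0"
  proof (rule ccontr)
    assume "measure P T \<noteq> 0"
    then have pos: "measure P T > 0" by (simp add: zero_less_measure_iff)
    obtain M :: nat where M: "2 * real N / measure P T < M" using reals_Archimedean2 by blast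
    then have "M > 0" using pos by (metis divide_nonneg_pos mult_nonneg_nonneg of_nat_0_le_iff of_nat_0_less_iff order_le_less_trans zero_le_numeral)
    then show False using le[of M] M pos by (simp add: field_simps)
  qed
  then have "emeasure P T = 0" by (simp add: emeasure_eq_measure)
  then show ?thesis using mT by (subst AE_iff_measurable[OF mT]) (auto simp: T_def)
qed

section \<open>Trifurcations out of thin clusters\<close>

lemma inf_weight_Un: assumes "inf_weight (A \<union> B)" shows "inf_weight A \<or> inf_weight B"
proof (rule ccontr)
  assume "\<not> ?thesis"
  then obtain m n :: nat where
    m: "\<And>F. finite F \<Longrightarrow> F \<subseteq> A \<Longrightarrow> sum w F < m" and n: "\<And>F. finite F \<Longrightarrow> F \<subseteq> B \<Longrightarrow> sum w F < n"
    unfolding inf_weight_def by (metis not_le)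
  obtain F where F: "finite F" "F \<subseteq> A \<union> B" "real (m + n) \<le> sum w F"
    using assms unfolding inf_weight_def by blast
  have "sum w F = sum w (F \<inter> A) + sum w (F - A)" using F(1) by (simp add: sum.Int_Diff)
  also have "\<dots> < m + n" using m[of "F \<inter> A"] n[of "F - A"] F by fastforce
  finally show False using F(3) by simp
qed

lemma inf_weight_UN:
  assumes "finite I" "inf_weight (\<Union>i\<in>I. A i)" shows "\<exists>i\<in>I. inf_weight (A i)"
  using assms
proof (induction I rule: finite_induct)
  case empty
  then show ?case using inf_weight_infinite[of "{}"] by simp
next
  case (insert i I)
  then show ?case using inf_weight_Un[of "A i" "\<Union>i\<in>I. A i"] by auto
qed

text \<open>Outside \<open>B\<close> the cluster is covered by the components of the finitely many
  vertices adjacent to \<open>B\<close>; since \<open>B\<close> itself has finite weight, one of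
  these components is heavy.\<close>

lemma heavy_branch_exists:
  assumes B: "finite B" "x \<in> B" and inf_weight: "inf_weight (cluster \<omega> x)"
  shows "\<exists>b z. b \<in> B \<and> z \<notin> B \<and> opn \<omega> b z \<and> reach (opn \<omega>) {} x z \<and> inf_weight (component \<omega> B z)"
proof -
  define Z where "Z = {z. z \<notin> B \<and> (\<exists>b\<in>B. opn \<omega> b z) \<and> reach (opn \<omega>) {} x z}"
  have "Z \<subseteq> (\<Union>b\<in>B. {z. G b z})" by (auto simp: Z_def open_subgraph_def)
  moreover have "finite (\<Union>b\<in>B. {z. G b z})" using B(1) fin_nbrs by blast
  ultimately have finZ: "finite Z" by (rule finite_subset)
  have "cluster \<omega> x \<subseteq> B \<union> (\<Union>z\<in>Z. component \<omega> B z)"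
  proof
    fix y assume "y \<in> cluster \<omega> x"
    then have xy: "reach (opn \<omega>) {} x y" by simp
    show "y \<in> B \<union> (\<Union>z\<in>Z. component \<omega> B z)"
    proof (cases "y \<in> B")
      case False
      have "(opn \<omega>)\<^sup>*\<^sup>* y x" using reach_sym[OF opn_sym xy] by (simp add: reach_empty)
      then obtain a b where ab: "reach (opn \<omega>) B y a" "opn \<omega> a b" "b \<in> B"
        using reach_first_entry False B(2) by metis
      have "reach (opn \<omega>) {} x a" using xy reach_rtranclp[OF ab(1)] reach_trans by (metis reach_empty)
      then have "a \<in> Z" using ab reach_end[OF ab(1)] opn_sym[of \<omega>] by (auto simp: Z_def symp_def)
      moreover have "y \<in> component \<omega> B a" using reach_sym[OF opn_sym ab(1)] by simp
      ultimately show ?thesis by blast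
    qed simp
  qed
  then have "inf_weight (B \<union> (\<Union>z\<in>Z. component \<omega> B z))" using inf_weight inf_weight_mono by blast
  moreover have "\<not> inf_weight B" using B(1) inf_weight_infinite by blast
  ultimately have "inf_weight (\<Union>z\<in>Z. component \<omega> B z)" using inf_weight_Un by blast
  then obtain z where "z \<in> Z" "inf_weight (component \<omega> B z)" using inf_weight_UN[OF finZ] by blast
  then show ?thesis by (auto simp: Z_def)
qed

text \<open>Two thin clusters cover only finitely many vertices of a level, so a vertex of a third
  remains.\<close>

lemma three_thin:
  assumes inf: "infinite {y \<in> level v. thin \<omega> y}"
  shows "\<exists>x1 x2 x3. thin \<omega> x1 \<and> thin \<omega> x2 \<and> thin \<omega> x3 \<and>
    \<not> reach (opn \<omega>) {} x1 x2 \<and> \<not> reach (opn \<omega>) {} x1 x3 \<and> \<not> reach (opn \<omega>) {} x2 x3"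
proof -
  define L where "L = {y \<in> level v. thin \<omega> y}"
  have L: "infinite L" using inf by (simp add: L_def)
  have fin: "finite (cluster \<omega> x \<inter> L)" if "x \<in> L" for x
    using that by (auto simp: L_def thin_def intro: finite_subset[of _ "cluster \<omega> x \<inter> level v"])
  obtain x1 where x1: "x1 \<in> L" using L by (metis finite.emptyI ex_in_conv)
  have "\<not> L \<subseteq> cluster \<omega> x1 \<inter> L" using L fin[OF x1] finite_subset by blast
  then have "L - cluster \<omega> x1 \<noteq> {}" by blast
  then obtain x2 where x2: "x2 \<in> L - cluster \<omega> x1" by blast
  have "\<not> L \<subseteq> (cluster \<omega> x1 \<inter> L) \<union> (cluster \<omega> x2 \<inter> L)"
    using L fin[OF x1] fin[of x2] x2 finite_subset by blast
  then obtain x3 where "x3 \<in> L" "x3 \<notin> cluster \<omega> x1" "x3 \<notin> cluster \<omega> x2" by blast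
  then show ?thesis using x1 x2 by (intro exI[of _ x1] exI[of _ x2] exI[of _ x3]) (auto simp: L_def)
qed

text \<open>Three clusters are joined by opening a ball meeting all of them together with one edge from
  the ball to a heavy component of each, and closing all other edges at the ball.\<close>

lemma create_trif:
  assumes thin: "thin \<omega> x1" "thin \<omega> x2" "thin \<omega> x3"
    and sep: "\<not> reach (opn \<omega>) {} x1 x2" "\<not> reach (opn \<omega>) {} x1 x3" "\<not> reach (opn \<omega>) {} x2 x3"
  shows "\<exists>R O'. finite O' \<and> O' \<subseteq> edges G \<and>
    trif R (upd {e \<in> edges G. e \<inter> gball G R v \<noteq> {}} O' \<omega>) v"
proof -
  obtain R where R: "{x1, x2, x3} \<subseteq> gball G R v" using finite_subset_gball[of "{x1, x2, x3}" v] by auto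
  define B where "B = gball G R v"
  have finB: "finite B" by (simp add: B_def finite_gball)
  have ex: "\<exists>b z. b \<in> B \<and> z \<notin> B \<and> opn \<omega> b z \<and> reach (opn \<omega>) {} x z \<and> inf_weight (component \<omega> B z)"
    if "x \<in> {x1, x2, x3}" for x
    using heavy_branch_exists[OF finB, of x \<omega>] that R thin by (auto simp: B_def thin_def)
  obtain b1 z1 where z1: "b1 \<in> B" "z1 \<notin> B" "opn \<omega> b1 z1" "reach (opn \<omega>) {} x1 z1" "inf_weight (component \<omega> B z1)"
    using ex[of x1] by auto
  obtain b2 z2 where z2: "b2 \<in> B" "z2 \<notin> B" "opn \<omega> b2 z2" "reach (opn \<omega>) {} x2 z2" "inf_weight (component \<omega> B z2)"
    using ex[of x2] by auto
  obtain b3 z3 where z3: "b3 \<in> B" "z3 \<notin> B" "opn \<omega> b3 z3" "reach (opn \<omega>) {} x3 z3" "inf_weight (component \<omega> B z3)"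
    using ex[of x3] by auto
  define links where "links = {(b1, z1), (b2, z2), (b3, z3)}"
  have lk: "b \<in> B \<and> z \<notin> B \<and> G b z" if "(b, z) \<in> links" for b z
    using that z1 z2 z3 by (auto simp: links_def open_subgraph_def)
  define O' where "O' = {{u, t} | u t. G u t \<and> u \<in> B \<and> t \<in> B} \<union> (\<lambda>(b, z). {b, z}) ` links"
  have "O' \<subseteq> edges G" unfolding O'_def using lk by (auto simp: edges_def)
  moreover have "finite O'"
  proof -
    have "{{u, t} | u t. G u t \<and> u \<in> B \<and> t \<in> B} \<subseteq> Pow B" by auto
    then have "finite {{u, t} | u t. G u t \<and> u \<in> B \<and> t \<in> B}" using finB by (meson finite_Pow_iff finite_subset)
    then show ?thesis by (simp add: O'_def links_def)
  qed
  moreover have "trif R (upd {e \<in> edges G. e \<inter> B \<noteq> {}} O' \<omega>) v"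
  proof -
    define D where "D = {e \<in> edges G. e \<inter> B \<noteq> {}}"
    define \<omega>' where "\<omega>' = upd D O' \<omega>"
    have rB: "reach (opn \<omega>') B s t \<longleftrightarrow> reach (opn \<omega>) B s t" for s t
      unfolding reach_def \<omega>'_def avoid_upd[OF D_def] ..
    have inB: "opn \<omega>' u t \<longleftrightarrow> G u t \<and> {u, t} \<in> O'" if "u \<in> B \<or> t \<in> B" for u t
      using that edge_mem[of u t] by (auto simp: open_subgraph_def \<omega>'_def upd_def D_def)
    have outB: "opn \<omega>' u t \<longleftrightarrow> opn \<omega> u t" if "u \<notin> B" "t \<notin> B" for u t
      using that by (auto simp: open_subgraph_def \<omega>'_def upd_def D_def)
    have ball: "ball_open R \<omega>' v"
      unfolding ball_open_def B_def[symmetric] using inB by (auto simp: O'_def)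
    have link_open: "opn \<omega>' b z" if "(b, z) \<in> links" for b z
      using lk[OF that] that inB[of b z] by (auto simp: O'_def)
    have linked: "reach (opn \<omega>') {} v t" if bz: "(b, z) \<in> links" and t: "t \<in> component \<omega> B z" for b z t
    proof -
      have "(induced (opn \<omega>') B)\<^sup>*\<^sup>* b v" unfolding B_def
        using hub_ball[OF ball] lk[OF bz] by (simp add: B_def)
      then have "reach (opn \<omega>') {} b v" using lk[OF bz] by (intro induced_reach[of _ B]) auto
      then have "reach (opn \<omega>') {} v b" by (rule reach_sym[OF opn_sym])
      then have "reach (opn \<omega>') {} v z" using link_open[OF bz] by (auto intro: reach_step)
      moreover have "reach (opn \<omega>') {} z t" using t reach_rtranclp[of "opn \<omega>'" B z t] by (simp add: rB reach_empty)
      ultimately show ?thesis by (rule reach_trans)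
    qed
    \<comment> \<open>The links are the only open edges leaving the ball, so the new cluster stays
      in \<open>S\<close>. Its levels are then finite, being contained in the ball and the levels of
      three thin clusters.\<close>
    define S where "S = B \<union> component \<omega> B z1 \<union> component \<omega> B z2 \<union> component \<omega> B z3"
    have links_S: "z \<in> S" if "(b, z) \<in> links" for b z
      using that z1 z2 z3 by (auto simp: links_def S_def intro: reach_refl)
    have cl_sub: "t \<in> S" if "reach (opn \<omega>') {} v t" for t
      using that
    proof (induction rule: reach_induct)
      case base
      show ?case by (simp add: S_def B_def gball_self)
    next
      case (step a b)
      show ?case
      proof (cases "b \<in> B")
        case True
        then show ?thesis by (simp add: S_def)
      next
        case b: False
        show ?thesis
        proof (cases "a \<in> B")
          case True
          then have "{a, b} \<in> O'" using inB step by blast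
          moreover have "{a, b} \<notin> {{u, t} | u t. G u t \<and> u \<in> B \<and> t \<in> B}"
            using b by (auto simp: doubleton_eq_iff)
          ultimately obtain c z where cz: "(c, z) \<in> links" "{a, b} = {c, z}" unfolding O'_def by auto
          then have "b = z" using lk[OF cz(1)] b True by (auto simp: doubleton_eq_iff)
          then show ?thesis using links_S[OF cz(1)] by simp
        next
          case False
          then have "opn \<omega> a b" using outB step b by blast
          then show ?thesis using step False b by (auto simp: S_def intro: reach_step)
        qed
      qed
    qed
    have thin': "thin \<omega>' v"
    proof -
      have "component \<omega> B z1 \<subseteq> cluster \<omega>' v" using linked[of b1 z1] by (auto simp: links_def)
      then have "inf_weight (cluster \<omega>' v)" using z1(5) inf_weight_mono by blast
      moreover have "finite (cluster \<omega>' v \<inter> level y)" for y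
      proof -
        have sub: "component \<omega> B z \<subseteq> cluster \<omega> x" if "reach (opn \<omega>) {} x z" for x z
        proof
          fix t assume "t \<in> component \<omega> B z"
          then have "reach (opn \<omega>) {} z t" using reach_rtranclp by (auto simp: reach_empty)
          then show "t \<in> cluster \<omega> x" using reach_trans[OF that] by simp
        qed
        have "cluster \<omega>' v \<inter> level y \<subseteq> B \<union> (cluster \<omega> x1 \<inter> level y) \<union> (cluster \<omega> x2 \<inter> level y) \<union> (cluster \<omega> x3 \<inter> level y)"
          using cl_sub sub[OF z1(4)] sub[OF z2(4)] sub[OF z3(4)] unfolding S_def by blast
        moreover have "finite (B \<union> (cluster \<omega> x1 \<inter> level y) \<union> (cluster \<omega> x2 \<inter> level y) \<union> (cluster \<omega> x3 \<inter> level y))"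
          using finB thin by (simp add: thin_def)
        ultimately show ?thesis by (rule finite_subset)
      qed
      ultimately show ?thesis by (simp add: thin_def)
    qed
    have nosep: "\<not> reach (opn \<omega>) B s t"
      if "\<not> reach (opn \<omega>) {} x y" "reach (opn \<omega>) {} x s" "reach (opn \<omega>) {} y t" for x y s t
    proof
      assume "reach (opn \<omega>) B s t"
      then have "reach (opn \<omega>) {} s t" using reach_rtranclp by (auto simp: reach_empty)
      then show False using that reach_sym[OF opn_sym] reach_trans by metis
    qed
    have "branches R (\<lambda>z. inf_weight (component \<omega>' B z)) \<omega>' v"
      unfolding branches_def B_def[symmetric] rB
    proof (intro exI conjI)
      show "\<not> reach (opn \<omega>) B z1 z2" using nosep[OF sep(1) z1(4) z2(4)] .
      show "\<not> reach (opn \<omega>) B z1 z3" using nosep[OF sep(2) z1(4) z3(4)] .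
      show "\<not> reach (opn \<omega>) B z2 z3" using nosep[OF sep(3) z2(4) z3(4)] .
      show "reach (opn \<omega>') {} v z1" using linked[of b1 z1 z1] z1(2) by (auto simp: links_def reach_refl)
      show "reach (opn \<omega>') {} v z2" using linked[of b2 z2 z2] z2(2) by (auto simp: links_def reach_refl)
      show "reach (opn \<omega>') {} v z3" using linked[of b3 z3 z3] z3(2) by (auto simp: links_def reach_refl)
    qed (use z1 z2 z3 in auto)
    then show ?thesis using thin' ball unfolding trif_def \<omega>'_def D_def B_def by simp
  qed
  ultimately show ?thesis unfolding B_def by blast
qed

text \<open>The radius and edge set from \<open>create_trif\<close> depend on the configuration, but
  there are only countably many choices, and by finite energy each fixed choice almost surely
  produces no trifurcation.\<close>

lemma no_thin:
  assumes p: "0 < p" "p < 1"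
  shows "AE \<omega> in P. \<forall>x. \<not> thin \<omega> x"
proof -
  define D where "D R v = {e \<in> edges G. e \<inter> gball G R v \<noteq> {}}" for R v
  have ce: "countable (edges G)"
    by (rule countable_subset[OF _ countable_finite_sets]) (auto simp: edges_def)
  have "AE \<omega> in P. \<not> trif R (upd (D R v) O' \<omega>) v" for R v O'
  proof (rule finite_energy[OF _ _ _ p])
    show "Measurable.pred P (\<lambda>\<omega>. \<not> trif R \<omega> v)" by measurable
    show "finite (D R v)" unfolding D_def by (rule finite_edges_at[OF finite_gball])
    show "D R v \<subseteq> edges G" by (auto simp: D_def)
  qed (rule no_trif[OF p])
  then have "AE \<omega> in P. \<forall>v. \<forall>R. \<forall>O'\<in>{O'. finite O' \<and> O' \<subseteq> edges G}. \<not> trif R (upd (D R v) O' \<omega>) v"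
    by (intro AE_all_v AE_all_countable[THEN iffD2] allI
        AE_ball_countable[OF countable_Collect_finite_subset[OF ce], THEN iffD2] ballI)
  with infinitely_many_thin show ?thesis
  proof eventually_elim
    case (elim \<omega>)
    show ?case
    proof (intro allI notI)
      fix x assume "thin \<omega> x"
      then have "infinite {y \<in> level x. thin \<omega> y}" using elim(1) by blast
      then obtain x1 x2 x3 where "thin \<omega> x1" "thin \<omega> x2" "thin \<omega> x3"
        "\<not> reach (opn \<omega>) {} x1 x2" "\<not> reach (opn \<omega>) {} x1 x3" "\<not> reach (opn \<omega>) {} x2 x3"
        using three_thin by blast
      then show False using create_trif[of \<omega> x1 x2 x3 x] elim(2) unfolding D_def by blast
    qed
  qed
qed

section \<open>The endpoints \<open>p = 0\<close> and \<open>p = 1\<close>, and the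
  conclusion\<close>

lemma AE_coord:
  assumes "pmf (bernoulli_pmf p) b = 0"
  shows "AE \<omega> in P. \<forall>x y. G x y \<longrightarrow> \<omega> {x, y} = (\<not> b)"
proof -
  have "AE \<omega> in P. \<omega> e = (\<not> b)" if e: "e \<in> edges G" for e
  proof -
    have "emeasure P {\<omega>\<in>space P. True \<and> \<omega> e = b} = 0"
      using emeasure_coord[of "\<lambda>_. True" e b] e assms by simp
    moreover have "Measurable.pred P (\<lambda>\<omega>. \<omega> e = b)" using measurable_coord[OF e] by measurable
    ultimately show ?thesis by (subst AE_iff_measurable[OF _ refl]) (auto simp: pred_def)
  qed
  then have "AE \<omega> in P. G x y \<longrightarrow> \<omega> {x, y} = (\<not> b)" for x y
    by (cases "G x y") (auto simp: edge_mem)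
  then show ?thesis by (intro AE_all_v)
qed

text \<open>Infinitely many vertices of one level have infinite weight outright, so only the other
  direction is probabilistic. Finite energy requires \<open>0 < p < 1\<close>; at
  \<open>p = 0\<close> clusters are single vertices, at \<open>p = 1\<close> there is one cluster
  containing every level.\<close>

theorem heavy_iff_infinite_levels:
  "AE \<omega> in P. \<forall>C\<in>clusters G \<omega>. heavy G r C \<longleftrightarrow> (\<forall>L. is_level G L \<longrightarrow> infinite (C \<inter> L))"
proof -
  have "AE \<omega> in P. \<forall>x. inf_weight (cluster \<omega> x) \<longrightarrow> (\<forall>y. infinite (cluster \<omega> x \<inter> level y))"
  proof -
    consider "p = 0" | "p = 1" | "0 < p" "p < 1" using p01 by linarith
    then show ?thesis
    proof cases
      case 1
      then have "AE \<omega> in P. \<forall>x y. G x y \<longrightarrow> \<omega> {x, y} = (\<not> True)" by (intro AE_coord) simp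
      then show ?thesis
      proof eventually_elim
        case (elim \<omega>)
        have "cluster \<omega> x \<subseteq> {x}" for x
        proof
          fix y assume "y \<in> cluster \<omega> x"
          then have "reach (opn \<omega>) {} x y" by simp
          then show "y \<in> {x}"
            by (induction rule: reach_induct) (use elim in \<open>auto simp: open_subgraph_def\<close>)
        qed
        then show ?case using inf_weight_infinite finite_subset by (meson finite.emptyI finite_insert)
      qed
    next
      case 2
      then have "AE \<omega> in P. \<forall>x y. G x y \<longrightarrow> \<omega> {x, y} = (\<not> False)" by (intro AE_coord) simp
      then show ?thesis
      proof eventually_elim
        case (elim \<omega>)
        then have "opn \<omega> = G" by (auto simp: open_subgraph_def fun_eq_iff)
        then have "cluster \<omega> x = UNIV" for x using conn by (auto simp: reach_empty)
        then show ?case using infinite_level by simp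
      qed
    next
      case 3
      \<comment> \<open>A heavy cluster that is not thin meets some level infinitely often, and
        \<open>hit_levels\<close> carries this to all levels.\<close>
      from no_thin[OF 3] hit_levels[OF 3(1)] show ?thesis
        by eventually_elim (unfold thin_def, blast)
    qed
  qed
  then show ?thesis
  proof eventually_elim
    case (elim \<omega>)
    show ?case
    proof
      fix C assume "C \<in> clusters G \<omega>"
      then obtain x where x: "C = cluster \<omega> x" by (auto simp: clusters_def reach_empty)
      have "inf_weight C" if "infinite (C \<inter> level r)"
        using infinite_subset_level_inf_weight[OF that, of r] inf_weight_mono by blast
      then show "heavy G r C \<longleftrightarrow> (\<forall>L. is_level G L \<longrightarrow> infinite (C \<inter> L))"
        using elim x by (auto simp: heavy_iff_inf_weight is_level_iff)
    qed
  qed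
qed

end

theorem corollary5p10:
  fixes G :: "'v graph" and r :: 'v and p :: real
  assumes "transitive_graph G"
    and "\<not> unimodular G"
    and "0 \<le> p" and "p \<le> 1"
  shows "AE \<omega> in bernoulli_percolation G p.
           \<forall>C\<in>clusters G \<omega>. heavy G r C \<longleftrightarrow> (\<forall>L. is_level G L \<longrightarrow> infinite (C \<inter> L))"
proof -
  interpret percolation G r p by unfold_locales (fact assms)+
  show ?thesis by (rule heavy_iff_infinite_levels)
qed

end
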